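(* Let $K$ be a number field with ring of integers $R$, let $G$ be a finite abelian group of odd order, let $A$ be an $R$-Hopf order in $\mathrm{Map}(G,K)$ such that $\varepsilon_A(I(A))=\alpha_A^2R$ for some $\alpha_A\in R$, and let $B$ be a principal homogeneous space for $A$. Then $(B,Tr'_B)$ and $(A,Tr'_A)$ are isomorphic $G$-quadratic spaces if and only if $B$ is a free $A^D$-module.
   Context: $\mathrm{Map}(G,K)$ is the $K$-Hopf algebra of functions $G\to K$, with $\Delta(f)(g\otimes h)=f(gh)$, antipode $S(f)(g)=f(g^{-1})$ and counit $\varepsilon(f)=f(1_G)$. An $R$-Hopf order $A$ in $\mathrm{Map}(G,K)$ is an $R$-order in this $K$-algebra which inherits the structure of an $R$-Hopf algebra ($\Delta(A)\subset A\otimes_RA$, $S(A)\subset A$, $\varepsilon(A)\subset R$); $\varepsilon_A$ is its counit. Its dual $A^D=\mathrm{Hom}_R(A,R)$ is identified with $\{x\in K[G]\mid \langle x,f\rangle\in R\ \forall f\in A\}$, where $\langle \sum_g x_g g,f\rangle=\sum_g x_gf(g)$; it is an $R$-Hopf order in $K[G]$ containing $R[G]$. A right $A$-comodule $\rho:M\to M\otimes_RA$, $\rho(m)=\sum m_{(0)}\otimes m_{(1)}$, is a left $A^D$-module by $u\cdot m=\sum u(m_{(1)})m_{(0)}$; in particular $A$ is an $A^D$-module via $\Delta$. A principal homogeneous space for $A$ is a (commutative) $R$-order $B$ with an action of $A^D$ (coming from a right $A$-comodule algebra structure) for which there is an isomorphism $B\otimes_RB\cong B\otimes_RA$ of $B$-algebras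 and $A^D$-modules, where $B$ acts on the left-hand factors and $A^D$ on the right-hand factors; equivalently $B$ is the algebra of a torsor over $\mathrm{Spec}(R)$ under the group scheme $\mathrm{Spec}(A)$. The module of (left) integrals is $I(A)=\{x\in A\mid ax=\varepsilon_A(a)x\ \forall a\in A\}$. Standing hypothesis: the ideal $\varepsilon_A(I(A))$ equals $\alpha_A^2R$ with $\alpha_A\in R$; put $\lambda=\alpha_A^2$. The forms $Tr'_A=\lambda^{-1}Tr_{A_K/K}:A\times A\to R$ and $Tr'_B=\lambda^{-1}Tr_{B_K/K}:B\times B\to R$ (where $Tr(x,y)$ denotes the trace of $xy$, $A_K=A\otimes_RK$, $B_K=B\otimes_RK$) are $G$-invariant, symmetric and non-degenerate over $R$, and up to isometry do not depend on the choice of $\alpha_A$. A $G$-quadratic space (or $G$-form) is a pair $(M,q)$ with $M$ a finitely generated locally free $A^D$-module and $q:M\times M\to R$ an $R$-bilinear, symmetric, non-degenerate form with $q(gm_1,gm_2)=q(m_1,m_2)$ for all $g\in G$. An isomorphism of $G$-quadratic spaces is an $A^D$-module isomorphism preserving the forms. *)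

theory Defs
  imports
    "HOL-Library.Function_Algebras"
    "HOL-Library.Multiset"
    "HOL-Library.Cardinality"
    "HOL-Computational_Algebra.Polynomial"
    "HOL-Algebra.QuotRing"
begin

text \<open>
  Conventions. The number field \<open>K\<close> is a type \<open>'k\<close>, the finite abelian group \<open>G\<close> is a type \<open>'g\<close>,
  written additively. A \<open>K\<close>-algebra is a type \<open>'b :: comm_ring_1\<close> with a scaling
  \<open>sc :: 'k \<Rightarrow> 'b \<Rightarrow> 'b\<close>. Both \<open>Map(G,K)\<close> and \<open>K[G]\<close> live on the type \<open>'g \<Rightarrow> 'k\<close>: the
  (pointwise) ring structure of \<open>Function_Algebras\<close> is the one of \<open>Map(G,K)\<close>; an element
  \<open>\<Sum> x\<^sub>g g\<close> of \<open>K[G]\<close> is its coefficient function, multiplied by convolution \<open>conv\<close>.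
\<close>

section \<open>Number fields and orders\<close>

definition number_field :: "'k::field_char_0 itself \<Rightarrow> bool" where
  "number_field _ \<longleftrightarrow>
     (\<exists>S::'k set. finite S \<and> module.span (\<lambda>(q::rat) x. of_rat q * x) S = UNIV)"

abbreviation ring_of_integers :: "'k::field_char_0 set" where
  "ring_of_integers \<equiv> {x. algebraic_int x}"

definition prime_of_R :: "'k::field_char_0 set \<Rightarrow> bool" where
  "prime_of_R P \<longleftrightarrow> P \<subseteq> ring_of_integers \<and> 0 \<in> P \<and> 1 \<notin> P \<and>
     (\<forall>x\<in>P. \<forall>y\<in>P. x + y \<in> P) \<and> (\<forall>r\<in>ring_of_integers. \<forall>x\<in>P. r * x \<in> P) \<and>
     (\<forall>x\<in>ring_of_integers. \<forall>y\<in>ring_of_integers. x * y \<in> P \<longrightarrow> x \<in> P \<or> y \<in> P)"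

definition K_algebra :: "('k::field_char_0 \<Rightarrow> 'b::comm_ring_1 \<Rightarrow> 'b) \<Rightarrow> bool" where
  "K_algebra sc \<longleftrightarrow> vector_space sc \<and> (\<forall>c x y. sc c (x * y) = sc c x * y)"

definition R_span :: "('k::field_char_0 \<Rightarrow> 'b::ab_group_add \<Rightarrow> 'b) \<Rightarrow> 'b set \<Rightarrow> 'b set" where
  "R_span sc X = {\<Sum>x\<in>F. sc (r x) x | F r. finite F \<and> F \<subseteq> X \<and> (\<forall>x\<in>F. r x \<in> ring_of_integers)}"

definition R_order :: "('k::field_char_0 \<Rightarrow> 'b::comm_ring_1 \<Rightarrow> 'b) \<Rightarrow> 'b set \<Rightarrow> bool" where
  "R_order sc B \<longleftrightarrow> K_algebra sc \<and> 1 \<in> B \<and> (\<forall>x\<in>B. \<forall>y\<in>B. x * y \<in> B) \<and>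
     (\<exists>S. finite S \<and> B = R_span sc S) \<and> module.span sc B = UNIV"

text \<open>Trace of multiplication by \<open>x\<close> on a finite-dimensional \<open>K\<close>-algebra; the value does not depend
  on the chosen basis.\<close>

definition alg_trace :: "('k::field_char_0 \<Rightarrow> 'b::comm_ring_1 \<Rightarrow> 'b) \<Rightarrow> 'b \<Rightarrow> 'k" where
  "alg_trace sc x =
     (let E = (SOME E. \<not> module.dependent sc E \<and> module.span sc E = UNIV)
      in \<Sum>e\<in>E. module.representation sc E (x * e) e)"

definition trace_form ::
    "('k::field_char_0 \<Rightarrow> 'b::comm_ring_1 \<Rightarrow> 'b) \<Rightarrow> 'k \<Rightarrow> 'b \<Rightarrow> 'b \<Rightarrow> 'k" where
  "trace_form sc l x y = inverse l * alg_trace sc (x * y)"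

section \<open>Hopf orders in Map(G,K) and their duals\<close>

definition map_scale :: "'k::field_char_0 \<Rightarrow> ('g \<Rightarrow> 'k) \<Rightarrow> ('g \<Rightarrow> 'k)" where
  "map_scale c f = (\<lambda>g. c * f g)"

text \<open>For an order \<open>B\<close> of \<open>B\<^sub>K\<close> and an order \<open>A\<close> of \<open>Map(G,K)\<close>, orders being flat over \<open>R\<close>,
  \<open>B \<otimes>\<^sub>R A\<close> is a subring of \<open>B\<^sub>K \<otimes>\<^sub>K Map(G,K) = Map(G,B\<^sub>K)\<close>, where \<open>b \<otimes> a\<close> is the map
  \<open>g \<mapsto> a(g) b\<close>. In particular \<open>A \<otimes>\<^sub>R A\<close> lies in \<open>'g \<Rightarrow> 'g \<Rightarrow> 'k\<close>, the \<^emph>\<open>first\<close> argument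
  belonging to the right-hand tensor factor.\<close>

definition tensor_with ::
    "('k::field_char_0 \<Rightarrow> 'b::comm_ring_1 \<Rightarrow> 'b) \<Rightarrow> 'b set \<Rightarrow> ('g \<Rightarrow> 'k) set \<Rightarrow> ('g \<Rightarrow> 'b) set" where
  "tensor_with sc B A =
     R_span (\<lambda>r F g. sc r (F g)) {\<lambda>g. sc (a g) b | b a. b \<in> B \<and> a \<in> A}"

definition comult :: "('g::ab_group_add \<Rightarrow> 'k) \<Rightarrow> 'g \<Rightarrow> 'g \<Rightarrow> 'k" where
  "comult f = (\<lambda>g h. f (h + g))"

definition antipode :: "('g::ab_group_add \<Rightarrow> 'k) \<Rightarrow> 'g \<Rightarrow> 'k" where
  "antipode f = (\<lambda>g. f (- g))"

definition counit :: "('g::ab_group_add \<Rightarrow> 'k) \<Rightarrow> 'k" where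
  "counit f = f 0"

definition hopf_order :: "('g::{finite,ab_group_add} \<Rightarrow> 'k::field_char_0) set \<Rightarrow> bool" where
  "hopf_order A \<longleftrightarrow> R_order map_scale A \<and>
     (\<forall>f\<in>A. comult f \<in> tensor_with map_scale A A) \<and>
     (\<forall>f\<in>A. antipode f \<in> A) \<and> (\<forall>f\<in>A. counit f \<in> ring_of_integers)"

definition integrals :: "('g::{finite,ab_group_add} \<Rightarrow> 'k::field_char_0) set \<Rightarrow> ('g \<Rightarrow> 'k) set" where
  "integrals A = {x \<in> A. \<forall>a\<in>A. a * x = map_scale (counit a) x}"

definition dual :: "('g::finite \<Rightarrow> 'k::field_char_0) set \<Rightarrow> ('g \<Rightarrow> 'k) set" where
  "dual A = {x. \<forall>f\<in>A. (\<Sum>g\<in>UNIV. x g * f g) \<in> ring_of_integers}"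

definition conv :: "('g::{finite,ab_group_add} \<Rightarrow> 'k::field_char_0) \<Rightarrow> ('g \<Rightarrow> 'k) \<Rightarrow> 'g \<Rightarrow> 'k" where
  "conv x y = (\<lambda>g. \<Sum>h\<in>UNIV. x h * y (g - h))"

definition gr_elem :: "'g \<Rightarrow> 'g \<Rightarrow> 'k::field_char_0" where
  "gr_elem g = (\<lambda>h. if h = g then 1 else 0)"

section \<open>Comodule algebras\<close>

text \<open>A right \<open>A\<close>-comodule algebra structure \<open>B \<rightarrow> B \<otimes>\<^sub>R A\<close>, given by its (unique) \<open>K\<close>-linear
  extension \<open>\<rho> : B\<^sub>K \<rightarrow> Map(G,B\<^sub>K)\<close>. If \<open>\<rho>(b) = \<Sum> b\<^sub>i \<otimes> a\<^sub>i\<close>, then at \<open>(g,h)\<close> the element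
  \<open>(\<rho> \<otimes> id)(\<rho>(b))\<close> is \<open>\<Sum> a\<^sub>i(h) \<rho>(b\<^sub>i)(g) = \<rho>(\<rho>(b)(h))(g)\<close> and \<open>(id \<otimes> \<Delta>)(\<rho>(b))\<close> is
  \<open>\<rho>(b)(g + h)\<close>; also \<open>(id \<otimes> \<epsilon>)(\<rho>(b)) = \<rho>(b)(0)\<close>. The products and the unit of
  \<open>'g \<Rightarrow> 'b\<close> are pointwise.\<close>

definition comodule_algebra ::
    "('k::field_char_0 \<Rightarrow> 'b::comm_ring_1 \<Rightarrow> 'b) \<Rightarrow> 'b set \<Rightarrow>
     ('g::{finite,ab_group_add} \<Rightarrow> 'k) set \<Rightarrow> ('b \<Rightarrow> 'g \<Rightarrow> 'b) \<Rightarrow> bool" where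
  "comodule_algebra sc B A \<rho> \<longleftrightarrow>
     (\<forall>x y. \<rho> (x + y) = \<rho> x + \<rho> y) \<and> (\<forall>c x g. \<rho> (sc c x) g = sc c (\<rho> x g)) \<and>
     (\<forall>x y. \<rho> (x * y) = \<rho> x * \<rho> y) \<and> \<rho> 1 = 1 \<and>
     (\<forall>x g h. \<rho> (\<rho> x h) g = \<rho> x (g + h)) \<and> (\<forall>x. \<rho> x 0 = x) \<and>
     (\<forall>b\<in>B. \<rho> b \<in> tensor_with sc B A)"

text \<open>\<open>u \<cdot> m = \<Sum> u(m\<^sub>(\<^sub>1\<^sub>)) m\<^sub>(\<^sub>0\<^sub>)\<close> with \<open>u(a) = \<Sum>\<^sub>g u\<^sub>g a(g)\<close>. For \<open>\<rho> = comult\<close> and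
  \<open>sc = map_scale\<close> this is the \<open>A\<^sup>D\<close>-module structure of \<open>A\<close> itself.\<close>

definition act ::
    "('k::field_char_0 \<Rightarrow> 'b::comm_ring_1 \<Rightarrow> 'b) \<Rightarrow> ('b \<Rightarrow> 'g::finite \<Rightarrow> 'b) \<Rightarrow>
     ('g \<Rightarrow> 'k) \<Rightarrow> 'b \<Rightarrow> 'b" where
  "act sc \<rho> u m = (\<Sum>g\<in>UNIV. sc (u g) (\<rho> m g))"

section \<open>Tensor products of algebras over R\<close>

text \<open>\<open>M \<otimes>\<^sub>R N\<close> by generators and relations: a multiset of pairs from \<open>M \<times> N\<close> stands for the sum of
  the corresponding pure tensors, and \<open>tensor_eq\<close> is the congruence generated by the relations of the
  tensor product. (The quotient monoid is a group as \<open>(m,n) + (-m,n) \<sim> (0,n) \<sim> 0\<close>.)\<close>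

inductive tensor_eq ::
    "('k::field_char_0 \<Rightarrow> 'm::comm_ring_1 \<Rightarrow> 'm) \<Rightarrow> 'm set \<Rightarrow>
     ('k \<Rightarrow> 'n::comm_ring_1 \<Rightarrow> 'n) \<Rightarrow> 'n set \<Rightarrow>
     ('m \<times> 'n) multiset \<Rightarrow> ('m \<times> 'n) multiset \<Rightarrow> bool"
  for scM M scN N where
  refl: "set_mset x \<subseteq> M \<times> N \<Longrightarrow> tensor_eq scM M scN N x x"
| sym: "tensor_eq scM M scN N x y \<Longrightarrow> tensor_eq scM M scN N y x"
| trans: "tensor_eq scM M scN N x y \<Longrightarrow> tensor_eq scM M scN N y z \<Longrightarrow> tensor_eq scM M scN N x z"
| cong: "tensor_eq scM M scN N x y \<Longrightarrow> set_mset z \<subseteq> M \<times> N \<Longrightarrow> tensor_eq scM M scN N (x + z) (y + z)"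
| zero: "0 \<in> M \<Longrightarrow> n \<in> N \<Longrightarrow> tensor_eq scM M scN N {#(0, n)#} {#}"
| add_left: "m \<in> M \<Longrightarrow> m' \<in> M \<Longrightarrow> n \<in> N \<Longrightarrow>
    tensor_eq scM M scN N {#(m + m', n)#} {#(m, n), (m', n)#}"
| add_right: "m \<in> M \<Longrightarrow> n \<in> N \<Longrightarrow> n' \<in> N \<Longrightarrow>
    tensor_eq scM M scN N {#(m, n + n')#} {#(m, n), (m, n')#}"
| balanced: "r \<in> ring_of_integers \<Longrightarrow> m \<in> M \<Longrightarrow> n \<in> N \<Longrightarrow>
    tensor_eq scM M scN N {#(scM r m, n)#} {#(m, scN r n)#}"

definition tensor_class where
  "tensor_class scM M scN N x = {y. tensor_eq scM M scN N x y}"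

definition tensor_ring ::
    "('k::field_char_0 \<Rightarrow> 'm::comm_ring_1 \<Rightarrow> 'm) \<Rightarrow> 'm set \<Rightarrow>
     ('k \<Rightarrow> 'n::comm_ring_1 \<Rightarrow> 'n) \<Rightarrow> 'n set \<Rightarrow> ('m \<times> 'n) multiset set ring" where
  "tensor_ring scM M scN N =
    (let cl = tensor_class scM M scN N in
     \<lparr>carrier = cl ` {x. set_mset x \<subseteq> M \<times> N},
      monoid.mult = (\<lambda>X Y. \<Union>x\<in>X. \<Union>y\<in>Y.
         cl (\<Sum>(m, n)\<in>#x. image_mset (\<lambda>(m', n'). (m * m', n * n')) y)),
      one = cl {#(1, 1)#},
      ring.zero = cl {#},
      add = (\<lambda>X Y. \<Union>x\<in>X. \<Union>y\<in>Y. cl (x + y))\<rparr>)"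

text \<open>The endomorphism \<open>id \<otimes> f\<close>.\<close>

definition tensor_right where
  "tensor_right scM M scN N f X = (\<Union>x\<in>X. tensor_class scM M scN N (image_mset (apsnd f) x))"

section \<open>Principal homogeneous spaces\<close>

text \<open>\<open>B \<noteq> 0\<close> is built into \<open>comm_ring_1\<close>. A ring isomorphism sending each \<open>b \<otimes> 1\<close> to \<open>b \<otimes> 1\<close> is
  an isomorphism of \<open>B\<close>-algebras.\<close>

definition principal_homogeneous_space ::
    "('k::field_char_0 \<Rightarrow> 'b::comm_ring_1 \<Rightarrow> 'b) \<Rightarrow> 'b set \<Rightarrow> ('b \<Rightarrow> 'g \<Rightarrow> 'b) \<Rightarrow>
     ('g::{finite,ab_group_add} \<Rightarrow> 'k) set \<Rightarrow> bool" where
  "principal_homogeneous_space sc B \<rho> A \<longleftrightarrow>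
     R_order sc B \<and> comodule_algebra sc B A \<rho> \<and>
     (\<exists>\<phi> \<in> ring_iso (tensor_ring sc B sc B) (tensor_ring sc B map_scale A).
        (\<forall>b\<in>B. \<phi> (tensor_class sc B sc B {#(b, 1)#}) = tensor_class sc B map_scale A {#(b, 1)#}) \<and>
        (\<forall>u\<in>dual A. \<forall>X\<in>carrier (tensor_ring sc B sc B).
           \<phi> (tensor_right sc B sc B (act sc \<rho> u) X) =
           tensor_right sc B map_scale A (act map_scale comult u) (\<phi> X)))"

section \<open>Modules over the dual and G-quadratic spaces\<close>

text \<open>Below, \<open>D\<close> is a subring of \<open>K[G]\<close>, and \<open>M\<close> a subset of a \<open>K\<close>-space on which \<open>K[G]\<close> acts by
  \<open>a :: ('g \<Rightarrow> 'k) \<Rightarrow> 'b \<Rightarrow> 'b\<close>.\<close>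

definition is_module ::
    "('g::{finite,ab_group_add} \<Rightarrow> 'k::field_char_0) set \<Rightarrow> (('g \<Rightarrow> 'k) \<Rightarrow> 'b::ab_group_add \<Rightarrow> 'b) \<Rightarrow>
     'b set \<Rightarrow> bool" where
  "is_module D a M \<longleftrightarrow>
     0 \<in> M \<and> (\<forall>x\<in>M. \<forall>y\<in>M. x - y \<in> M) \<and> (\<forall>u\<in>D. \<forall>x\<in>M. a u x \<in> M) \<and>
     (\<forall>u\<in>D. \<forall>x\<in>M. \<forall>y\<in>M. a u (x + y) = a u x + a u y) \<and>
     (\<forall>u\<in>D. \<forall>v\<in>D. \<forall>x\<in>M. a (u + v) x = a u x + a v x \<and> a (conv u v) x = a u (a v x)) \<and>
     (\<forall>x\<in>M. a (gr_elem 0) x = x)"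

definition fin_gen ::
    "('g \<Rightarrow> 'k::field_char_0) set \<Rightarrow> (('g \<Rightarrow> 'k) \<Rightarrow> 'b::ab_group_add \<Rightarrow> 'b) \<Rightarrow> 'b set \<Rightarrow> bool" where
  "fin_gen D a M \<longleftrightarrow>
     (\<exists>S. finite S \<and> S \<subseteq> M \<and> (\<forall>m\<in>M. \<exists>c. (\<forall>s\<in>S. c s \<in> D) \<and> m = (\<Sum>s\<in>S. a (c s) s)))"

definition free_module ::
    "('g \<Rightarrow> 'k::field_char_0) set \<Rightarrow> (('g \<Rightarrow> 'k) \<Rightarrow> 'b::ab_group_add \<Rightarrow> 'b) \<Rightarrow> 'b set \<Rightarrow> bool" where
  "free_module D a M \<longleftrightarrow>
     (\<exists>S \<subseteq> M. \<forall>m\<in>M. \<exists>!c. finite {s. c s \<noteq> 0} \<and> {s. c s \<noteq> 0} \<subseteq> S \<and> range c \<subseteq> D \<and>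
        m = (\<Sum>s | c s \<noteq> 0. a (c s) s))"

definition localization :: "('k::field_char_0 \<Rightarrow> 'b \<Rightarrow> 'b) \<Rightarrow> 'k set \<Rightarrow> 'b set \<Rightarrow> 'b set" where
  "localization sc P M = {sc (inverse s) m | s m. s \<in> ring_of_integers - P \<and> m \<in> M}"

definition locally_free ::
    "('k::field_char_0 \<Rightarrow> 'b::comm_ring_1 \<Rightarrow> 'b) \<Rightarrow> ('g \<Rightarrow> 'k) set \<Rightarrow>
     (('g \<Rightarrow> 'k) \<Rightarrow> 'b \<Rightarrow> 'b) \<Rightarrow> 'b set \<Rightarrow> bool" where
  "locally_free sc D a M \<longleftrightarrow>
     (\<forall>P. prime_of_R P \<longrightarrow> free_module (localization map_scale P D) a (localization sc P M))"

definition R_linear_form ::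
    "('k::field_char_0 \<Rightarrow> 'b::comm_ring_1 \<Rightarrow> 'b) \<Rightarrow> 'b set \<Rightarrow> ('b \<Rightarrow> 'k) \<Rightarrow> bool" where
  "R_linear_form sc M f \<longleftrightarrow>
     (\<forall>x\<in>M. f x \<in> ring_of_integers) \<and> (\<forall>x\<in>M. \<forall>y\<in>M. f (x + y) = f x + f y) \<and>
     (\<forall>r\<in>ring_of_integers. \<forall>x\<in>M. f (sc r x) = r * f x)"

text \<open>Non-degenerate over \<open>R\<close> means that \<open>M \<rightarrow> Hom\<^sub>R(M,R)\<close>, \<open>x \<mapsto> q(x,-)\<close>, is bijective.\<close>

definition G_quadratic_space ::
    "('k::field_char_0 \<Rightarrow> 'b::comm_ring_1 \<Rightarrow> 'b) \<Rightarrow> ('g::{finite,ab_group_add} \<Rightarrow> 'k) set \<Rightarrow>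
     (('g \<Rightarrow> 'k) \<Rightarrow> 'b \<Rightarrow> 'b) \<Rightarrow> 'b set \<Rightarrow> ('b \<Rightarrow> 'b \<Rightarrow> 'k) \<Rightarrow> bool" where
  "G_quadratic_space sc D a M q \<longleftrightarrow>
     is_module D a M \<and> fin_gen D a M \<and> locally_free sc D a M \<and>
     (\<forall>x\<in>M. R_linear_form sc M (q x)) \<and> (\<forall>x\<in>M. \<forall>y\<in>M. q x y = q y x) \<and>
     (\<forall>f. R_linear_form sc M f \<longrightarrow> (\<exists>!x. x \<in> M \<and> (\<forall>y\<in>M. q x y = f y))) \<and>
     (\<forall>g. \<forall>x\<in>M. \<forall>y\<in>M. q (a (gr_elem g) x) (a (gr_elem g) y) = q x y)"

definition isometry ::
    "('g \<Rightarrow> 'k) set \<Rightarrow> (('g \<Rightarrow> 'k) \<Rightarrow> 'b \<Rightarrow> 'b) \<Rightarrow> 'b::ab_group_add set \<Rightarrow> ('b \<Rightarrow> 'b \<Rightarrow> 'k) \<Rightarrow>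
     (('g \<Rightarrow> 'k) \<Rightarrow> 'c \<Rightarrow> 'c) \<Rightarrow> 'c::ab_group_add set \<Rightarrow> ('c \<Rightarrow> 'c \<Rightarrow> 'k) \<Rightarrow> ('b \<Rightarrow> 'c) \<Rightarrow> bool" where
  "isometry D a M q a' M' q' \<phi> \<longleftrightarrow>
     bij_betw \<phi> M M' \<and> (\<forall>x\<in>M. \<forall>y\<in>M. \<phi> (x + y) = \<phi> x + \<phi> y) \<and>
     (\<forall>u\<in>D. \<forall>x\<in>M. \<phi> (a u x) = a' u (\<phi> x)) \<and>
     (\<forall>x\<in>M. \<forall>y\<in>M. q' (\<phi> x) (\<phi> y) = q x y)"

definition isomorphic_G_quadratic_spaces ::
    "('g::{finite,ab_group_add} \<Rightarrow> 'k::field_char_0) set \<Rightarrow>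
     ('k \<Rightarrow> 'b::comm_ring_1 \<Rightarrow> 'b) \<Rightarrow> (('g \<Rightarrow> 'k) \<Rightarrow> 'b \<Rightarrow> 'b) \<Rightarrow> 'b set \<Rightarrow> ('b \<Rightarrow> 'b \<Rightarrow> 'k) \<Rightarrow>
     ('k \<Rightarrow> 'c::comm_ring_1 \<Rightarrow> 'c) \<Rightarrow> (('g \<Rightarrow> 'k) \<Rightarrow> 'c \<Rightarrow> 'c) \<Rightarrow> 'c set \<Rightarrow> ('c \<Rightarrow> 'c \<Rightarrow> 'k) \<Rightarrow> bool" where
  "isomorphic_G_quadratic_spaces D sc a M q sc' a' M' q' \<longleftrightarrow>
     G_quadratic_space sc D a M q \<and> G_quadratic_space sc' D a' M' q' \<and>
     (\<exists>\<phi>. isometry D a M q a' M' q' \<phi>)"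

end

theory Submission
  imports Defs "Jordan_Normal_Form.Char_Poly" "HOL-Library.Poly_Mapping"
begin

text \<open>
  Write \<open>D\<close> for the dual of \<open>A\<close>, \<open>\<lambda> = \<alpha>\<^sup>2\<close>, \<open>n\<close> for the order of \<open>G\<close>, and \<open>x \<mapsto> bar x\<close> for the
  involution of a group ring that inverts the elements of \<open>G\<close>.

  The order \<open>A\<close> is itself free of rank one over \<open>D\<close>: if \<open>\<delta>\<close> is the indicator function of the
  neutral element, then \<open>\<lambda>\<delta>\<close> is an integral of \<open>A\<close> and it generates \<open>A\<close> over \<open>D\<close>
  (\<open>regular_cyclic\<close>). This is the theorem of Larson and Sweedler; it says that \<open>A\<close> is self-dual
  under \<open>Tr'\<^sub>A\<close>, and so \<open>(A, Tr'\<^sub>A)\<close> is a \<open>G\<close>-quadratic space. An isomorphism of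
  \<open>G\<close>-quadratic spaces is in particular one of \<open>D\<close>-modules, so if \<open>B\<close> and \<open>A\<close> are isomorphic,
  then \<open>B\<close> is free.

  For the converse let \<open>B\<close> be free. The elements of \<open>B\<close> fixed by \<open>G\<close> are scalars, because
  \<open>B \<otimes> B\<close> is isomorphic to \<open>B \<otimes> A\<close> (\<open>invariant_is_scalar\<close>). Every member of a basis
  contributes its norm to these scalars, so there is only one member: \<open>B = D b\<close> (\<open>free_imp_cyclic\<close>).
  The same one-dimensionality identifies the trace of \<open>B\<^sub>K\<close> with the sum over the \<open>G\<close>-orbit
  (\<open>norm_eq_trace\<close>). Hence
  \<open>Tr'\<^sub>B(ub, vb)\<close> is \<open>\<lambda>\<close> times the coefficient at the neutral element of
  \<open>u (bar v) \<theta>\<close>, where \<open>\<theta>\<close> has the coefficients \<open>\<lambda>\<^sup>-\<^sup>2 Tr(b (kb))\<close>, while for \<open>A\<close>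
  and \<open>\<lambda>\<delta>\<close> the same formula holds with \<open>1\<close> in place of \<open>\<theta>\<close>. An isometry is therefore
  \<open>vb \<mapsto> vW (\<lambda>\<delta>)\<close> for any unit \<open>W\<close> of \<open>D\<close> with \<open>W (bar W) = \<theta>\<close>
  (\<open>isometry_of_norm\<close>).

  Over \<open>B\<close> such a \<open>W\<close> is at hand: the resolvent \<open>r\<close>, the sum of the \<open>\<lambda>\<^sup>-\<^sup>1 (gb) g\<^sup>-\<^sup>1\<close>,
  lies in \<open>B \<otimes> D\<close> and satisfies \<open>r (bar r) = \<theta>\<close>. Its coefficients need not be scalars, but letting
  \<open>k\<close> in \<open>G\<close> act on them multiplies \<open>r\<close> by the group element \<open>k\<close>. So the coefficients of
  \<open>r\<^sup>n\<close> are invariant, \<open>r\<^sup>n\<close> lies in \<open>D\<close>, and \<open>\<theta>\<^sup>n\<close> is the norm of \<open>r\<^sup>n\<close>. Here the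
  order of \<open>G\<close> enters: \<open>n = 2m + 1\<close> is odd and \<open>\<theta>\<close> is a symmetric unit, so \<open>\<theta>\<close> is the norm
  of \<open>W = r\<^sup>n \<theta>\<^sup>-\<^sup>m\<close> (\<open>theta_is_norm\<close>). That \<open>\<theta>\<close> is a unit of \<open>D\<close> comes from the
  surjectivity of \<open>B \<otimes> B \<rightarrow> B \<otimes> A\<close> (\<open>theta_unit\<close>).

  The arithmetic input is that \<open>A\<close> is projective over \<open>R\<close>, used in the form of a dual basis
  (\<open>lattice_dual_basis\<close>). It follows from the invertibility of finitely generated fractional ideals,
  which in turn is read off from a primitive integer polynomial of an algebraic number
  (\<open>invertible_of_integral_multiple\<close>).
\<close>

section \<open>Closure properties of algebraic integers\<close>

text \<open>The number is an eigenvalue of an integer matrix, hence a root of its monic integral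
characteristic polynomial.\<close>

lemma algebraic_int_of_int_eigenvector:
  fixes c :: "'k::field_char_0" and s :: "nat \<Rightarrow> 'k" and M :: "nat \<Rightarrow> nat \<Rightarrow> int"
  assumes eq: "\<And>i. i < n \<Longrightarrow> c * s i = (\<Sum>j<n. of_int (M i j) * s j)"
    and nz: "i0 < n" "s i0 \<noteq> 0"
  shows "algebraic_int c"
proof -
  define A where "A = mat n n (\<lambda>(i,j). M i j)"
  define A' :: "'k mat" where "A' = map_mat of_int A"
  have A: "A \<in> carrier_mat n n" "A' \<in> carrier_mat n n" by (auto simp: A_def A'_def)
  have "eigenvector A' (vec n s) c"
    unfolding eigenvector_def
  proof (intro conjI)
    show "vec n s \<in> carrier_vec (dim_row A')" using A by simp
    show "vec n s \<noteq> 0\<^sub>v (dim_row A')" using A nz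
      by (metis carrier_matD(1) index_vec index_zero_vec(1))
    show "A' *\<^sub>v vec n s = c \<cdot>\<^sub>v vec n s"
      using A by (intro eq_vecI) (auto simp: A'_def A_def scalar_prod_def eq lessThan_atLeast0)
  qed
  then have "poly (char_poly A') c = 0"
    using eigenvalue_root_char_poly[OF A(2)] by (auto simp: eigenvalue_def)
  moreover have cp: "char_poly A' = map_poly of_int (char_poly A)"
    unfolding A'_def by (rule of_int_hom.char_poly_hom[OF A(1)])
  moreover have "lead_coeff (char_poly A') = 1"
    using degree_monic_char_poly[OF A(2)] by simp
  ultimately show ?thesis
    by (intro algebraic_int.intros[of "char_poly A'"]) auto
qed

interpretation Z: Modules.module "\<lambda>(n::int) (x::'k::field_char_0). of_int n * x"
  by unfold_locales (auto simp: algebra_simps)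

lemma algebraic_int_of_stable_int_span:
  fixes c :: "'k::field_char_0"
  assumes S: "finite S" and st: "\<And>s. s \<in> S \<Longrightarrow> c * s \<in> Z.span S" and nz: "s0 \<in> S" "s0 \<noteq> 0"
  shows "algebraic_int c"
proof -
  obtain e where e: "bij_betw e {..<card S} S"
    using ex_bij_betw_nat_finite[OF S] by (auto simp: lessThan_atLeast0)
  have "\<exists>u. c * s = (\<Sum>a\<in>S. of_int (u a) * a)" if "s \<in> S" for s
    using st[OF that] Z.span_finite[OF S] by auto
  then obtain u where u: "\<And>s. s \<in> S \<Longrightarrow> c * s = (\<Sum>a\<in>S. of_int (u s a) * a)" by metis
  obtain i0 where i0: "i0 < card S" "e i0 = s0" using bij_betw_imp_surj_on[OF e] nz by (metis imageE lessThan_iff)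
  show ?thesis
  proof (rule algebraic_int_of_int_eigenvector[of "card S" c e "\<lambda>i j. u (e i) (e j)" i0])
    fix i assume "i < card S"
    then have "e i \<in> S" using e by (auto simp: bij_betw_def)
    then show "c * e i = (\<Sum>j<card S. of_int (u (e i) (e j)) * e j)"
      by (simp add: u sum.reindex_bij_betw[OF e, symmetric])
  qed (use i0 nz in auto)
qed

text \<open>Subrings that are finitely generated abelian groups. They replace the usual closure arguments:
all their elements are integral, and adjoining an integral element stays inside the class.\<close>

definition int_subring :: "'k::field_char_0 set \<Rightarrow> bool" where
  "int_subring L \<longleftrightarrow> 1 \<in> L \<and> (\<forall>x\<in>L. \<forall>y\<in>L. x * y \<in> L) \<and> (\<exists>S. finite S \<and> L = Z.span S)"

lemma int_subring_algebraic_int: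
  assumes L: "int_subring L" and c: "c \<in> L"
  shows "algebraic_int c"
proof -
  obtain S where S: "finite S" "L = Z.span S" using L by (auto simp: int_subring_def)
  have "\<exists>s\<in>S. s \<noteq> 0"
  proof (rule ccontr)
    assume "\<not> ?thesis"
    then have "Z.span S \<subseteq> {0}" by (intro Z.span_minimal) (auto simp: Z.subspace_def)
    then show False using L S by (auto simp: int_subring_def)
  qed
  then obtain s0 where "s0 \<in> S" "s0 \<noteq> 0" by auto
  moreover have "c * s \<in> Z.span S" if "s \<in> S" for s
    using L c S that Z.span_base[OF that] by (auto simp: int_subring_def)
  ultimately show ?thesis using algebraic_int_of_stable_int_span[OF S(1)] by blast
qed

lemma int_span_mult_closed:
  fixes S T U :: "'k::field_char_0 set"
  assumes "\<And>s t. s \<in> S \<Longrightarrow> t \<in> T \<Longrightarrow> s * t \<in> Z.span U" "x \<in> Z.span S" "y \<in> Z.span T"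
  shows "x * y \<in> Z.span U"
proof -
  have 1: "s * y \<in> Z.span U" if "s \<in> S" for s
  proof -
    have "Z.span T \<subseteq> {y. s * y \<in> Z.span U}"
      using assms(1)[OF that]
      by (intro Z.span_minimal)
         (auto simp: Z.subspace_def Z.span_zero distrib_left Z.span_add mult.left_commute[of s] Z.span_scale)
    then show ?thesis using assms(3) by auto
  qed
  have "Z.span S \<subseteq> {x. x * y \<in> Z.span U}"
    using 1 by (intro Z.span_minimal)
         (auto simp: Z.subspace_def Z.span_zero distrib_right Z.span_add mult.assoc Z.span_scale)
  then show ?thesis using assms(2) by auto
qed

text \<open>With \<open>d\<close> the degree of the monic polynomial, the products \<open>x\<^sup>i s\<close> with \<open>i < d\<close> and \<open>s\<close> in a
generating set of \<open>L\<close> span a ring, since \<open>x\<^sup>d\<close> can be rewritten by the polynomial.\<close>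

lemma int_subring_adjoin:
  assumes L: "int_subring L" and p: "lead_coeff p = 1" "\<And>i. coeff p i \<in> L" "poly p x = 0"
  shows "\<exists>L'. int_subring L' \<and> L \<subseteq> L' \<and> x \<in> L'"
proof -
  obtain S where S: "finite S" "L = Z.span S" using L by (auto simp: int_subring_def)
  define d where "d = degree p"
  have d: "d > 0"
  proof (rule ccontr)
    assume "\<not> d > 0"
    then have "p = [:1:]" using p(1) by (metis d_def degree_eq_zeroE lead_coeff_pCons(2) neq0_conv degree_pCons_0 coeff_pCons_0)
    then show False using p(3) by simp
  qed
  define T where "T = (\<lambda>(i,s). x ^ i * s) ` ({..<d} \<times> S)"
  have low: "x ^ i * l \<in> Z.span T" if "i < d" "l \<in> L" for i l
  proof (rule int_span_mult_closed[of "{x^i}" S])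
    show "s * t \<in> Z.span T" if "s \<in> {x ^ i}" "t \<in> S" for s t
      using that \<open>i < d\<close> by (intro Z.span_base) (auto simp: T_def)
  qed (use that S in \<open>auto intro: Z.span_base\<close>)
  have Lm: "a * b \<in> L" if "a \<in> L" "b \<in> L" for a b using L that by (auto simp: int_subring_def)
  have "0 = (\<Sum>i\<le>d. coeff p i * x ^ i)" using p(3) by (simp add: poly_altdef d_def)
  also have "\<dots> = (\<Sum>i<d. coeff p i * x ^ i) + x ^ d"
    using p(1) by (simp add: lessThan_Suc_atMost[symmetric] d_def)
  finally have xd: "x ^ d = (\<Sum>i<d. of_int (-1) * (x ^ i * coeff p i))"
    by (simp add: sum_negf eq_neg_iff_add_eq_0 add.commute mult.commute)
  have top: "x ^ d * l \<in> Z.span T" if "l \<in> L" for l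
  proof -
    have "x ^ d * l = (\<Sum>i<d. of_int (-1) * (x ^ i * (coeff p i * l)))"
      by (simp add: xd sum_distrib_right sum_distrib_left mult.assoc sum_negf)
    then show ?thesis using low Lm that p(2) by (simp only:) (intro Z.span_sum Z.span_scale, simp)
  qed
  have xT: "x * y \<in> Z.span T" if "y \<in> Z.span T" for y
  proof (rule int_span_mult_closed[of "{x}" T])
    fix s t assume "s \<in> {x}" "t \<in> T"
    then obtain i a where ia: "s = x" "t = x ^ i * a" "i < d" "a \<in> S" by (auto simp: T_def)
    then have "a \<in> L" using S by (auto intro: Z.span_base)
    then show "s * t \<in> Z.span T"
      using low[of "Suc i" a] top[of a] ia
      by (cases "Suc i = d") (auto simp: mult.assoc)
  qed (use that in \<open>auto intro: Z.span_base\<close>)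
  have xTi: "x ^ i * y \<in> Z.span T" if "y \<in> Z.span T" for y i
    using that by (induction i) (auto simp: xT mult.assoc)
  have LT: "l * y \<in> Z.span T" if "l \<in> L" "y \<in> Z.span T" for l y
  proof (rule int_span_mult_closed[of "{l}" T])
    fix s t assume "s \<in> {l}" "t \<in> T"
    then obtain i a where ia: "s = l" "t = x ^ i * a" "i < d" "a \<in> S" by (auto simp: T_def)
    then have "a \<in> L" using S by (auto intro: Z.span_base)
    then show "s * t \<in> Z.span T"
      using low[of i "l * a"] ia Lm that by (auto simp: mult_ac)
  qed (use that in \<open>auto intro: Z.span_base\<close>)
  have sub: "L \<subseteq> Z.span T" using low[of 0] d by auto
  have one: "1 \<in> L" using L by (auto simp: int_subring_def)
  have "int_subring (Z.span T)"
    unfolding int_subring_def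
  proof (intro conjI ballI exI)
    show "1 \<in> Z.span T" using one sub by auto
    show "finite T" using S by (auto simp: T_def)
    fix y z assume yz: "y \<in> Z.span T" "z \<in> Z.span T"
    show "y * z \<in> Z.span T"
    proof (rule int_span_mult_closed[of T "{z}"])
      fix s t assume "s \<in> T" "t \<in> {z}"
      then obtain i a where ia: "t = z" "s = x ^ i * a" "i < d" "a \<in> S" by (auto simp: T_def)
      then have "a \<in> L" using S by (auto intro: Z.span_base)
      then show "s * t \<in> Z.span T" using xTi LT yz ia by (auto simp: mult.assoc)
    qed (use yz in \<open>auto intro: Z.span_base\<close>)
  qed simp
  moreover have "x \<in> Z.span T" using xT[of 1] one sub by auto
  ultimately show ?thesis using sub by blast
qed

lemma finite_algebraic_ints_in_int_subring:
  assumes "finite F" "\<And>x. x \<in> F \<Longrightarrow> algebraic_int x"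
  shows "\<exists>L. int_subring L \<and> F \<subseteq> L"
  using assms
proof (induction F)
  case empty
  have one: "1 \<in> Z.span {1}" by (rule Z.span_base) simp
  have "x * y \<in> Z.span {1}" if "x \<in> Z.span {1}" "y \<in> Z.span {1}" for x y :: 'a
    using _ that by (rule int_span_mult_closed) (simp add: one)
  then have "int_subring (Z.span {1} :: 'a set)"
    unfolding int_subring_def using one by blast
  then show ?case by blast
next
  case (insert x F)
  then obtain L where L: "int_subring L" "F \<subseteq> L" by auto
  have "algebraic_int x" using insert by auto
  then obtain p where p: "lead_coeff p = 1" "\<And>i. coeff p i \<in> \<int>" "poly p x = 0"
    by (auto elim: algebraic_int.cases)
  have "of_int n \<in> L" for n
    using L(1) Z.span_scale[of 1 _ n] by (auto simp: int_subring_def)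
  then have "coeff p i \<in> L" for i using p(2)[of i] by (auto elim: Ints_cases)
  then show ?case using int_subring_adjoin[OF L(1) p(1) _ p(3)] L(2) by blast
qed

lemma algebraic_int_add_mult:
  fixes x y :: "'k::field_char_0"
  assumes "algebraic_int x" "algebraic_int y"
  shows algebraic_int_add: "algebraic_int (x + y)" and algebraic_int_mult: "algebraic_int (x * y)"
proof -
  obtain L where L: "int_subring L" "{x,y} \<subseteq> L"
    using finite_algebraic_ints_in_int_subring[of "{x,y}"] assms by auto
  then have "x + y \<in> L" "x * y \<in> L" by (auto simp: int_subring_def intro: Z.span_add)
  then show "algebraic_int (x + y)" "algebraic_int (x * y)"
    using int_subring_algebraic_int L by blast+
qed

lemma algebraic_int_diff:
  "algebraic_int x \<Longrightarrow> algebraic_int y \<Longrightarrow> algebraic_int (x - y :: 'k::field_char_0)"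
  using algebraic_int_add[of x "- y"] by auto

lemma algebraic_int_sum:
  "(\<And>i. i \<in> I \<Longrightarrow> algebraic_int (f i)) \<Longrightarrow> algebraic_int (\<Sum>i\<in>I. f i :: 'k::field_char_0)"
  by (induction I rule: infinite_finite_induct) (auto intro: algebraic_int_add)

lemma algebraic_int_1 [simp]: "algebraic_int (1 :: 'k::field_char_0)"
  by (rule int_imp_algebraic_int) auto

text \<open>The finitely many matrix entries lie in a subring \<open>L\<close> that is finitely generated over \<open>\<int>\<close>; the
\<open>L\<close>-span of the vectors is then a finitely generated group that multiplication by \<open>c\<close> preserves.\<close>

lemma algebraic_int_of_stable_lattice:
  fixes c :: "'k::field_char_0"
  assumes S: "finite S" and r: "\<And>s t. s \<in> S \<Longrightarrow> t \<in> S \<Longrightarrow> algebraic_int (r s t)"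
    and eq: "\<And>s. s \<in> S \<Longrightarrow> c * e s = (\<Sum>t\<in>S. r s t * e t)"
    and nz: "s0 \<in> S" "e s0 \<noteq> 0"
  shows "algebraic_int c"
proof -
  have "\<exists>L. int_subring L \<and> (\<lambda>(s,t). r s t) ` (S \<times> S) \<subseteq> L"
    by (rule finite_algebraic_ints_in_int_subring) (use S r in auto)
  then obtain L where L: "int_subring L" "\<And>s t. s \<in> S \<Longrightarrow> t \<in> S \<Longrightarrow> r s t \<in> L"
    by (auto simp: image_subset_iff)
  from L(1) obtain U where U: "finite U" "L = Z.span U" unfolding int_subring_def by blast
  define T where "T = (\<lambda>(u,s). u * e s) ` (U \<times> S)"
  have base: "l * e s \<in> Z.span T" if "l \<in> L" "s \<in> S" for l s
  proof (rule int_span_mult_closed[of U "{e s}"])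
    show "u * t \<in> Z.span T" if "u \<in> U" "t \<in> {e s}" for u t
      using that \<open>s \<in> S\<close> by (intro Z.span_base) (auto simp: T_def)
  qed (use that U in \<open>auto intro: Z.span_base\<close>)
  have "e s0 \<in> Z.span T" using base[of 1 s0] L(1) nz by (auto simp: int_subring_def)
  have "\<exists>t\<in>T. t \<noteq> 0"
  proof (rule ccontr)
    assume "\<not> ?thesis"
    then have "Z.span T \<subseteq> {0}" by (intro Z.span_minimal) (auto simp: Z.subspace_def)
    then show False using \<open>e s0 \<in> Z.span T\<close> nz by auto
  qed
  then obtain t0 where "t0 \<in> T" "t0 \<noteq> 0" by auto
  moreover have "c * t \<in> Z.span T" if t: "t \<in> T" for t
  proof -
    from t obtain u s where us: "u \<in> U" "s \<in> S" "t = u * e s" by (auto simp: T_def)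
    have "c * t = (\<Sum>t\<in>S. (u * r s t) * e t)"
      using eq[OF us(2)] us(3) by (simp add: mult.left_commute[of c] sum_distrib_left mult.assoc)
    moreover have "u * r s t \<in> L" if "t \<in> S" for t
    proof -
      have "u \<in> L" "r s t \<in> L" using U(2) Z.span_base[OF us(1)] L(2)[OF us(2) that] by auto
      then show ?thesis using L by (auto simp: int_subring_def)
    qed
    ultimately show ?thesis using base by (auto intro!: Z.span_sum)
  qed
  moreover have "finite T" using U S by (auto simp: T_def)
  ultimately show ?thesis using algebraic_int_of_stable_int_span by blast
qed

section \<open>Invertibility of fractional ideals\<close>

lemma common_denominator:
  "finite F \<Longrightarrow> \<exists>d::int. d \<noteq> 0 \<and> (\<forall>q\<in>F. of_int d * (q::rat) \<in> \<int>)"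
proof (induction F rule: finite_induct)
  case (insert q F)
  then obtain d where d: "d \<noteq> 0" "\<forall>q\<in>F. of_int d * q \<in> \<int>" by auto
  obtain a b where q: "q = of_int a / of_int b" "b > 0"
    by (metis quotient_of_div quotient_of_denom_pos surj_pair)
  have "of_int (d * b) * r \<in> \<int>" if r: "r \<in> insert q F" for r
  proof (cases "r = q")
    case True
    then have "of_int (d * b) * r = of_int (d * a)" using q by simp
    then show ?thesis by (metis Ints_of_int)
  next
    case False
    then have "of_int d * r \<in> \<int>" using d r by auto
    then have "of_int b * (of_int d * r) \<in> \<int>" using Ints_mult Ints_of_int by metis
    then show ?thesis by (simp add: mult_ac)
  qed
  moreover have "d * b \<noteq> 0" using d q by auto
  ultimately show ?case by blast
qed (auto intro: exI[of _ 1])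

text \<open>Multiplication by \<open>x\<close> on a finite spanning set over \<open>\<rat>\<close> has a rational matrix, and a common
denominator of the entries is the required multiplier.\<close>

lemma number_field_integral_multiple:
  fixes x :: "'k::field_char_0"
  assumes "number_field TYPE('k)"
  shows "\<exists>d::int. d \<noteq> 0 \<and> algebraic_int (of_int d * x)"
proof -
  interpret Q: Modules.module "\<lambda>(q::rat) (x::'k). of_rat q * x"
    by unfold_locales (auto simp: algebra_simps of_rat_add of_rat_mult)
  obtain S :: "'k set" where S: "finite S" "Q.span S = UNIV"
    using assms by (auto simp: number_field_def)
  have "\<exists>u. x * s = (\<Sum>a\<in>S. of_rat (u a) * a)" for s
    using S Q.span_finite[OF S(1)] by (metis (mono_tags, lifting) UNIV_I imageE)
  then obtain u where u: "\<And>s. x * s = (\<Sum>a\<in>S. of_rat (u s a) * a)" by metis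
  obtain d :: int where d: "d \<noteq> 0" "\<And>s a. s \<in> S \<Longrightarrow> a \<in> S \<Longrightarrow> of_int d * u s a \<in> \<int>"
    using common_denominator[of "(\<lambda>(s,a). u s a) ` (S \<times> S)"] S(1) by force
  have "\<exists>s\<in>S. s \<noteq> 0"
  proof (rule ccontr)
    assume "\<not> ?thesis"
    then have "Q.span S \<subseteq> {0}" by (intro Q.span_minimal) (auto simp: Q.subspace_def)
    then show False using S(2) by (metis UNIV_I singletonD subsetD zero_neq_one)
  qed
  then obtain s0 where s0: "s0 \<in> S" "s0 \<noteq> 0" by auto
  have "of_int d * x * s \<in> Z.span S" if s: "s \<in> S" for s
  proof -
    have "of_int d * x * s = (\<Sum>a\<in>S. of_rat (of_int d * u s a) * a)"
      by (simp add: u mult.assoc sum_distrib_left of_rat_mult)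
    also have "\<dots> = (\<Sum>a\<in>S. of_int \<lfloor>of_int d * u s a\<rfloor> * a)"
    proof (rule sum.cong)
      fix a assume "a \<in> S"
      then obtain m where "of_int d * u s a = of_int m" using d(2)[OF s] by (auto elim: Ints_cases)
      then show "of_rat (of_int d * u s a) * a = of_int \<lfloor>of_int d * u s a\<rfloor> * a" by simp
    qed simp
    also have "\<dots> \<in> Z.span S" by (intro Z.span_sum Z.span_scale Z.span_base)
    finally show ?thesis .
  qed
  then show ?thesis using algebraic_int_of_stable_int_span[OF S(1) _ s0] d(1) by blast
qed

lemma common_integral_multiple:
  fixes v :: "'g::finite \<Rightarrow> 'k::field_char_0"
  assumes K: "number_field TYPE('k)"
  shows "\<exists>d::int. d \<noteq> 0 \<and> (\<forall>g. algebraic_int (of_int d * v g))"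
proof -
  have "\<exists>d. \<forall>g. d g \<noteq> (0::int) \<and> algebraic_int (of_int (d g) * v g)"
    using number_field_integral_multiple[OF K] by (intro choice) blast
  then obtain d where d: "\<And>g. d g \<noteq> (0::int)" "\<And>g. algebraic_int (of_int (d g) * v g)" by blast
  have "algebraic_int (of_int (\<Prod>h\<in>UNIV. d h) * v g)" for g
  proof -
    have "of_int (\<Prod>h\<in>UNIV. d h) * v g = of_int (\<Prod>h\<in>UNIV-{g}. d h) * (of_int (d g) * v g)"
      by (subst prod.remove[of UNIV g]) auto
    moreover have "algebraic_int (of_int n :: 'k)" for n by (rule int_imp_algebraic_int) auto
    ultimately show ?thesis using d(2) algebraic_int_mult by metis
  qed
  then show ?thesis using d(1) by (intro exI[of _ "\<Prod>h\<in>UNIV. d h"]) simp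
qed

lemma bezout_finite:
  "finite I \<Longrightarrow> \<exists>t. (\<Sum>i\<in>I. t i * c i) = Gcd (c ` I :: int set)"
proof (induction I rule: finite_induct)
  case (insert i I)
  then obtain t where t: "(\<Sum>i\<in>I. t i * c i) = Gcd (c ` I)" by auto
  obtain u v where uv: "u * c i + v * Gcd (c ` I) = gcd (c i) (Gcd (c ` I))"
    using bezout_int by blast
  have "(\<Sum>j\<in>insert i I. (if j = i then u else v * t j) * c j) = u * c i + v * (\<Sum>i\<in>I. t i * c i)"
    using insert(1,2) by (auto simp: sum_distrib_left mult.assoc intro!: sum.cong)
  then show ?case using t uv by auto
qed auto

text \<open>Substituting \<open>d X\<close> into a monic polynomial of \<open>d x\<close> and dividing by the content.\<close>

lemma primitive_int_poly_root:
  fixes x :: "'k::field_char_0"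
  assumes d: "d \<noteq> (0::int)" "algebraic_int (of_int d * x)"
  shows "\<exists>p::int poly. p \<noteq> 0 \<and> content p = 1 \<and> (\<Sum>i\<le>degree p. of_int (coeff p i) * x ^ i) = 0"
proof -
  obtain p :: "int poly" where p: "poly (map_poly of_int p) (of_int d * x) = 0" "lead_coeff p = 1"
    using d(2) by (auto simp: algebraic_int_altdef_ipoly)
  define q where "q = pcompose p [:0, d:]"
  have "q \<noteq> 0" using p(2) d(1) by (auto simp: q_def pcompose_eq_0_iff)
  have ip: "(\<Sum>i\<le>degree r. of_int (coeff r i) * x ^ i) = poly (map_poly of_int r) x" for r :: "int poly"
    by (simp add: poly_altdef coeff_map_poly degree_map_poly)
  have "poly (map_poly of_int q) x = 0"
  proof -
    have "map_poly of_int q = pcompose (map_poly of_int p) [:0, of_int d :: 'k:]"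
      by (simp add: q_def of_int_hom.map_poly_pcompose of_int_hom.map_poly_pCons_hom)
    then show ?thesis using p(1) by (simp add: poly_pcompose mult.commute)
  qed
  moreover have "q = Polynomial.smult (content q) (primitive_part q)" by simp
  then have "map_poly of_int q = Polynomial.smult (of_int (content q) :: 'k) (map_poly of_int (primitive_part q))"
    by (metis of_int_hom.map_poly_hom_smult)
  ultimately have "of_int (content q) * poly (map_poly of_int (primitive_part q)) x = (0::'k)"
    by simp
  then have "poly (map_poly of_int (primitive_part q)) x = (0::'k)" using \<open>q \<noteq> 0\<close> by simp
  then show ?thesis using \<open>q \<noteq> 0\<close> ip[of "primitive_part q"]
    by (intro exI[of _ "primitive_part q"]) (auto simp: content_primitive_part)
qed

text \<open>The fractional ideal \<open>(1, x)\<close> is invertible, with inverse containing \<open>p\<close> and \<open>q\<close>. Let \<open>c\<^sub>i\<close> be the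
coefficients of a primitive integer polynomial of degree \<open>n\<close> vanishing at \<open>x\<close>. The partial Horner
sums \<open>b\<^sub>k = c\<^sub>n x\<^sup>k + \<dots> + c\<^sub>n\<^sub>-\<^sub>k\<close> are integral, because they map the lattice spanned by
\<open>1, \<dots>, x\<^sup>n\<^sup>-\<^sup>1\<close> to itself, and the recursion for \<open>b\<^sub>k\<^sub>+\<^sub>1\<close> shows that \<open>x b\<^sub>k\<close> is integral too.
The recursion also writes each \<open>c\<^sub>i\<close> in terms of the \<open>b\<^sub>k\<close> and \<open>x b\<^sub>k\<close>; as the polynomial is
primitive, some integral combination of the \<open>c\<^sub>i\<close> is \<open>1\<close>.\<close>

lemma invertible_of_integral_multiple:
  fixes x :: "'k::field_char_0"
  assumes d: "d \<noteq> (0::int)" "algebraic_int (of_int d * x)"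
  shows "\<exists>p q. algebraic_int p \<and> algebraic_int q \<and> algebraic_int (p * x) \<and> algebraic_int (q * x) \<and>
           p + q * x = 1"
proof -
  obtain P :: "int poly" where P: "P \<noteq> 0" "content P = 1"
    "(\<Sum>i\<le>degree P. of_int (coeff P i) * x ^ i) = 0" using primitive_int_poly_root[OF d] by auto
  define n c where "n = degree P" and "c = (\<lambda>i. of_int (coeff P i) :: 'k)"
  define b where "b k = (\<Sum>m\<in>{n-k..n}. c m * x ^ (m - (n-k)))" for k
  have root: "(\<Sum>i\<le>n. c i * x ^ i) = 0" using P(3) by (simp add: n_def c_def)
  have "n \<noteq> 0"
  proof
    assume "n = 0"
    then have "coeff P 0 = 0" using root by (simp add: c_def)
    then show False using P(1) \<open>n = 0\<close> by (metis leading_coeff_0_iff n_def)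
  qed
  define M where "M = (\<lambda>j. x ^ j) ` {..<n}"
  have ci: "algebraic_int (c i)" for i unfolding c_def by (rule int_imp_algebraic_int) auto
  have mono: "c m * x ^ j \<in> Z.span M" if "j < n" for m j
    unfolding c_def using that by (intro Z.span_scale Z.span_base) (auto simp: M_def)
  have low: "b k * x ^ j \<in> Z.span M" if "k + j < n" for k j
  proof -
    have "b k * x ^ j = (\<Sum>m\<in>{n-k..n}. c m * x ^ (m - (n-k) + j))"
      by (simp only: b_def sum_distrib_right power_add mult.assoc)
    also have "\<dots> \<in> Z.span M" using that by (intro Z.span_sum mono) auto
    finally show ?thesis .
  qed
  (* The high terms of the vanishing polynomial are minus the low ones.
     This lowers the degree of b k * x ^ j when k + j is at least n. *)
  have bk: "b k * x ^ (n - k) = - (\<Sum>m<n-k. c m * x ^ m)" if "k \<le> n" for k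
  proof -
    have "b k * x ^ (n-k) = (\<Sum>m\<in>{n-k..n}. c m * x ^ m)"
      by (simp add: b_def sum_distrib_right power_add[symmetric] mult.assoc)
    moreover have "{..n} = {..<n-k} \<union> {n-k..n}" "{..<n-k} \<inter> {n-k..n} = {}" by auto
    then have "(\<Sum>i\<le>n. c i * x ^ i) = (\<Sum>m<n-k. c m * x ^ m) + (\<Sum>m\<in>{n-k..n}. c m * x ^ m)"
      by (simp add: sum.union_disjoint)
    ultimately show ?thesis using root by (simp add: eq_neg_iff_add_eq_0 add.commute)
  qed
  have stable: "b k * x ^ j \<in> Z.span M" if "k \<le> n" "j < n" for k j
  proof (cases "k + j < n")
    case False
    have "b k * x ^ j = b k * x ^ (n - k) * x ^ (j - (n - k))"
      using False that by (simp add: mult.assoc power_add[symmetric])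
    also have "\<dots> = - (\<Sum>m<n-k. c m * x ^ (m + (j - (n - k))))"
      by (simp add: bk[OF that(1)] sum_distrib_right power_add mult.assoc)
    also have "\<dots> \<in> Z.span M" using that by (intro Z.span_neg Z.span_sum mono) auto
    finally show ?thesis .
  qed (rule low)
  have bi: "algebraic_int (b k)" if "k \<le> n" for k
    by (rule algebraic_int_of_stable_int_span[of M _ "x ^ 0"])
       (use stable that \<open>n \<noteq> 0\<close> in \<open>auto simp: M_def simp del: power_0\<close>)
  have rec: "b (Suc k) = x * b k + c (n - Suc k)" if "k < n" for k
  proof -
    have "{n - Suc k..n} = insert (n - Suc k) {n-k..n}" using that by auto
    then have "b (Suc k) = c (n - Suc k) + (\<Sum>m\<in>{n-k..n}. c m * x ^ (m - (n - Suc k)))"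
      using that by (simp add: b_def)
    also have "(\<Sum>m\<in>{n-k..n}. c m * x ^ (m - (n - Suc k))) = x * b k"
      unfolding b_def sum_distrib_left
    proof (rule sum.cong)
      fix m assume "m \<in> {n-k..n}"
      then have "m - (n - Suc k) = Suc (m - (n - k))" using that by auto
      then show "c m * x ^ (m - (n - Suc k)) = x * (c m * x ^ (m - (n - k)))" by simp
    qed simp
    finally show ?thesis by simp
  qed
  have bn: "b n = 0" using root by (simp add: b_def atLeast0AtMost)
  have xbi: "algebraic_int (b k * x)" if "k \<le> n" for k
  proof (cases "k = n")
    case False
    then have "b k * x = b (Suc k) - c (n - Suc k)" using rec[of k] that by simp
    then show ?thesis using bi[of "Suc k"] ci False that by (simp add: algebraic_int_diff)
  qed (simp add: bn)
  obtain t where t: "(\<Sum>i\<le>n. t i * coeff P i) = Gcd (coeff P ` {..n})"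
    using bezout_finite[of "{..n}" "coeff P"] by auto
  have "Gcd (coeff P ` {..n}) dvd coeff P k" for k
    by (cases "k \<le> n") (auto simp: n_def coeff_eq_0)
  then have "Gcd (coeff P ` {..n}) dvd content P"
    by (simp add: const_poly_dvd_iff_dvd_content[symmetric] const_poly_dvd_iff)
  then have "Gcd (coeff P ` {..n}) = 1"
    using P(2) by (metis dvd_refl is_unit_normalize normalize_Gcd)
  then have "(\<Sum>i\<le>n. of_int (t i) * c i) = of_int 1"
    unfolding c_def of_int_mult[symmetric] of_int_sum[symmetric] t by simp
  then have one: "(\<Sum>i<n. of_int (t i) * c i) + of_int (t n) * c n = 1"
    by (simp add: lessThan_Suc_atMost[symmetric])
  have ti: "algebraic_int (of_int (t i) :: 'k)" for i by (rule int_imp_algebraic_int) auto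
  define p where "p = (\<Sum>i\<le>n. of_int (t i) * b (n - i))"
  define q where "q = (\<Sum>i<n. - of_int (t i) * b (n - Suc i))"
  have "p + q * x = (\<Sum>i<n. of_int (t i) * (b (n - i) - x * b (n - Suc i))) + of_int (t n) * b 0"
    by (simp add: p_def q_def lessThan_Suc_atMost[symmetric] right_diff_distrib sum_subtractf
          sum_distrib_left sum_distrib_right sum_negf mult_ac)
  also have "(\<Sum>i<n. of_int (t i) * (b (n - i) - x * b (n - Suc i))) = (\<Sum>i<n. of_int (t i) * c i)"
  proof (rule sum.cong)
    fix i assume "i \<in> {..<n}"
    then have "b (n - i) = x * b (n - Suc i) + c i" using rec[of "n - Suc i"] by (simp add: Suc_diff_Suc)
    then show "of_int (t i) * (b (n - i) - x * b (n - Suc i)) = of_int (t i) * c i" by simp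
  qed simp
  also have "b 0 = c n" by (simp add: b_def)
  finally have "p + q * x = 1" using one by simp
  moreover have "algebraic_int p" "algebraic_int q"
    unfolding p_def q_def by (auto intro!: algebraic_int_sum algebraic_int_mult ti bi)
  moreover have "algebraic_int (p * x)" "algebraic_int (q * x)"
    unfolding p_def q_def sum_distrib_right mult.assoc
    by (auto intro!: algebraic_int_sum algebraic_int_mult ti xbi)
  ultimately show ?thesis by blast
qed

text \<open>Induction on the number of generators. Suppose that \<open>y\<close> inverts the ideal of the \<open>a\<^sub>i\<close>, and that
\<open>a\<^sub>k\<close> is a new generator. For each \<open>i\<close> the ideal \<open>(1, a\<^sub>k y\<^sub>i)\<close> is invertible, say with
\<open>p\<^sub>i + q\<^sub>i a\<^sub>k y\<^sub>i = 1\<close>. Inserting these equations into \<open>\<Sum> y\<^sub>i a\<^sub>i = 1\<close> and sorting by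
generators gives the new coefficients.\<close>

lemma fractional_ideal_invertible:
  fixes a :: "'i \<Rightarrow> 'k::field_char_0"
  assumes K: "number_field TYPE('k)" and "finite I" "\<exists>i\<in>I. a i \<noteq> 0"
  shows "\<exists>y. (\<Sum>i\<in>I. y i * a i) = 1 \<and> (\<forall>i\<in>I. \<forall>j\<in>I. algebraic_int (y i * a j))"
  using assms(2,3)
proof (induction I rule: finite_induct)
  case (insert k I)
  show ?case
  proof (cases "\<exists>i\<in>I. a i \<noteq> 0")
    case False
    then have "(\<Sum>i\<in>insert k I. inverse (a k) * a i) = 1" using insert by simp
    moreover have "algebraic_int (inverse (a k) * a j)" if "j \<in> insert k I" for j
      using that False insert(4) by (cases "j = k") auto
    ultimately show ?thesis by (intro exI[of _ "\<lambda>i. inverse (a k)"]) auto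
  next
    case True
    then obtain y where y: "(\<Sum>i\<in>I. y i * a i) = 1"
      "\<And>i j. i \<in> I \<Longrightarrow> j \<in> I \<Longrightarrow> algebraic_int (y i * a j)" using insert by metis
    have "\<exists>p q. algebraic_int p \<and> algebraic_int q \<and> algebraic_int (p * (a k * y i)) \<and>
        algebraic_int (q * (a k * y i)) \<and> p + q * (a k * y i) = 1" for i
      using number_field_integral_multiple[OF K, of "a k * y i"] invertible_of_integral_multiple by blast
    then obtain p q where pq: "\<And>i. algebraic_int (p i)" "\<And>i. algebraic_int (q i)"
      "\<And>i. algebraic_int (p i * (a k * y i))" "\<And>i. algebraic_int (q i * (a k * y i))"
      "\<And>i. p i + q i * (a k * y i) = 1" by metis
    define y' where "y' i = (if i = k then \<Sum>i\<in>I. y i * a i * q i * y i else y i * p i)" for i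
    have y'I: "y' i = y i * p i" if "i \<in> I" for i using that insert(2) by (auto simp: y'_def)
    have y'k: "y' k = (\<Sum>i\<in>I. y i * a i * q i * y i)" by (simp add: y'_def)
    have "(\<Sum>i\<in>insert k I. y' i * a i) = (\<Sum>i\<in>I. y i * a i * q i * y i) * a k + (\<Sum>i\<in>I. y i * p i * a i)"
      using insert(1,2) y'k y'I by simp
    also have "\<dots> = (\<Sum>i\<in>I. y i * a i * (p i + q i * (a k * y i)))"
      by (simp add: sum_distrib_right sum_distrib_left sum.distrib[symmetric] algebra_simps)
    also have "\<dots> = 1" using pq(5) y(1) by simp
    finally have 1: "(\<Sum>i\<in>insert k I. y' i * a i) = 1" .
    have "algebraic_int (y' i * a j)" if "i \<in> insert k I" "j \<in> insert k I" for i j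
    proof (cases "i = k"; cases "j = k")
      assume ij: "i = k" "j = k"
      have "y' k * a k = (\<Sum>i\<in>I. (y i * a i) * (q i * (a k * y i)))"
        unfolding y'k sum_distrib_right by (simp add: mult_ac)
      also have "algebraic_int \<dots>"
        by (intro algebraic_int_sum algebraic_int_mult[OF y(2) pq(4)])
      finally show ?thesis using ij by simp
    next
      assume ij: "i = k" "j \<noteq> k"
      have "y' k * a j = (\<Sum>i\<in>I. (y i * a i) * (q i * (y i * a j)))"
        unfolding y'k sum_distrib_right by (simp add: mult_ac)
      also have "algebraic_int \<dots>" using ij that
        by (intro algebraic_int_sum algebraic_int_mult[OF y(2) algebraic_int_mult[OF pq(2) y(2)]]) auto
      finally show ?thesis using ij by simp
    next
      assume ij: "i \<noteq> k" "j = k"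
      have "y' i * a j = p i * (a k * y i)" using ij that y'I by (simp add: mult_ac)
      then show ?thesis using pq by simp
    next
      assume ij: "i \<noteq> k" "j \<noteq> k"
      have "y' i * a j = p i * (y i * a j)" using ij that y'I by (simp add: mult_ac)
      moreover have "i \<in> I" "j \<in> I" using ij that by auto
      ultimately show ?thesis using algebraic_int_mult[OF pq(1) y(2)] by metis
    qed
    then show ?thesis using 1 by blast
  qed
qed auto

section \<open>Dual bases of lattices of functions\<close>

text \<open>Closure under negation is included, as \<open>-1\<close> is an algebraic integer.\<close>

definition R_submodule :: "('k::field_char_0 \<Rightarrow> 'b::ab_group_add \<Rightarrow> 'b) \<Rightarrow> 'b set \<Rightarrow> bool" where
  "R_submodule sc W \<longleftrightarrow> 0 \<in> W \<and> (\<forall>x\<in>W. \<forall>y\<in>W. x + y \<in> W) \<and>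
     (\<forall>r\<in>ring_of_integers. \<forall>x\<in>W. sc r x \<in> W)"

lemma R_submodule_sum:
  "R_submodule sc W \<Longrightarrow> (\<And>i. i \<in> I \<Longrightarrow> f i \<in> W) \<Longrightarrow> (\<Sum>i\<in>I. f i) \<in> W"
  by (induction I rule: infinite_finite_induct) (auto simp: R_submodule_def)

lemma R_span_base:
  assumes "vector_space sc" "x \<in> X" shows "x \<in> R_span sc X"
proof -
  interpret vector_space sc by fact
  show ?thesis using assms(2) unfolding R_span_def
    by (intro CollectI exI[of _ "{x}"] exI[of _ "\<lambda>_. 1"]) simp
qed

lemma R_submodule_R_span:
  assumes "vector_space sc" shows "R_submodule sc (R_span sc X)"
  unfolding R_submodule_def
proof (intro conjI ballI)
  interpret vector_space sc by fact
  show "0 \<in> R_span sc X" unfolding R_span_def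
    by (intro CollectI exI[of _ "{}"] exI[of _ "\<lambda>_. 0"]) simp
  fix x assume "x \<in> R_span sc X"
  then obtain F r where x: "x = (\<Sum>a\<in>F. sc (r a) a)" and F: "finite F" "F \<subseteq> X" "\<forall>a\<in>F. algebraic_int (r a)"
    by (auto simp: R_span_def)
  show "sc c x \<in> R_span sc X" if "c \<in> ring_of_integers" for c
    unfolding R_span_def using F that
    by (intro CollectI exI[of _ F] exI[of _ "\<lambda>a. c * r a"])
       (auto simp: x scale_sum_right intro: algebraic_int_mult)
  fix y assume "y \<in> R_span sc X"
  then obtain F' r' where y: "y = (\<Sum>a\<in>F'. sc (r' a) a)" and F': "finite F'" "F' \<subseteq> X" "\<forall>a\<in>F'. algebraic_int (r' a)"
    by (auto simp: R_span_def)
  define q where "q a = (if a \<in> F then r a else 0) + (if a \<in> F' then r' a else 0)" for a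
  have "x = (\<Sum>a\<in>F\<union>F'. sc (if a \<in> F then r a else 0) a)"
    unfolding x using F F' by (intro sum.mono_neutral_cong_left) auto
  moreover have "y = (\<Sum>a\<in>F\<union>F'. sc (if a \<in> F' then r' a else 0) a)"
    unfolding y using F F' by (intro sum.mono_neutral_cong_left) auto
  ultimately have "x + y = (\<Sum>a\<in>F\<union>F'. sc (q a) a)"
    by (simp add: q_def scale_left_distrib sum.distrib)
  moreover have "algebraic_int (q a)" for a using F F' by (auto simp: q_def intro: algebraic_int_add)
  ultimately show "x + y \<in> R_span sc X" unfolding R_span_def using F F' by blast
qed

lemma R_span_minimal:
  assumes "R_submodule sc W" "X \<subseteq> W" shows "R_span sc X \<subseteq> W"
  using assms by (auto simp: R_span_def R_submodule_def intro!: R_submodule_sum[OF assms(1)])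

lemma R_span_finite:
  assumes "vector_space sc" "finite X" "x \<in> R_span sc X"
  shows "\<exists>r. (\<forall>a. algebraic_int (r a)) \<and> x = (\<Sum>a\<in>X. sc (r a) a)"
proof -
  interpret vector_space sc by fact
  obtain F r where x: "x = (\<Sum>a\<in>F. sc (r a) a)" and F: "finite F" "F \<subseteq> X" "\<forall>a\<in>F. algebraic_int (r a)"
    using assms(3) by (auto simp: R_span_def)
  have "x = (\<Sum>a\<in>X. sc (if a \<in> F then r a else 0) a)"
    unfolding x using F assms(2) by (intro sum.mono_neutral_cong_left) auto
  then show ?thesis using F by (intro exI[of _ "\<lambda>a. if a \<in> F then r a else 0"]) auto
qed

lemma sum_fun_apply: "(\<Sum>i\<in>I. f i) x = (\<Sum>i\<in>I. f i x)"
  by (induction I rule: infinite_finite_induct) auto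

lemma vector_space_map_scale: "vector_space (map_scale :: 'k::field_char_0 \<Rightarrow> ('g \<Rightarrow> 'k) \<Rightarrow> _)"
  by unfold_locales (auto simp: map_scale_def algebra_simps)

text \<open>The pairing between \<open>K[G]\<close> and \<open>Map(G,K)\<close>.\<close>

definition pairing :: "('g::finite \<Rightarrow> 'k::field_char_0) \<Rightarrow> ('g \<Rightarrow> 'k) \<Rightarrow> 'k" where
  "pairing x f = (\<Sum>g\<in>UNIV. x g * f g)"

lemma pairing_add_right: "pairing x (f + f') = pairing x f + pairing x f'"
  by (simp add: pairing_def distrib_left sum.distrib)

lemma pairing_scale_right: "pairing x (map_scale c f) = c * pairing x f"
  by (simp add: pairing_def map_scale_def sum_distrib_left mult_ac)

lemma pairing_add_left: "pairing (x + y) f = pairing x f + pairing y f"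
  by (simp add: pairing_def distrib_right sum.distrib)

lemma pairing_scale_left: "pairing (map_scale c x) f = c * pairing x f"
  by (simp add: pairing_def map_scale_def sum_distrib_left mult.assoc)

lemma pairing_zero_left: "pairing 0 f = 0"
  by (simp add: pairing_def)

lemma pairing_sum_left: "pairing (\<Sum>i\<in>I. x i) f = (\<Sum>i\<in>I. pairing (x i) f)"
  unfolding pairing_def sum_fun_apply sum_distrib_right by (rule sum.swap)

lemma dual_iff: "x \<in> dual A \<longleftrightarrow> (\<forall>f\<in>A. algebraic_int (pairing x f))"
  by (simp add: dual_def pairing_def)

text \<open>A finitely generated lattice is projective, by induction on the support. The values of the lattice at
a point \<open>t\<close> form an invertible ideal; so evaluation at \<open>t\<close> splits, and the projection \<open>p\<close> along a
splitting maps the lattice to a sublattice supported away from \<open>t\<close>. A dual basis of the image,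
composed with \<open>p\<close>, is completed by the functionals \<open>f \<mapsto> y\<^sub>s f(t)\<close> paired with the generators \<open>s\<close>.\<close>

lemma dual_basis_supported:
  fixes S :: "('g::finite \<Rightarrow> 'k::field_char_0) set"
  assumes K: "number_field TYPE('k)" and "finite T"
  shows "finite S \<Longrightarrow> (\<And>f t. f \<in> S \<Longrightarrow> t \<notin> T \<Longrightarrow> f t = 0) \<Longrightarrow>
    \<exists>xs. (\<forall>(u,e)\<in>set xs. u \<in> dual (R_span map_scale S) \<and> e \<in> R_span map_scale S) \<and>
      (\<forall>f\<in>R_span map_scale S. \<forall>y. f y = (\<Sum>(u,e)\<leftarrow>xs. pairing u f * e y))"
  using assms(2)
proof (induction T arbitrary: S rule: finite_induct)
  case empty
  have "f = 0" if "f \<in> R_span map_scale S" for f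
  proof -
    have "R_submodule map_scale ({0} :: ('g \<Rightarrow> 'k) set)" by (auto simp: R_submodule_def map_scale_def)
    then have "R_span map_scale S \<subseteq> {0}" by (rule R_span_minimal) (use empty in \<open>auto simp: fun_eq_iff\<close>)
    then show ?thesis using that by auto
  qed
  then have "f y = 0" if "f \<in> R_span map_scale S" for f y using that by fastforce
  then show ?case by (intro exI[of _ "[]"]) auto
next
  case (insert t T)
  note vs = vector_space_map_scale[where 'g='g and 'k='k]
  show ?case
  proof (cases "\<exists>s\<in>S. s t \<noteq> 0")
    case False
    then have "f x = 0" if "f \<in> S" "x \<notin> T" for f x using insert.prems(2)[of f x] that by auto
    then show ?thesis using insert.IH insert.prems(1) by blast
  next
    case True
    obtain y where y: "(\<Sum>s\<in>S. y s * s t) = 1" "\<And>s s'. s \<in> S \<Longrightarrow> s' \<in> S \<Longrightarrow> algebraic_int (y s * s' t)"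
      using fractional_ideal_invertible[OF K insert.prems(1), of "\<lambda>s. s t"] True by metis
    define p where "p f = f - map_scale (f t) (\<Sum>s\<in>S. map_scale (y s) s)" for f
    have p_apply: "p f x = f x - f t * (\<Sum>s\<in>S. y s * s x)" for f x
      by (simp add: p_def map_scale_def sum_fun_apply)
    have p_add: "p (f + f') = p f + p f'" and p_scale: "p (map_scale c f) = map_scale c (p f)" for f f' c
      by (auto simp: fun_eq_iff p_apply map_scale_def algebra_simps)
    let ?L = "R_span map_scale S" and ?L' = "R_span map_scale (p ` S)"
    note L = R_submodule_R_span[OF vs, of S] and L' = R_submodule_R_span[OF vs, of "p ` S"]
    have yt: "algebraic_int (f t * y s)" if "f \<in> ?L" "s \<in> S" for f s
    proof -
      have "R_submodule map_scale {f. algebraic_int (f t * y s)}"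
        by (auto simp: R_submodule_def map_scale_def distrib_right mult.assoc
            intro: algebraic_int_add algebraic_int_mult)
      then have "?L \<subseteq> {f. algebraic_int (f t * y s)}"
        by (rule R_span_minimal) (use y that in \<open>auto simp: mult.commute\<close>)
      then show ?thesis using that by auto
    qed
    have "p s \<in> ?L" if s: "s \<in> S" for s
    proof -
      have "p s = s + (\<Sum>s'\<in>S. map_scale (- (s t * y s')) s')"
        by (auto simp: fun_eq_iff p_apply sum_fun_apply map_scale_def sum_negf sum_distrib_left mult.assoc)
      also have "\<dots> \<in> ?L"
      proof -
        have "algebraic_int (- (s t * y s'))" if "s' \<in> S" for s'
          using yt[OF R_span_base[OF vs s] that] by simp
        then have "map_scale (- (s t * y s')) s' \<in> ?L" if "s' \<in> S" for s'
          using L that R_span_base[OF vs that] unfolding R_submodule_def by blast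
        then show ?thesis
          using L R_span_base[OF vs s] R_submodule_sum[OF L, of S "\<lambda>s'. map_scale (- (s t * y s')) s'"]
          unfolding R_submodule_def by blast
      qed
      finally show ?thesis .
    qed
    then have L'L: "?L' \<subseteq> ?L" by (intro R_span_minimal[OF L]) auto
    have "R_submodule map_scale {f. p f \<in> ?L'}"
      using L' by (auto simp: R_submodule_def p_add p_scale) (simp add: p_def map_scale_def zero_fun_def)
    then have pL: "?L \<subseteq> {f. p f \<in> ?L'}"
      by (rule R_span_minimal) (auto intro: R_span_base[OF vs])
    have pt: "p f t = 0" for f using y(1) by (simp add: p_apply)
    have "f x = 0" if "f \<in> p ` S" "x \<notin> T" for f x
    proof (cases "x = t")
      case False
      then have "s x = 0" if "s \<in> S" for s using insert.prems(2)[of s x] that \<open>x \<notin> T\<close> by auto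
      then have "(\<Sum>s\<in>S. y s * s x) = 0" by (intro sum.neutral) auto
      then show ?thesis using \<open>f \<in> p ` S\<close> \<open>\<And>s. s \<in> S \<Longrightarrow> s x = 0\<close> by (auto simp: p_apply)
    qed (use that pt in auto)
    then obtain xs where xs: "\<forall>(u,e)\<in>set xs. u \<in> dual ?L' \<and> e \<in> ?L'"
      "\<forall>f\<in>?L'. \<forall>y. f y = (\<Sum>(u,e)\<leftarrow>xs. pairing u f * e y)"
      using insert.IH[of "p ` S"] insert.prems(1) by auto
    (* The element of K[G] that represents the functional u composed with p. *)
    define q where "q u x = u x - (if x = t then \<Sum>s\<in>S. y s * pairing u s else 0)" for u x
    have q: "pairing (q u) f = pairing u (p f)" for u f
    proof -
      have "pairing u (p f) = pairing u f - f t * (\<Sum>s\<in>S. y s * pairing u s)"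
        by (simp add: pairing_def p_apply right_diff_distrib sum_subtractf sum_distrib_left
            sum.swap[of _ S] mult_ac)
      moreover have "pairing (q u) f = pairing u f - f t * (\<Sum>s\<in>S. y s * pairing u s)"
      proof -
        have "pairing (q u) f = (\<Sum>g\<in>UNIV. u g * f g - (if g = t then f t * (\<Sum>s\<in>S. y s * pairing u s) else 0))"
          unfolding pairing_def[of "q u"] by (rule sum.cong) (auto simp: q_def algebra_simps)
        then show ?thesis by (simp add: sum_subtractf pairing_def)
      qed
      ultimately show ?thesis by simp
    qed
    define d where "d s x = (if x = t then y s else 0)" for s x
    have d: "pairing (d s) f = f t * y s" for s f
    proof -
      have "pairing (d s) f = (\<Sum>g\<in>UNIV. if g = t then f t * y s else 0)"
        unfolding pairing_def by (rule sum.cong) (auto simp: d_def)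
      then show ?thesis by simp
    qed
    obtain ss where ss: "set ss = S" "distinct ss" using finite_distinct_list[OF insert.prems(1)] by auto
    define ys where "ys = map (\<lambda>(u,e). (q u, e)) xs @ map (\<lambda>s. (d s, s)) ss"
    have "u \<in> dual ?L \<and> e \<in> ?L" if "(u,e) \<in> set ys" for u e
    proof -
      from that consider u' where "(u',e) \<in> set xs" "u = q u'" | "e \<in> S" "u = d e"
        by (auto simp: ys_def ss)
      then show ?thesis
      proof cases
        case 1
        then have "u' \<in> dual ?L'" "e \<in> ?L'" using xs(1) by auto
        then show ?thesis using 1 pL L'L by (auto simp: dual_iff q)
      next
        case 2
        then show ?thesis using yt R_span_base[OF vs] by (auto simp: dual_iff d)
      qed
    qed
    moreover have "f x = (\<Sum>(u,e)\<leftarrow>ys. pairing u f * e x)" if f: "f \<in> ?L" for f x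
    proof -
      have "(\<Sum>(u,e)\<leftarrow>ys. pairing u f * e x) = (\<Sum>(u,e)\<leftarrow>xs. pairing u (p f) * e x) + (\<Sum>s\<leftarrow>ss. f t * y s * s x)"
        by (simp add: ys_def o_def q d case_prod_unfold)
      also have "(\<Sum>(u,e)\<leftarrow>xs. pairing u (p f) * e x) = p f x" using xs(2) pL f by auto
      also have "(\<Sum>s\<leftarrow>ss. f t * y s * s x) = f t * (\<Sum>s\<in>S. y s * s x)"
        using ss by (simp add: sum_list_distinct_conv_sum_set sum_distrib_left mult.assoc)
      finally show ?thesis by (simp add: p_apply)
    qed
    ultimately show ?thesis by (intro exI[of _ ys]) auto
  qed
qed

lemma lattice_dual_basis:
  fixes S :: "('g::finite \<Rightarrow> 'k::field_char_0) set"
  assumes K: "number_field TYPE('k)" and S: "finite S" and L: "L = R_span map_scale S"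
  shows "\<exists>(n::nat) u e. (\<forall>i<n. u i \<in> dual L \<and> e i \<in> L) \<and>
     (\<forall>f\<in>L. \<forall>y. f y = (\<Sum>i<n. pairing (u i) f * e i y))"
proof -
  obtain xs where xs: "\<forall>(u,e)\<in>set xs. u \<in> dual L \<and> e \<in> L"
      "\<forall>f\<in>L. \<forall>y. f y = (\<Sum>(u,e)\<leftarrow>xs. pairing u f * e y)"
    using dual_basis_supported[OF K, of UNIV S] S unfolding L by auto
  show ?thesis
  proof (intro exI conjI allI impI ballI)
    fix i assume "i < length xs"
    then have "xs ! i \<in> set xs" by simp
    then show "fst (xs ! i) \<in> dual L" "snd (xs ! i) \<in> L" using xs(1) by auto
  next
    fix f y assume "f \<in> L"
    then show "f y = (\<Sum>i<length xs. pairing (fst (xs ! i)) f * snd (xs ! i) y)"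
      using xs(2) by (simp add: sum_list_sum_nth case_prod_unfold lessThan_atLeast0)
  qed
qed

section \<open>Hopf orders, their duals and comodules\<close>

lemma R_order_vector_space: "R_order sc B \<Longrightarrow> vector_space sc"
  by (simp add: R_order_def K_algebra_def)

lemma R_order_R_submodule:
  assumes "R_order sc B" shows "R_submodule sc B"
  using assms R_submodule_R_span[OF R_order_vector_space[OF assms]] by (auto simp: R_order_def)

lemma R_order_integral_multiple:
  fixes sc :: "'k::field_char_0 \<Rightarrow> 'b::comm_ring_1 \<Rightarrow> 'b"
  assumes K: "number_field TYPE('k)" and B: "R_order sc B"
  shows "\<exists>d::int. d \<noteq> 0 \<and> sc (of_int d) x \<in> B"
proof -
  interpret vector_space sc by (rule R_order_vector_space[OF B])
  note sub = R_order_R_submodule[OF B, unfolded R_submodule_def]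
  have ri: "algebraic_int (of_int d :: 'k)" for d by (rule int_imp_algebraic_int) auto
  let ?W = "{x. \<exists>d::int. d \<noteq> 0 \<and> sc (of_int d) x \<in> B}"
  have "subspace ?W"
    unfolding subspace_def
  proof (intro conjI ballI allI)
    show "0 \<in> ?W" using sub by (auto intro: exI[of _ 1])
  next
    fix x y assume "x \<in> ?W" "y \<in> ?W"
    then obtain d e :: int where de: "d \<noteq> 0" "sc (of_int d) x \<in> B" "e \<noteq> 0" "sc (of_int e) y \<in> B" by auto
    have "sc (of_int (d * e)) (x + y) = sc (of_int e) (sc (of_int d) x) + sc (of_int d) (sc (of_int e) y)"
      by (simp add: scale_right_distrib mult.commute)
    also have "\<dots> \<in> B" using de sub ri by blast
    finally show "x + y \<in> ?W" using de by (intro CollectI exI[of _ "d * e"]) auto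
  next
    fix c :: 'k and x assume "x \<in> ?W"
    then obtain d :: int where d: "d \<noteq> 0" "sc (of_int d) x \<in> B" by auto
    obtain e :: int where e: "e \<noteq> 0" "algebraic_int (of_int e * c)"
      using number_field_integral_multiple[OF K] by blast
    have "sc (of_int (d * e)) (sc c x) = sc (of_int e * c) (sc (of_int d) x)" by (simp add: mult_ac)
    also have "\<dots> \<in> B" using d e sub by blast
    finally show "sc c x \<in> ?W" using d e by (intro CollectI exI[of _ "d * e"]) auto
  qed
  moreover have "B \<subseteq> ?W" by (auto intro: exI[of _ 1])
  ultimately have "span B \<subseteq> ?W" by (rule span_minimal[rotated])
  then show ?thesis using B by (auto simp: R_order_def)
qed

lemma map_scale_apply: "map_scale c f g = c * f g"
  by (simp add: map_scale_def)

locale hopf_lattice =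
  fixes A :: "('g::{finite,ab_group_add} \<Rightarrow> 'k::field_char_0) set"
  assumes K: "number_field TYPE('k)" and hopf: "hopf_order A"
begin

lemma order: "R_order map_scale A" using hopf by (simp add: hopf_order_def)

lemma A_sub: "R_submodule map_scale A" by (rule R_order_R_submodule[OF order])

lemma A_one: "1 \<in> A" and A_mult: "\<And>f f'. f \<in> A \<Longrightarrow> f' \<in> A \<Longrightarrow> f * f' \<in> A"
  and A_span: "module.span map_scale A = UNIV"
  using order by (auto simp: R_order_def)

lemma A_scale: "algebraic_int r \<Longrightarrow> f \<in> A \<Longrightarrow> map_scale r f \<in> A"
  using A_sub by (auto simp: R_submodule_def)

text \<open>Evaluation at \<open>g\<close> turns multiplication by \<open>f\<close> on \<open>A\<close> into multiplication by \<open>f g\<close> on a lattice in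
\<open>K\<close>, which is nonzero as \<open>1\<close> belongs to \<open>A\<close>.\<close>

lemma A_values_integral:
  assumes "f \<in> A" shows "algebraic_int (f g)"
proof -
  obtain S where S: "finite S" "A = R_span map_scale S" using order by (auto simp: R_order_def)
  note vs = vector_space_map_scale[where 'g='g and 'k='k]
  have "\<exists>r. (\<forall>a. algebraic_int (r a)) \<and> f * s = (\<Sum>a\<in>S. map_scale (r a) a)" if "s \<in> S" for s
    using R_span_finite[OF vs S(1)] A_mult[OF assms] R_span_base[OF vs that] S(2) by blast
  then obtain r where r: "\<And>s a. s \<in> S \<Longrightarrow> algebraic_int (r s a)"
    "\<And>s. s \<in> S \<Longrightarrow> f * s = (\<Sum>a\<in>S. map_scale (r s a) a)" by metis
  have "\<exists>s\<in>S. s g \<noteq> 0"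
  proof (rule ccontr)
    assume "\<not> ?thesis"
    then have "R_span map_scale S \<subseteq> {f. f g = 0}"
      by (intro R_span_minimal) (auto simp: R_submodule_def map_scale_def)
    then show False using A_one S(2) by auto
  qed
  then obtain s0 where s0: "s0 \<in> S" "s0 g \<noteq> 0" by auto
  show ?thesis
  proof (rule algebraic_int_of_stable_lattice[OF S(1) _ _ s0(1), of r _ "\<lambda>s. s g"])
    show "f g * s g = (\<Sum>t\<in>S. r s t * t g)" if "s \<in> S" for s
      using fun_cong[OF r(2)[OF that], of g] by (simp add: sum_fun_apply map_scale_def)
  qed (use r s0 in auto)
qed

lemma integral_in_dual: "(\<And>g. algebraic_int (u g)) \<Longrightarrow> u \<in> dual A"
  unfolding dual_iff pairing_def
  by (intro ballI algebraic_int_sum algebraic_int_mult[OF _ A_values_integral])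

lemma gr_elem_in_dual: "gr_elem g \<in> dual A"
  by (rule integral_in_dual) (auto simp: gr_elem_def)

lemma integral_multiple_in_dual: "\<exists>d::int. d \<noteq> 0 \<and> map_scale (of_int d) v \<in> dual A"
  using common_integral_multiple[OF K, of v] by (auto intro: integral_in_dual simp: map_scale_def)

lemma dual_sub: "R_submodule map_scale (dual A)"
  by (auto simp: R_submodule_def dual_iff pairing_zero_left pairing_add_left pairing_scale_left
      intro: algebraic_int_add algebraic_int_mult)

lemma dual_zero: "0 \<in> dual A" using dual_sub by (simp add: R_submodule_def)

text \<open>As \<open>A\<close> spans \<open>Map(G,K)\<close>, the expansion in the dual basis holds for all functions; for indicator
functions it says that \<open>\<Sum> u\<^sub>i \<otimes> e\<^sub>i\<close> is the unit matrix.\<close>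

lemma dual_basis:
  obtains n :: nat and u e where "\<And>i. i < n \<Longrightarrow> u i \<in> dual A" "\<And>i. i < n \<Longrightarrow> e i \<in> A"
    "\<And>f y. f y = (\<Sum>i<n. pairing (u i) f * e i y)"
    "\<And>x y. (\<Sum>i<n. u i x * e i y) = (if x = y then 1 else 0)"
proof -
  obtain S where S: "finite S" "A = R_span map_scale S" using order by (auto simp: R_order_def)
  obtain n :: nat and u e where ue: "\<forall>i<n. u i \<in> dual A \<and> e i \<in> A"
     "\<forall>f\<in>A. \<forall>y. f y = (\<Sum>i<n. pairing (u i) f * e i y)"
    using lattice_dual_basis[OF K S] by (elim exE conjE)
  interpret vector_space "map_scale :: 'k \<Rightarrow> ('g \<Rightarrow> 'k) \<Rightarrow> _" by (rule vector_space_map_scale)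
  have "subspace {f. \<forall>y. f y = (\<Sum>i<n. pairing (u i) f * e i y)}"
    unfolding subspace_def
  proof (intro conjI ballI allI)
    show "0 \<in> {f. \<forall>y. f y = (\<Sum>i<n. pairing (u i) f * e i y)}" by (simp add: pairing_def)
    fix f f' c
    assume f: "f \<in> {f. \<forall>y. f y = (\<Sum>i<n. pairing (u i) f * e i y)}"
    then show "map_scale c f \<in> {f. \<forall>y. f y = (\<Sum>i<n. pairing (u i) f * e i y)}"
      by (simp add: pairing_scale_right mult.assoc sum_distrib_left[symmetric] map_scale_apply)
    assume f': "f' \<in> {f. \<forall>y. f y = (\<Sum>i<n. pairing (u i) f * e i y)}"
    show "f + f' \<in> {f. \<forall>y. f y = (\<Sum>i<n. pairing (u i) f * e i y)}"
      using f f' by (simp add: pairing_add_right distrib_right sum.distrib)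
  qed
  then have "span A \<subseteq> {f. \<forall>y. f y = (\<Sum>i<n. pairing (u i) f * e i y)}"
    using ue(2) by (intro span_minimal) auto
  then have f: "f y = (\<Sum>i<n. pairing (u i) f * e i y)" for f y using A_span by auto
  have "pairing (u i) (gr_elem x) = u i x" for i x
  proof -
    have "pairing (u i) (gr_elem x) = (\<Sum>g\<in>UNIV. if g = x then u i x else 0)"
      unfolding pairing_def gr_elem_def by (rule sum.cong) auto
    then show ?thesis by simp
  qed
  then have "(\<Sum>i<n. u i x * e i y) = (if x = y then 1 else 0)" for x y
    using f[of "gr_elem x" y] by (simp add: gr_elem_def eq_commute)
  then show ?thesis using that ue(1) f by blast
qed

end

text \<open>The order \<open>A\<close> is an instance of this locale, with \<open>comult\<close> as its coaction
(\<open>hopf_comodule_regular\<close>); so the lemmas below serve for both sides of the comparison.\<close>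

locale hopf_comodule = hopf_lattice A for A :: "('g::{finite,ab_group_add} \<Rightarrow> 'k::field_char_0) set" +
  fixes sc :: "'k \<Rightarrow> 'b::comm_ring_1 \<Rightarrow> 'b" and B :: "'b set" and \<rho> :: "'b \<Rightarrow> 'g \<Rightarrow> 'b"
  assumes B_order: "R_order sc B" and comod: "comodule_algebra sc B A \<rho>"
begin

sublocale vector_space sc by (rule R_order_vector_space[OF B_order])

lemma sc_mult_left: "sc c x * y = sc c (x * y)"
  using B_order by (simp add: R_order_def K_algebra_def)

lemma sc_mult_right: "x * sc c y = sc c (x * y)"
  using sc_mult_left[of c y x] by (simp add: mult.commute)

lemma B_sub: "R_submodule sc B" by (rule R_order_R_submodule[OF B_order])

lemma B_one: "1 \<in> B" and B_mult: "\<And>x y. x \<in> B \<Longrightarrow> y \<in> B \<Longrightarrow> x * y \<in> B"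
  using B_order by (auto simp: R_order_def)

lemma B_zero: "0 \<in> B" and B_add: "\<And>x y. x \<in> B \<Longrightarrow> y \<in> B \<Longrightarrow> x + y \<in> B"
  and B_scale: "\<And>r x. algebraic_int r \<Longrightarrow> x \<in> B \<Longrightarrow> sc r x \<in> B"
  using B_sub by (auto simp: R_submodule_def)

lemma B_diff: "x \<in> B \<Longrightarrow> y \<in> B \<Longrightarrow> x - y \<in> B"
  using B_add[of x "sc (-1) y"] B_scale[of "-1" y] by simp

lemma B_sum: "(\<And>i. i \<in> I \<Longrightarrow> f i \<in> B) \<Longrightarrow> (\<Sum>i\<in>I. f i) \<in> B"
  by (rule R_submodule_sum[OF B_sub])

lemma rho_add: "\<rho> (x + y) g = \<rho> x g + \<rho> y g" and rho_scale: "\<rho> (sc c x) g = sc c (\<rho> x g)"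
  and rho_mult: "\<rho> (x * y) g = \<rho> x g * \<rho> y g" and rho_one: "\<rho> 1 g = 1"
  and rho_rho: "\<rho> (\<rho> x h) g = \<rho> x (g + h)" and rho_0: "\<rho> x 0 = x"
  and rho_tensor: "x \<in> B \<Longrightarrow> \<rho> x \<in> tensor_with sc B A"
  using comod by (simp_all add: comodule_algebra_def)

lemma rho_zero: "\<rho> 0 g = 0" using rho_scale[of 0 0 g] by simp

lemma rho_sum: "\<rho> (\<Sum>i\<in>I. f i) g = (\<Sum>i\<in>I. \<rho> (f i) g)"
  by (induction I rule: infinite_finite_induct) (auto simp: rho_add rho_zero)

text \<open>The contraction \<open>B \<otimes> A \<rightarrow> B\<close> with an element of the dual. It is the reason why the dual acts on
\<open>B\<close> and not merely on \<open>B\<^sub>K\<close>.\<close>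

lemma tensor_with_contract:
  assumes "F \<in> tensor_with sc B A" "x \<in> dual A"
  shows "(\<Sum>g\<in>UNIV. sc (x g) (F g)) \<in> B"
proof -
  let ?W = "{F. (\<Sum>g\<in>UNIV. sc (x g) (F g)) \<in> B}"
  have scale: "(\<Sum>g\<in>UNIV. sc (x g) (sc r (F g))) = sc r (\<Sum>g\<in>UNIV. sc (x g) (F g))" for r F
    by (simp add: scale_sum_right mult.commute)
  have "R_submodule (\<lambda>r F g. sc r (F g)) ?W"
    unfolding R_submodule_def
    by (auto simp only: mem_Collect_eq scale B_scale plus_fun_apply zero_fun_apply scale_right_distrib
        scale_zero_right sum.distrib B_add sum.neutral_const B_zero)
  moreover have "{\<lambda>g. sc (a g) b | b a. b \<in> B \<and> a \<in> A} \<subseteq> ?W"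
  proof safe
    fix b a assume "b \<in> B" "a \<in> A"
    have "(\<Sum>g\<in>UNIV. sc (x g) (sc (a g) b)) = sc (pairing x a) b"
      by (simp add: pairing_def scale_sum_left)
    also have "\<dots> \<in> B" using assms(2) \<open>b \<in> B\<close> \<open>a \<in> A\<close> by (auto simp: dual_iff intro: B_scale)
    finally show "(\<Sum>g\<in>UNIV. sc (x g) (sc (a g) b)) \<in> B" .
  qed
  ultimately have "tensor_with sc B A \<subseteq> ?W" unfolding tensor_with_def by (rule R_span_minimal)
  then show ?thesis using assms(1) by auto
qed

abbreviation "ac \<equiv> act sc \<rho>"

lemma act_closed: "u \<in> dual A \<Longrightarrow> m \<in> B \<Longrightarrow> ac u m \<in> B"
  unfolding act_def by (rule tensor_with_contract[OF rho_tensor])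

lemma act_add: "ac u (x + y) = ac u x + ac u y"
  by (simp add: act_def rho_add scale_right_distrib sum.distrib)

lemma act_add_left: "ac (u + v) x = ac u x + ac v x"
  by (simp add: act_def scale_left_distrib sum.distrib)

lemma act_diff_left: "ac (u - v) x = ac u x - ac v x"
  by (simp add: act_def scale_left_diff_distrib sum_subtractf)

lemma act_zero_left: "ac 0 x = 0" by (simp add: act_def)

lemma act_zero: "ac u 0 = 0" by (simp add: act_def rho_zero)

lemma act_sum: "ac u (\<Sum>i\<in>I. f i) = (\<Sum>i\<in>I. ac u (f i))"
  by (induction I rule: infinite_finite_induct) (auto simp: act_add act_zero)

lemma act_scale: "ac u (sc c x) = sc c (ac u x)"
  by (simp add: act_def rho_scale scale_sum_right mult.commute)

lemma act_scale_left: "ac (map_scale c u) x = sc c (ac u x)"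
  by (simp add: act_def map_scale_def scale_sum_right)

lemma act_gr_elem: "ac (gr_elem g) x = \<rho> x g"
proof -
  have "ac (gr_elem g) x = (\<Sum>h\<in>UNIV. if h = g then \<rho> x g else 0)"
    unfolding act_def gr_elem_def by (rule sum.cong) auto
  then show ?thesis by simp
qed

lemma rho_closed: "x \<in> B \<Longrightarrow> \<rho> x g \<in> B"
  using act_closed[OF gr_elem_in_dual] by (simp add: act_gr_elem)

lemma act_conv: "ac (conv u v) x = ac u (ac v x)"
proof -
  have "ac (conv u v) x = (\<Sum>g\<in>UNIV. \<Sum>h\<in>UNIV. sc (u h * v (g - h)) (\<rho> x g))"
    by (simp add: act_def conv_def scale_sum_left)
  also have "\<dots> = (\<Sum>h\<in>UNIV. \<Sum>g\<in>UNIV. sc (u h * v (g - h)) (\<rho> x g))" by (rule sum.swap)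
  also have "\<dots> = (\<Sum>h\<in>UNIV. \<Sum>k\<in>UNIV. sc (u h * v k) (\<rho> x (h + k)))"
  proof (rule sum.cong)
    fix h :: 'g
    show "(\<Sum>g\<in>UNIV. sc (u h * v (g - h)) (\<rho> x g)) = (\<Sum>k\<in>UNIV. sc (u h * v k) (\<rho> x (h + k)))"
      by (rule sum.reindex_bij_witness[of _ "\<lambda>k. h + k" "\<lambda>g. g - h"]) auto
  qed simp
  also have "\<dots> = ac u (ac v x)"
    by (simp add: act_def rho_sum rho_scale rho_rho scale_sum_right)
  finally show ?thesis .
qed

lemma rho_act: "\<rho> (ac u x) g = (\<Sum>h\<in>UNIV. sc (u h) (\<rho> x (g + h)))"
  by (simp add: act_def rho_sum rho_scale rho_rho)

lemma dual_module: "is_module (dual A) ac B"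
  unfolding is_module_def
  by (auto simp: B_zero B_diff act_closed act_add act_add_left act_conv act_gr_elem rho_0)

text \<open>Multiplication by \<open>c\<close> preserves the lattice \<open>B\<close>, and a coordinate function that does not vanish on
\<open>B\<close> carries this to a lattice in \<open>K\<close>.\<close>

lemma scalar_in_B_integral:
  assumes "sc c 1 \<in> B" shows "algebraic_int c"
proof -
  obtain S where S: "finite S" "B = R_span sc S" using B_order by (auto simp: R_order_def)
  note vs = R_order_vector_space[OF B_order]
  have ex: "\<exists>r. (\<forall>a. algebraic_int (r a)) \<and> sc c s = (\<Sum>a\<in>S. sc (r a) a)" if "s \<in> S" for s
  proof -
    have "sc c s = sc c 1 * s" by (simp add: sc_mult_left)
    then have "sc c s \<in> R_span sc S" using B_mult[OF assms] R_span_base[OF vs that] S(2) by metis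
    then show ?thesis by (rule R_span_finite[OF vs S(1)])
  qed
  then obtain r where r: "\<And>s a. s \<in> S \<Longrightarrow> algebraic_int (r s a)"
    "\<And>s. s \<in> S \<Longrightarrow> sc c s = (\<Sum>a\<in>S. sc (r s a) a)" by metis
  have "\<exists>s\<in>S. s \<noteq> 0"
  proof (rule ccontr)
    assume "\<not> ?thesis"
    then have "R_span sc S \<subseteq> {0}"
      by (intro R_span_minimal) (auto simp: R_submodule_def)
    then show False using B_one S(2) by auto
  qed
  then obtain s0 where s0: "s0 \<in> S" "s0 \<noteq> 0" by auto
  obtain E where E: "s0 \<in> E" "independent E" "span E = UNIV"
  proof -
    have "independent {s0}" using s0 by simp
    then show ?thesis using that[of "extend_basis {s0}"] independent_extend_basis span_extend_basis
      extend_basis_superset by blast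
  qed
  let ?e = "\<lambda>s. representation E s s0"
  have lin: "?e (\<Sum>a\<in>S. sc (f a) a) = (\<Sum>a\<in>S. f a * ?e a)" for f
    using E by (simp add: representation_sum representation_scale)
  show ?thesis
  proof (rule algebraic_int_of_stable_lattice[OF S(1) _ _ s0(1), of r _ ?e])
    show "c * ?e s = (\<Sum>t\<in>S. r s t * ?e t)" if "s \<in> S" for s
    proof -
      have "c * ?e s = ?e (sc c s)" using E by (simp add: representation_scale)
      also have "\<dots> = (\<Sum>t\<in>S. r s t * ?e t)" unfolding r(2)[OF that] by (rule lin)
      finally show ?thesis .
    qed
    show "?e s0 \<noteq> 0" using E by (simp add: representation_basis)
  qed (use r in auto)
qed

end

lemma (in hopf_lattice) hopf_comodule_regular: "hopf_comodule A map_scale A comult"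
proof unfold_locales
  show "R_order map_scale A" by (rule order)
  show "comodule_algebra map_scale A A comult"
    using hopf unfolding comodule_algebra_def hopf_order_def
    by (auto simp: fun_eq_iff comult_def map_scale_def add.assoc)
qed

lemma act_comult: "act map_scale comult u f h = (\<Sum>g\<in>UNIV. u g * f (h + g))"
  by (simp add: act_def sum_fun_apply map_scale_def comult_def)

context hopf_lattice
begin

interpretation A: hopf_comodule A map_scale A comult by (rule hopf_comodule_regular)

text \<open>The action on \<open>A\<close> is the transpose of the multiplication of \<open>K[G]\<close>; so the dual is closed under
convolution.\<close>

lemma pairing_conv:
  fixes x y f :: "'g \<Rightarrow> 'k"
  shows "pairing (conv x y) f = pairing x (act map_scale comult y f)"
proof -
  have "pairing (conv x y) f = (\<Sum>g\<in>UNIV. \<Sum>h\<in>UNIV. x h * y (g - h) * f g)"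
    by (simp add: pairing_def conv_def sum_distrib_right)
  also have "\<dots> = (\<Sum>h\<in>UNIV. \<Sum>g\<in>UNIV. x h * y (g - h) * f g)" by (rule sum.swap)
  also have "\<dots> = (\<Sum>h\<in>UNIV. \<Sum>k\<in>UNIV. x h * y k * f (h + k))"
  proof (rule sum.cong)
    fix h :: 'g
    show "(\<Sum>g\<in>UNIV. x h * y (g - h) * f g) = (\<Sum>k\<in>UNIV. x h * y k * f (h + k))"
      by (rule sum.reindex_bij_witness[of _ "\<lambda>k. h + k" "\<lambda>g. g - h"]) auto
  qed simp
  finally show ?thesis by (simp add: pairing_def act_comult sum_distrib_left mult.assoc)
qed

lemma dual_conv: "x \<in> dual A \<Longrightarrow> y \<in> dual A \<Longrightarrow> conv x y \<in> dual A"
  by (subst dual_iff) (auto simp: pairing_conv dual_iff[of x] intro: A.act_closed)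

lemma antipode_closed: "f \<in> A \<Longrightarrow> antipode f \<in> A"
  using hopf by (simp add: hopf_order_def)

lemma pairing_antipode: "pairing (antipode u) f = pairing u (antipode f)"
  unfolding pairing_def antipode_def
  by (rule sum.reindex_bij_witness[of _ uminus uminus]) auto

lemma dual_antipode: "u \<in> dual A \<Longrightarrow> antipode u \<in> dual A"
  by (auto simp: dual_iff pairing_antipode intro: antipode_closed)

end

section \<open>Integrals and self-duality of a Hopf order\<close>

locale hopf_integral = hopf_lattice A for A :: "('g::{finite,ab_group_add} \<Rightarrow> 'k::field_char_0) set" +
  fixes l :: 'k
  assumes integrals: "counit ` integrals A = {l * r | r. r \<in> ring_of_integers}"
begin

interpretation A: hopf_comodule A map_scale A comult by (rule hopf_comodule_regular)

lemma delta_integral: "map_scale c (gr_elem 0) \<in> A \<longleftrightarrow> map_scale c (gr_elem 0) \<in> integrals A"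
  by (auto simp: integrals_def fun_eq_iff map_scale_def gr_elem_def counit_def)

lemma delta_multiple: obtains d :: int where "d \<noteq> 0" "map_scale (of_int d) (gr_elem 0) \<in> A"
  using R_order_integral_multiple[OF K order] by blast

text \<open>A nonzero multiple of the indicator function of \<open>0\<close> belongs to \<open>A\<close>; multiplying an integral by it
shows that the integral vanishes outside \<open>0\<close>.\<close>

lemma integral_form:
  assumes "x \<in> integrals A" shows "x = map_scale (x 0) (gr_elem 0)"
proof -
  obtain d :: int where d: "d \<noteq> 0" "map_scale (of_int d) (gr_elem 0) \<in> A" by (rule delta_multiple)
  then have "map_scale (of_int d) (gr_elem 0) * x = map_scale (of_int d) x"
    using assms by (auto simp: integrals_def counit_def map_scale_def gr_elem_def)
  then have "\<forall>g. of_int d * gr_elem 0 g * x g = of_int d * x g"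
    by (simp add: fun_eq_iff map_scale_def)
  then have "x g = 0" if "g \<noteq> 0" for g using d(1) that by (auto simp: gr_elem_def dest!: spec[of _ g])
  then show ?thesis by (auto simp: fun_eq_iff map_scale_def gr_elem_def)
qed

lemma delta_iff: "map_scale c (gr_elem 0) \<in> A \<longleftrightarrow> (\<exists>r. algebraic_int r \<and> c = l * r)"
proof -
  have "c \<in> counit ` integrals A \<longleftrightarrow> map_scale c (gr_elem 0) \<in> A"
  proof
    assume "c \<in> counit ` integrals A"
    then obtain x where "x \<in> integrals A" "c = x 0" by (auto simp: counit_def)
    then have "map_scale c (gr_elem 0) = x" using integral_form by auto
    then show "map_scale c (gr_elem 0) \<in> A" using \<open>x \<in> integrals A\<close> by (auto simp: integrals_def)
  next
    assume "map_scale c (gr_elem 0) \<in> A"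
    then show "c \<in> counit ` integrals A" unfolding delta_integral
      by (intro image_eqI[of _ _ "map_scale c (gr_elem 0)"]) (auto simp: counit_def map_scale_def gr_elem_def)
  qed
  then show ?thesis unfolding integrals by auto
qed

lemma l_nonzero: "l \<noteq> 0"
proof
  assume "l = 0"
  obtain d :: int where d: "d \<noteq> 0" "map_scale (of_int d) (gr_elem 0) \<in> A" by (rule delta_multiple)
  then show False using delta_iff \<open>l = 0\<close> by auto
qed

definition generator :: "'g \<Rightarrow> 'k" where "generator = map_scale l (gr_elem 0)"

lemma generator_in: "generator \<in> A"
  unfolding generator_def delta_iff by (auto intro: exI[of _ 1])

text \<open>The core of the Larson-Sweedler theorem. For a dual basis \<open>u\<^sub>i, e\<^sub>i\<close> of \<open>A\<close>, the element
\<open>\<Sum> u\<^sub>i \<cdot> (e\<^sub>i f)\<close> of \<open>A\<close> is the projection of \<open>f\<close> to the integrals: since \<open>\<Sum> u\<^sub>i \<otimes> e\<^sub>i\<close> is the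
unit matrix, it is the sum of the values of \<open>f\<close> times the indicator function of \<open>0\<close>.\<close>

lemma sum_divisible:
  assumes "f \<in> A" shows "algebraic_int (inverse l * (\<Sum>g\<in>UNIV. f g))"
proof -
  obtain n :: nat and u e where ue: "\<And>i. i < n \<Longrightarrow> u i \<in> dual A" "\<And>i. i < n \<Longrightarrow> e i \<in> A"
    "\<And>x y. (\<Sum>i<n. u i x * e i y) = (if x = y then 1 else 0)"
    by (rule dual_basis) blast
  have "(\<Sum>i<n. act map_scale comult (u i) (e i * f)) h = map_scale (\<Sum>g\<in>UNIV. f g) (gr_elem 0) h" for h
  proof -
    have "(\<Sum>i<n. act map_scale comult (u i) (e i * f)) h = (\<Sum>i<n. \<Sum>g\<in>UNIV. u i g * (e i (h + g) * f (h + g)))"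
      by (simp add: sum_fun_apply act_comult)
    also have "\<dots> = (\<Sum>g\<in>UNIV. \<Sum>i<n. u i g * (e i (h + g) * f (h + g)))" by (rule sum.swap)
    also have "\<dots> = (\<Sum>g\<in>UNIV. (\<Sum>i<n. u i g * e i (h + g)) * f (h + g))"
      by (simp add: sum_distrib_right mult.assoc)
    also have "\<dots> = map_scale (\<Sum>g\<in>UNIV. f g) (gr_elem 0) h"
      by (cases "h = 0") (auto simp: ue(3) map_scale_def gr_elem_def)
    finally show ?thesis .
  qed
  then have "map_scale (\<Sum>g\<in>UNIV. f g) (gr_elem 0) = (\<Sum>i<n. act map_scale comult (u i) (e i * f))" by auto
  also have "\<dots> \<in> A" by (intro A.B_sum A.act_closed A_mult assms ue) auto
  finally obtain r where "algebraic_int r" "(\<Sum>g\<in>UNIV. f g) = l * r" using delta_iff by auto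
  then show ?thesis using l_nonzero by (simp add: mult.assoc[symmetric])
qed

text \<open>Together with \<open>scaled_dual\<close> below this says that \<open>A\<close> is \<open>l\<close> times its dual, that is, self-dual for
the trace form divided by \<open>l\<close>.\<close>

lemma A_subset_dual: "f \<in> A \<Longrightarrow> map_scale (inverse l) f \<in> dual A"
  unfolding dual_iff using sum_divisible[OF A_mult]
  by (auto simp: pairing_def map_scale_def sum_distrib_left mult.assoc)

lemma act_generator: "act map_scale comult u generator = map_scale l (antipode u)"
proof
  fix h
  have "act map_scale comult u generator h = (\<Sum>g\<in>UNIV. if g = - h then u g * l else 0)"
    unfolding act_comult by (rule sum.cong) (auto simp: generator_def map_scale_def gr_elem_def add_eq_0_iff)
  then show "act map_scale comult u generator h = map_scale l (antipode u) h"
    by (simp add: map_scale_def antipode_def)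
qed

lemma regular_cyclic:
  assumes "m \<in> A" shows "\<exists>!v. v \<in> dual A \<and> m = act map_scale comult v generator"
proof (rule ex1I[of _ "map_scale (inverse l) (antipode m)"], intro conjI)
  show "map_scale (inverse l) (antipode m) \<in> dual A" by (intro A_subset_dual antipode_closed assms)
  show "m = act map_scale comult (map_scale (inverse l) (antipode m)) generator"
    using l_nonzero by (auto simp: act_generator fun_eq_iff map_scale_def antipode_def)
  fix v assume "v \<in> dual A \<and> m = act map_scale comult v generator"
  then show "v = map_scale (inverse l) (antipode m)"
    using l_nonzero by (auto simp: act_generator fun_eq_iff map_scale_def antipode_def)
qed

end

section \<open>Tensor products over the ring of integers\<close>

lemma UN_eq_const: "X \<noteq> {} \<Longrightarrow> (\<And>x. x \<in> X \<Longrightarrow> f x = C) \<Longrightarrow> (\<Union>x\<in>X. f x) = C"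
  by auto

text \<open>The tensor product of two orders by generators and relations. The lemmas of this locale replace
classes by representatives in the ring operations and in the maps \<open>id \<otimes> f\<close>.\<close>

locale tensor_lattice =
  fixes scM :: "'k::field_char_0 \<Rightarrow> 'm::comm_ring_1 \<Rightarrow> 'm" and M :: "'m set"
    and scN :: "'k \<Rightarrow> 'n::comm_ring_1 \<Rightarrow> 'n" and N :: "'n set"
  assumes algM: "K_algebra scM" and algN: "K_algebra scN"
    and subM: "R_submodule scM M" and subN: "R_submodule scN N"
    and multM: "\<And>x y. x \<in> M \<Longrightarrow> y \<in> M \<Longrightarrow> x * y \<in> M"
    and multN: "\<And>x y. x \<in> N \<Longrightarrow> y \<in> N \<Longrightarrow> x * y \<in> N"
begin

abbreviation "TE \<equiv> tensor_eq scM M scN N"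
abbreviation "cl \<equiv> tensor_class scM M scN N"
abbreviation "TR \<equiv> tensor_ring scM M scN N"

lemma M_closed: "0 \<in> M" "x \<in> M \<Longrightarrow> y \<in> M \<Longrightarrow> x + y \<in> M" "algebraic_int r \<Longrightarrow> x \<in> M \<Longrightarrow> scM r x \<in> M"
  using subM by (auto simp: R_submodule_def)

lemma N_closed: "0 \<in> N" "x \<in> N \<Longrightarrow> y \<in> N \<Longrightarrow> x + y \<in> N" "algebraic_int r \<Longrightarrow> x \<in> N \<Longrightarrow> scN r x \<in> N"
  using subN by (auto simp: R_submodule_def)

lemma scM_mult: "scM c x * y = scM c (x * y)" using algM by (simp add: K_algebra_def)
lemma scN_mult: "scN c x * y = scN c (x * y)" using algN by (simp add: K_algebra_def)

lemma TE_in: "TE x y \<Longrightarrow> set_mset x \<subseteq> M \<times> N \<and> set_mset y \<subseteq> M \<times> N"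
  by (induction rule: tensor_eq.induct) (auto simp: M_closed N_closed)

lemma TE_add: assumes "TE x x'" "TE y y'" shows "TE (x + y) (x' + y')"
proof (rule tensor_eq.trans)
  show "TE (x + y) (x' + y)" by (rule tensor_eq.cong[OF assms(1)]) (use TE_in[OF assms(2)] in simp)
  have "TE (y + x') (y' + x')" by (rule tensor_eq.cong[OF assms(2)]) (use TE_in[OF assms(1)] in simp)
  then show "TE (x' + y) (x' + y')" by (simp only: add.commute)
qed

text \<open>A relation between generators can be applied to all members of a multiset at once.\<close>

lemma TE_image:
  assumes "\<And>p. p \<in># y \<Longrightarrow> TE {#f p#} (F p)"
  shows "TE (image_mset f y) (\<Sum>p\<in>#y. F p)"
  using assms
proof (induction y)
  case (add p y)
  then have "TE ({#f p#} + image_mset f y) (F p + (\<Sum>p\<in>#y. F p))" by (intro TE_add) auto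
  then show ?case by simp
qed (auto intro: tensor_eq.refl)

lemma class_self: "set_mset x \<subseteq> M \<times> N \<Longrightarrow> x \<in> cl x"
  by (simp add: tensor_class_def tensor_eq.refl)

lemma class_eq: assumes "TE x y" shows "cl x = cl y"
proof -
  have "TE x z \<longleftrightarrow> TE y z" for z
    using tensor_eq.trans[OF assms] tensor_eq.trans[OF tensor_eq.sym[OF assms]] by metis
  then show ?thesis by (simp add: tensor_class_def)
qed

lemma class_memD: "y \<in> cl x \<Longrightarrow> TE x y" by (simp add: tensor_class_def)

lemma class_eqD: "set_mset x \<subseteq> M \<times> N \<Longrightarrow> cl x = cl y \<Longrightarrow> TE x y"
  using class_self[of x] tensor_eq.sym[OF class_memD[of x y]] by simp

lemma carrier_ring: "carrier TR = cl ` {x. set_mset x \<subseteq> M \<times> N}"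
  by (simp add: tensor_ring_def Let_def)

lemma add_ring:
  assumes "set_mset x \<subseteq> M \<times> N" "set_mset y \<subseteq> M \<times> N"
  shows "cl x \<oplus>\<^bsub>TR\<^esub> cl y = cl (x + y)"
proof -
  have "cl (x' + y') = cl (x + y)" if "x' \<in> cl x" "y' \<in> cl y" for x' y'
    using class_eq[OF TE_add[OF class_memD[OF that(1)] class_memD[OF that(2)]]] by simp
  moreover have "cl x \<oplus>\<^bsub>TR\<^esub> cl y = (\<Union>x'\<in>cl x. \<Union>y'\<in>cl y. cl (x' + y'))"
    by (simp only: tensor_ring_def Let_def ring.simps)
  ultimately show ?thesis using class_self[OF assms(1)] class_self[OF assms(2)]
    by (metis (no_types, lifting) UN_eq_const empty_iff)
qed

lemma TE_zero_right:
  assumes "m \<in> M" shows "TE {#(m, 0)#} {#}"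
proof -
  interpret VM: vector_space scM using algM by (simp add: K_algebra_def)
  interpret VN: vector_space scN using algN by (simp add: K_algebra_def)
  have "TE {#(scM 0 m, 0)#} {#(m, scN 0 0)#}" using assms by (intro tensor_eq.balanced) (auto simp: N_closed)
  then have "TE {#(0, 0)#} {#(m, 0)#}" by simp
  from tensor_eq.trans[OF tensor_eq.sym[OF this] tensor_eq.zero[OF M_closed(1) N_closed(1)]] show ?thesis .
qed

lemma TE_sum_right:
  assumes "m \<in> M" "\<And>i. i < k \<Longrightarrow> f i \<in> N"
  shows "TE (\<Sum>i\<in>#mset_set {..<k::nat}. {#(m, f i)#}) {#(m, \<Sum>i<k. f i)#}"
  using assms(2)
proof (induction k)
  case 0
  show ?case using tensor_eq.sym[OF TE_zero_right[OF assms(1)]] by simp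
next
  case (Suc k)
  have "TE ((\<Sum>i\<in>#mset_set {..<k}. {#(m, f i)#}) + {#(m, f k)#}) ({#(m, \<Sum>i<k. f i)#} + {#(m, f k)#})"
    using Suc assms(1) by (intro TE_add tensor_eq.refl) auto
  also have "TE \<dots> {#(m, (\<Sum>i<k. f i) + f k)#}"
  proof -
    have "TE {#(m, (\<Sum>i<k. f i) + f k)#} {#(m, \<Sum>i<k. f i), (m, f k)#}"
      using Suc.prems assms(1) by (intro tensor_eq.add_right R_submodule_sum[OF subN]) auto
    from tensor_eq.sym[OF this] show ?thesis by (simp add: add_mset_commute)
  qed
  finally (tensor_eq.trans) show ?case by (simp add: lessThan_Suc add.commute)
qed

definition tmul :: "('m \<times> 'n) multiset \<Rightarrow> ('m \<times> 'n) multiset \<Rightarrow> ('m \<times> 'n) multiset" where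
  "tmul x y = (\<Sum>(m, n)\<in>#x. image_mset (\<lambda>(m', n'). (m * m', n * n')) y)"

lemma tmul_add_left: "tmul (x + z) y = tmul x y + tmul z y"
  by (simp add: tmul_def)

lemma tmul_in:
  assumes "set_mset x \<subseteq> M \<times> N" "set_mset y \<subseteq> M \<times> N" shows "set_mset (tmul x y) \<subseteq> M \<times> N"
  using assms by (fastforce simp: tmul_def multM multN)

lemma tmul_commute: "tmul x y = tmul y x"
proof -
  have 1: "tmul x y = (\<Sum>p\<in>#x. \<Sum>q\<in>#y. {#(fst p * fst q, snd p * snd q)#})" for x y
    by (simp add: tmul_def case_prod_unfold)
  show ?thesis unfolding 1[of x y] 1[of y x] by (subst sum_mset.swap) (simp only: mult.commute)
qed

lemma sum_mset_pair: "(\<Sum>p\<in>#y. {#f p, g p#}) = image_mset f y + image_mset g y"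
  by (induction y) auto

text \<open>The product respects each defining relation in its left-hand argument; for the right-hand one,
\<open>tmul\<close> is commutative.\<close>

lemma TE_tmul:
  assumes "TE x x'" "set_mset y \<subseteq> M \<times> N" shows "TE (tmul x y) (tmul x' y)"
  using assms(1)
proof (induction rule: tensor_eq.induct)
  case (refl x)
  show ?case by (rule tensor_eq.refl[OF tmul_in[OF refl assms(2)]])
next
  case (cong x x' z)
  show ?case unfolding tmul_add_left by (rule tensor_eq.cong[OF cong.IH tmul_in[OF cong.hyps(2) assms(2)]])
next
  case (zero n)
  have "TE (image_mset (\<lambda>(m', n'). (0 * m', n * n')) y) (\<Sum>p\<in>#y. {#})"
    by (intro TE_image) (use assms(2) zero in \<open>auto simp: multN intro!: tensor_eq.zero\<close>)
  then show ?case by (simp add: tmul_def)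
next
  case (add_left m m' n)
  have "TE (image_mset (\<lambda>(a, b). ((m + m') * a, n * b)) y)
      (\<Sum>p\<in>#y. {#(\<lambda>(a, b). (m * a, n * b)) p, (\<lambda>(a, b). (m' * a, n * b)) p#})"
    by (intro TE_image) (use assms(2) add_left in
        \<open>auto simp: multN multM distrib_right intro!: tensor_eq.add_left\<close>)
  then show ?case unfolding sum_mset_pair by (simp add: tmul_def)
next
  case (add_right m n n')
  have "TE (image_mset (\<lambda>(a, b). (m * a, (n + n') * b)) y)
      (\<Sum>p\<in>#y. {#(\<lambda>(a, b). (m * a, n * b)) p, (\<lambda>(a, b). (m * a, n' * b)) p#})"
    by (intro TE_image) (use assms(2) add_right in
        \<open>auto simp: multN multM distrib_right intro!: tensor_eq.add_right\<close>)
  then show ?case unfolding sum_mset_pair by (simp add: tmul_def)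
next
  case (balanced r m n)
  have "TE (image_mset (\<lambda>(a, b). (scM r m * a, n * b)) y)
      (\<Sum>p\<in>#y. {#(\<lambda>(a, b). (m * a, scN r n * b)) p#})"
    by (intro TE_image) (use assms(2) balanced in
        \<open>auto simp: multN multM scM_mult scN_mult intro!: tensor_eq.balanced\<close>)
  then show ?case by (simp add: tmul_def)
next
  case (sym x z)
  show ?case using sym.IH by (rule tensor_eq.sym)
next
  case (trans x z w)
  show ?case using trans.IH by (rule tensor_eq.trans)
qed

lemma mult_ring:
  assumes x: "set_mset x \<subseteq> M \<times> N" and y: "set_mset y \<subseteq> M \<times> N"
  shows "cl x \<otimes>\<^bsub>TR\<^esub> cl y = cl (tmul x y)"
proof -
  have "cl (tmul x' y') = cl (tmul x y)" if "x' \<in> cl x" "y' \<in> cl y" for x' y'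
  proof -
    note x' = class_memD[OF that(1)] and y' = class_memD[OF that(2)]
    have "TE (tmul x y) (tmul x' y)" by (rule TE_tmul[OF x' y])
    moreover have "TE (tmul x' y) (tmul x' y')"
      using TE_tmul[OF y', of x'] TE_in[OF x'] by (simp add: tmul_commute[of x'])
    ultimately show ?thesis using class_eq by simp
  qed
  moreover have "cl x \<otimes>\<^bsub>TR\<^esub> cl y = (\<Union>x'\<in>cl x. \<Union>y'\<in>cl y. cl (tmul x' y'))"
    by (simp add: tensor_ring_def Let_def tmul_def)
  ultimately show ?thesis using class_self[OF x] class_self[OF y]
    by (metis (no_types, lifting) UN_eq_const empty_iff)
qed

lemma tensor_right_class:
  assumes x: "set_mset x \<subseteq> M \<times> N"
    and f: "\<And>n. n \<in> N \<Longrightarrow> f n \<in> N" "\<And>n n'. n \<in> N \<Longrightarrow> n' \<in> N \<Longrightarrow> f (n + n') = f n + f n'"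
      "\<And>r n. algebraic_int r \<Longrightarrow> n \<in> N \<Longrightarrow> f (scN r n) = scN r (f n)"
  shows "tensor_right scM M scN N f (cl x) = cl (image_mset (apsnd f) x)"
proof -
  have "TE (image_mset (apsnd f) y) (image_mset (apsnd f) y')" if "TE y y'" for y y'
    using that
  proof (induction rule: tensor_eq.induct)
    case (refl x)
    then show ?case using f by (intro tensor_eq.refl) fastforce
  next
    case (cong x x' z)
    then have "set_mset (image_mset (apsnd f) z) \<subseteq> M \<times> N" using f(1) by fastforce
    then show ?case using cong by (simp add: tensor_eq.cong)
  next
    case (sym x z)
    show ?case using sym.IH by (rule tensor_eq.sym)
  next
    case (trans x z w)
    show ?case using trans.IH by (rule tensor_eq.trans)
  qed (simp_all add: f tensor_eq.zero tensor_eq.add_left tensor_eq.add_right tensor_eq.balanced)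
  then have "cl (image_mset (apsnd f) x') = cl (image_mset (apsnd f) x)" if "x' \<in> cl x" for x'
    using class_eq class_memD[OF that] by metis
  moreover have "cl x \<noteq> {}" using class_self[OF x] by blast
  ultimately show ?thesis unfolding tensor_right_def by (intro UN_eq_const)
qed

text \<open>The universal property: a balanced biadditive map is constant on classes.\<close>

lemma TE_bilinear:
  fixes \<beta> :: "'m \<Rightarrow> 'n \<Rightarrow> 'c::ab_group_add"
  assumes "TE x y"
    and "\<And>m m' n. m \<in> M \<Longrightarrow> m' \<in> M \<Longrightarrow> n \<in> N \<Longrightarrow> \<beta> (m + m') n = \<beta> m n + \<beta> m' n"
    and "\<And>m n n'. m \<in> M \<Longrightarrow> n \<in> N \<Longrightarrow> n' \<in> N \<Longrightarrow> \<beta> m (n + n') = \<beta> m n + \<beta> m n'"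
    and "\<And>r m n. algebraic_int r \<Longrightarrow> m \<in> M \<Longrightarrow> n \<in> N \<Longrightarrow> \<beta> (scM r m) n = \<beta> m (scN r n)"
  shows "(\<Sum>(m,n)\<in>#x. \<beta> m n) = (\<Sum>(m,n)\<in>#y. \<beta> m n)"
  using assms(1)
proof (induction rule: tensor_eq.induct)
  case (zero n)
  then have "\<beta> (0 + 0) n = \<beta> 0 n + \<beta> 0 n" by (intro assms) (auto simp: M_closed)
  then show ?case by simp
qed (auto simp: assms)

end

context hopf_comodule
begin

interpretation A: hopf_comodule A map_scale A comult by (rule hopf_comodule_regular)

lemma K_alg: "K_algebra sc" "K_algebra (map_scale :: 'k \<Rightarrow> ('g \<Rightarrow> 'k) \<Rightarrow> 'g \<Rightarrow> 'k)"
  using B_order order by (auto simp: R_order_def)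

sublocale BB: tensor_lattice sc B sc B
  by unfold_locales (auto simp: B_sub K_alg intro: B_mult)

sublocale BA: tensor_lattice sc B map_scale A
  by unfold_locales (auto simp: B_sub A_sub K_alg intro: B_mult A_mult)

lemma map_scale_zero: "map_scale c 0 = (0 :: 'g \<Rightarrow> 'k)"
  by (simp add: map_scale_def fun_eq_iff)

text \<open>The map \<open>B \<otimes> A \<rightarrow> Map(G,B\<^sub>K)\<close>, on representatives.\<close>

definition tensor_eval :: "('b \<times> ('g \<Rightarrow> 'k)) multiset \<Rightarrow> 'g \<Rightarrow> 'b" where
  "tensor_eval x g = (\<Sum>(b, a)\<in>#x. sc (a g) b)"

lemma tensor_eval_cong:
  assumes "BA.TE x y" shows "tensor_eval x = tensor_eval y"
proof
  fix g
  show "tensor_eval x g = tensor_eval y g" unfolding tensor_eval_def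
    by (rule BA.TE_bilinear[OF assms])
       (auto simp: scale_right_distrib scale_left_distrib map_scale_apply mult.commute)
qed

lemma tensor_eval_simps [simp]: "tensor_eval {#} = 0" "tensor_eval (x + y) = tensor_eval x + tensor_eval y" "tensor_eval {#p#} g = sc (snd p g) (fst p)"
  by (auto simp: tensor_eval_def fun_eq_iff case_prod_unfold)

lemma tensor_eval_add_mset: "tensor_eval (add_mset p x) g = sc (snd p g) (fst p) + tensor_eval x g"
  by (simp add: tensor_eval_def case_prod_unfold)

lemma tensor_eval_add_single: "tensor_eval (add_mset p x) = tensor_eval {#p#} + tensor_eval x"
  by (simp add: fun_eq_iff tensor_eval_add_mset)

lemma tensor_eval_tmul: "tensor_eval (BA.tmul x y) = tensor_eval x * tensor_eval y"
proof -
  have 1: "tensor_eval (image_mset (\<lambda>(m', n'). (b * m', a * n')) y) g = sc (a g) b * tensor_eval y g" for a b g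
    by (induction y) (auto simp: tensor_eval_add_mset sc_mult_left sc_mult_right distrib_left mult.commute)
  have "BA.tmul (add_mset p x) y = image_mset (\<lambda>(m', n'). (fst p * m', snd p * n')) y + BA.tmul x y" for p x
    by (simp add: BA.tmul_def case_prod_unfold)
  then have "tensor_eval (BA.tmul x y) g = tensor_eval x g * tensor_eval y g" for g
    by (induction x) (simp_all add: 1 tensor_eval_add_mset distrib_right BA.tmul_def[of "{#}"])
  then show ?thesis by (simp add: fun_eq_iff)
qed

lemma tensor_eval_closed:
  assumes "set_mset x \<subseteq> B \<times> A" shows "tensor_eval x g \<in> B"
  using assms
  by (induction x) (auto simp: tensor_eval_add_mset B_zero B_add B_scale A_values_integral)

lemma tensor_eval_apsnd: "tensor_eval (image_mset (apsnd (act map_scale comult u)) x) h = (\<Sum>g\<in>UNIV. sc (u g) (tensor_eval x (h + g)))"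
  by (induction x) (auto simp: tensor_eval_add_mset act_comult scale_right_distrib sum.distrib scale_sum_left)

text \<open>Expanding the right-hand factors in a dual basis brings every tensor to the form \<open>\<Sum> c\<^sub>i \<otimes> e\<^sub>i\<close>, and
the \<open>c\<^sub>i\<close> depend only on its image in \<open>Map(G,B\<^sub>K)\<close>. Hence \<open>B \<otimes> A\<close> embeds there.\<close>

lemma TE_normal_form:
  assumes "\<And>i. i < (n::nat) \<Longrightarrow> u i \<in> dual A" "\<And>i. i < n \<Longrightarrow> e i \<in> A"
    "\<And>f y. f y = (\<Sum>i<n. pairing (u i) f * e i y)"
  defines "nf \<equiv> \<lambda>F. \<Sum>i\<in>#mset_set {..<n}. {#(\<Sum>g\<in>UNIV. sc (u i g) (F g), e i)#}"
  assumes "set_mset x \<subseteq> B \<times> A"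
  shows "BA.TE x (nf (tensor_eval x))"
  using assms(5)
proof (induction x)
  case empty
  have "BA.TE (image_mset (\<lambda>i. (0, e i)) (mset_set {..<n})) (\<Sum>i\<in>#mset_set {..<n}. {#})"
    by (intro BA.TE_image tensor_eq.zero B_zero assms) simp
  from tensor_eq.sym[OF this] show ?case unfolding nf_def by simp
next
  case (add p x)
  obtain b a where p: "p = (b, a)" "b \<in> B" "a \<in> A" using add.prems by (cases p) auto
  let ?c = "\<lambda>F i. \<Sum>g\<in>UNIV. sc (u i g) (F g)"
  have c_in: "?c (tensor_eval y) i \<in> B" if "set_mset y \<subseteq> B \<times> A" "i < n" for y i
    using that(1)
  proof (induction y)
    case (add q y)
    obtain b a where q: "q = (b, a)" "b \<in> B" "a \<in> A" using add.prems by (cases q) auto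
    have "?c (tensor_eval {#q#}) i = sc (pairing (u i) a) b" by (simp add: q pairing_def scale_sum_left)
    then have "?c (tensor_eval {#q#}) i \<in> B" using q assms(1)[OF that(2)] by (auto simp: dual_iff intro: B_scale)
    then show ?case using add by (auto simp: tensor_eval_add_single[of q y] scale_right_distrib sum.distrib intro: B_add)
  qed (simp add: B_zero)
  have sub: "set_mset x \<subseteq> B \<times> A" "set_mset {#p#} \<subseteq> B \<times> A" using add.prems by auto
  have 1: "BA.TE (nf (tensor_eval {#p#} + tensor_eval x)) (nf (tensor_eval {#p#}) + nf (tensor_eval x))"
  proof -
    have "BA.TE (image_mset (\<lambda>i. (?c (tensor_eval {#p#}) i + ?c (tensor_eval x) i, e i)) (mset_set {..<n}))
        (\<Sum>i\<in>#mset_set {..<n}. {#(?c (tensor_eval {#p#}) i, e i), (?c (tensor_eval x) i, e i)#})"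
      by (intro BA.TE_image tensor_eq.add_left c_in sub assms(2)) auto
    then show ?thesis unfolding BA.sum_mset_pair by (simp add: nf_def scale_right_distrib sum.distrib)
  qed
  have 2: "BA.TE (nf (tensor_eval {#p#})) {#p#}"
  proof -
    have "BA.TE (image_mset (\<lambda>i. (sc (pairing (u i) a) b, e i)) (mset_set {..<n}))
        (\<Sum>i\<in>#mset_set {..<n}. {#(b, map_scale (pairing (u i) a) (e i))#})"
      by (intro BA.TE_image tensor_eq.balanced) (use p assms in \<open>auto simp: dual_iff\<close>)
    moreover have "?c (tensor_eval {#p#}) i = sc (pairing (u i) a) b" for i
      by (simp add: p pairing_def scale_sum_left)
    ultimately have 3: "BA.TE (nf (tensor_eval {#p#})) (\<Sum>i\<in>#mset_set {..<n}. {#(b, map_scale (pairing (u i) a) (e i))#})"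
      by (simp add: nf_def)
    have me: "map_scale (pairing (u i) a) (e i) \<in> A" if "i < n" for i
      using that assms p by (auto simp: dual_iff intro: A_scale)
    have 4: "BA.TE (\<Sum>i\<in>#mset_set {..<n}. {#(b, map_scale (pairing (u i) a) (e i))#})
            {#(b, \<Sum>i<n. map_scale (pairing (u i) a) (e i))#}"
      by (intro BA.TE_sum_right p me)
    moreover have "(\<Sum>i<n. map_scale (pairing (u i) a) (e i)) = a"
      by (rule ext, subst (2) assms(3)) (simp add: sum_fun_apply map_scale_apply)
    ultimately show ?thesis using tensor_eq.trans[OF 3 4] p(1) by simp
  qed
  have "BA.TE ({#p#} + x) (nf (tensor_eval {#p#}) + nf (tensor_eval x))"
    using add.IH[OF sub(1)] by (intro BA.TE_add tensor_eq.sym[OF 2])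
  from tensor_eq.trans[OF this tensor_eq.sym[OF 1]]
  have "BA.TE ({#p#} + x) (nf (tensor_eval (add_mset p x)))" unfolding tensor_eval_add_single[of p x] .
  moreover have "{#p#} + x = add_mset p x" by simp
  ultimately show ?case by metis
qed

lemma tensor_eval_injective:
  assumes "set_mset x \<subseteq> B \<times> A" "set_mset y \<subseteq> B \<times> A" "tensor_eval x = tensor_eval y"
  shows "BA.TE x y"
proof -
  obtain n :: nat and u e where ue: "\<And>i. i < n \<Longrightarrow> u i \<in> dual A" "\<And>i. i < n \<Longrightarrow> e i \<in> A"
    "\<And>f y. f y = (\<Sum>i<n. pairing (u i) f * e i y)"
    by (rule dual_basis) blast
  define nf where "nf F = (\<Sum>i\<in>#mset_set {..<n}. {#(\<Sum>g\<in>UNIV. sc (u i g) (F g), e i)#})" for F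
  have nf: "BA.TE z (nf (tensor_eval z))" if "set_mset z \<subseteq> B \<times> A" for z
    unfolding nf_def by (rule TE_normal_form[where n = n and u = u and e = e]) (fact ue that)+
  have "BA.TE x (nf (tensor_eval y))" using nf[OF assms(1)] assms(3) by simp
  then show ?thesis using tensor_eq.sym[OF nf[OF assms(2)]] by (rule tensor_eq.trans)
qed

end

section \<open>The translation map of a principal homogeneous space\<close>

context hopf_comodule
begin

interpretation A: hopf_comodule A map_scale A comult by (rule hopf_comodule_regular)

definition class_eval :: "('b \<times> ('g \<Rightarrow> 'k)) multiset set \<Rightarrow> 'g \<Rightarrow> 'b" where
  "class_eval X = tensor_eval (SOME x. x \<in> X)"

lemma class_eval: "set_mset x \<subseteq> B \<times> A \<Longrightarrow> class_eval (BA.cl x) = tensor_eval x"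
  unfolding class_eval_def
  by (rule tensor_eval_cong[symmetric], rule BA.class_memD, rule someI[of _ x], rule BA.class_self)

text \<open>The isomorphism \<open>\<phi> : B \<otimes> B \<rightarrow> B \<otimes> A\<close> in terms of \<open>\<psi> y = \<phi>(1 \<otimes> y)\<close>, read as a map
from \<open>G\<close> to \<open>B\<close>. By \<open>B\<close>-linearity
\<open>\<phi>(m \<otimes> n) = m \<psi>(n)\<close>, so that surjectivity of \<open>\<phi>\<close> expresses each \<open>1 \<otimes> a\<close> by values of \<open>\<psi>\<close>.
Equivariance gives \<open>\<psi> x g = \<psi> (\<rho> x g) 0\<close>; thus \<open>\<psi>\<close> is the coaction followed by the ring
homomorphism \<open>x \<mapsto> \<psi> x 0\<close> of \<open>B\<close>, which may differ from the identity and may even fail to be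
injective: \<open>\<phi>\<close> is an arbitrary isomorphism, not necessarily the canonical one. If \<open>\<psi> x\<close> is
constant with value \<open>c\<close>, injectivity of \<open>\<phi>\<close> yields \<open>1 \<otimes> x = c \<otimes> 1\<close>.\<close>

lemma phs_translation:
  assumes phs: "principal_homogeneous_space sc B \<rho> A"
  obtains \<psi> where
    "\<And>x y g. x \<in> B \<Longrightarrow> y \<in> B \<Longrightarrow> \<psi> (x + y) g = \<psi> x g + \<psi> y g"
    "\<And>x y g. x \<in> B \<Longrightarrow> y \<in> B \<Longrightarrow> \<psi> (x * y) g = \<psi> x g * \<psi> y g"
    "\<And>r x g. algebraic_int r \<Longrightarrow> x \<in> B \<Longrightarrow> \<psi> (sc r x) g = sc r (\<psi> x g)"
    "\<And>g. \<psi> 1 g = 1"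
    "\<And>x g h. x \<in> B \<Longrightarrow> \<psi> (\<rho> x g) h = \<psi> x (h + g)"
    "\<And>x g. x \<in> B \<Longrightarrow> \<psi> x g \<in> B"
    "\<And>a. a \<in> A \<Longrightarrow> \<exists>x. set_mset x \<subseteq> B \<times> B \<and> (\<forall>g. sc (a g) 1 = (\<Sum>(m,n)\<in>#x. m * \<psi> n g))"
    "\<And>x c. x \<in> B \<Longrightarrow> c \<in> B \<Longrightarrow> (\<And>g. \<psi> x g = c) \<Longrightarrow> \<exists>k. x = sc k 1"
proof -
  from phs obtain \<phi> where iso: "\<phi> \<in> ring_iso BB.TR BA.TR"
    and unit: "\<And>b. b \<in> B \<Longrightarrow> \<phi> (BB.cl {#(b, 1)#}) = BA.cl {#(b, 1)#}"
    and equi: "\<And>u X. u \<in> dual A \<Longrightarrow> X \<in> carrier BB.TR \<Longrightarrow>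
       \<phi> (tensor_right sc B sc B (act sc \<rho> u) X) = tensor_right sc B map_scale A (act map_scale comult u) (\<phi> X)"
    by (auto simp: principal_homogeneous_space_def)
  have hom: "\<phi> \<in> Ring.ring_hom BB.TR BA.TR" and bij: "bij_betw \<phi> (carrier BB.TR) (carrier BA.TR)"
    using iso by (auto simp: ring_iso_def)
  let ?P = "\<lambda>x. set_mset x \<subseteq> B \<times> B"
  have inC: "BB.cl x \<in> carrier BB.TR" if "?P x" for x using that by (auto simp: BB.carrier_ring)
  have "\<exists>z. set_mset z \<subseteq> B \<times> A \<and> \<phi> (BB.cl x) = BA.cl z" if "?P x" for x
    using ring_hom_closed[OF hom inC[OF that]] by (auto simp: BA.carrier_ring)
  then obtain z where z: "\<And>x. ?P x \<Longrightarrow> set_mset (z x) \<subseteq> B \<times> A" "\<And>x. ?P x \<Longrightarrow> \<phi> (BB.cl x) = BA.cl (z x)"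
    by metis
  define \<Phi> where "\<Phi> x = class_eval (\<phi> (BB.cl x))" for x
  have \<Phi>: "\<Phi> x = tensor_eval (z x)" if "?P x" for x using z that by (simp add: \<Phi>_def class_eval)
  have \<Phi>_eqI: "\<Phi> x = \<Phi> y" if "BB.TE x y" for x y using BB.class_eq[OF that] by (simp add: \<Phi>_def)
  have \<Phi>_inj: "BB.TE x y" if "?P x" "?P y" "\<Phi> x = \<Phi> y" for x y
  proof -
    have "BA.TE (z x) (z y)" using tensor_eval_injective z \<Phi> that by metis
    then have "\<phi> (BB.cl x) = \<phi> (BB.cl y)" using BA.class_eq z(2) that by metis
    then have "BB.cl x = BB.cl y" using bij inC that by (auto simp: bij_betw_def inj_on_def)
    then show ?thesis by (rule BB.class_eqD[OF that(1)])
  qed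
  have \<Phi>_add: "\<Phi> (x + y) = \<Phi> x + \<Phi> y" if "?P x" "?P y" for x y
  proof -
    have "\<phi> (BB.cl (x + y)) = BA.cl (z x + z y)"
      using ring_hom_add[OF hom inC[OF that(1)] inC[OF that(2)]] that z
      by (simp add: BB.add_ring BA.add_ring)
    then have "\<Phi> (x + y) = tensor_eval (z x + z y)" unfolding \<Phi>_def using z that by (simp add: class_eval)
    then show ?thesis using that by (simp add: \<Phi>)
  qed
  have \<Phi>_tmul: "\<Phi> (BB.tmul x y) = \<Phi> x * \<Phi> y" if "?P x" "?P y" for x y
  proof -
    have "\<phi> (BB.cl (BB.tmul x y)) = BA.cl (BA.tmul (z x) (z y))"
      using ring_hom_mult[OF hom inC[OF that(1)] inC[OF that(2)]] that z
      by (simp add: BB.mult_ring BA.mult_ring)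
    then have "\<Phi> (BB.tmul x y) = tensor_eval (BA.tmul (z x) (z y))"
      unfolding \<Phi>_def using z that BA.tmul_in by (simp add: class_eval)
    then show ?thesis using that by (simp add: \<Phi> tensor_eval_tmul)
  qed
  have \<Phi>_unit: "\<Phi> {#(b, 1)#} g = b" if "b \<in> B" for b g
    unfolding \<Phi>_def unit[OF that] by (subst class_eval) (auto simp: that A_one)
  have \<Phi>_act: "\<Phi> (image_mset (apsnd (ac u)) x) h = (\<Sum>g\<in>UNIV. sc (u g) (\<Phi> x (h + g)))"
    if "u \<in> dual A" "?P x" for u x h
  proof -
    have "\<phi> (BB.cl (image_mset (apsnd (ac u)) x)) = BA.cl (image_mset (apsnd (act map_scale comult u)) (z x))"
      using equi[OF that(1) inC[OF that(2)]] z(2)[OF that(2)] that z(1)[OF that(2)]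
      by (simp add: BB.tensor_right_class BA.tensor_right_class act_closed act_add act_scale
          A.act_closed A.act_add A.act_scale)
    moreover have "set_mset (image_mset (apsnd (act map_scale comult u)) (z x)) \<subseteq> B \<times> A"
      using z(1)[OF that(2)] that(1) by (fastforce intro: A.act_closed)
    ultimately have "\<Phi> (image_mset (apsnd (ac u)) x) = tensor_eval (image_mset (apsnd (act map_scale comult u)) (z x))"
      by (simp add: \<Phi>_def class_eval)
    then show ?thesis using that by (simp add: tensor_eval_apsnd \<Phi>)
  qed
  define \<psi> where "\<psi> y = \<Phi> {#(1, y)#}" for y
  have \<Phi>_pair: "\<Phi> {#(m, n)#} g = m * \<psi> n g" if "m \<in> B" "n \<in> B" for m n g
  proof -
    have "\<Phi> (BB.tmul {#(m,1)#} {#(1,n)#}) = \<Phi> {#(m,1)#} * \<Phi> {#(1,n)#}"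
      using that B_one by (intro \<Phi>_tmul) auto
    then show ?thesis using \<Phi>_unit[OF that(1)] by (simp add: BB.tmul_def \<psi>_def)
  qed
  have \<Phi>_sum: "\<Phi> x g = (\<Sum>(m,n)\<in>#x. m * \<psi> n g)" if "?P x" for x g
    using that
  proof (induction x)
    case empty
    have "\<Phi> ({#} + {#}) = \<Phi> {#} + \<Phi> {#}" by (rule \<Phi>_add) auto
    then have "\<Phi> {#} g = \<Phi> {#} g + \<Phi> {#} g" by (simp add: fun_eq_iff)
    then show ?case by simp
  next
    case (add p x)
    have "\<Phi> ({#p#} + x) = \<Phi> {#p#} + \<Phi> x" using add.prems by (intro \<Phi>_add) auto
    then show ?case using add \<Phi>_pair by (cases p) auto
  qed
  show ?thesis
  proof (rule that[of \<psi>])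
    fix x y g assume xy: "x \<in> B" "y \<in> B"
    have "\<Phi> {#(1, x + y)#} = \<Phi> {#(1, x), (1, y)#}"
      using xy B_one by (intro \<Phi>_eqI tensor_eq.add_right) auto
    then show "\<psi> (x + y) g = \<psi> x g + \<psi> y g"
      using \<Phi>_sum[of "{#(1, x), (1, y)#}" g] xy B_one by (simp add: \<psi>_def)
    have "\<Phi> (BB.tmul {#(1,x)#} {#(1,y)#}) = \<Phi> {#(1,x)#} * \<Phi> {#(1,y)#}"
      using xy B_one by (intro \<Phi>_tmul) auto
    then show "\<psi> (x * y) g = \<psi> x g * \<psi> y g" by (simp add: BB.tmul_def \<psi>_def)
  next
    fix r :: 'k and x g assume r: "algebraic_int r" "x \<in> B"
    have "\<Phi> {#(sc r 1, x)#} = \<Phi> {#(1, sc r x)#}"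
      using r B_one by (intro \<Phi>_eqI tensor_eq.balanced) auto
    moreover have "\<Phi> {#(sc r 1, x)#} g = sc r 1 * \<psi> x g" using r B_one by (intro \<Phi>_pair B_scale)
    ultimately show "\<psi> (sc r x) g = sc r (\<psi> x g)" by (simp add: \<psi>_def sc_mult_left)
  next
    show "\<psi> 1 g = 1" for g using \<Phi>_unit[OF B_one] by (simp add: \<psi>_def)
  next
    fix x g h assume x: "x \<in> B"
    have "\<Phi> (image_mset (apsnd (ac (gr_elem g))) {#(1, x)#}) h = (\<Sum>k\<in>UNIV. sc (gr_elem g k) (\<Phi> {#(1, x)#} (h + k)))"
      using x B_one by (intro \<Phi>_act gr_elem_in_dual) auto
    also have "\<dots> = (\<Sum>k\<in>UNIV. if k = g then \<Phi> {#(1, x)#} (h + g) else 0)"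
      by (rule sum.cong) (auto simp: gr_elem_def)
    finally show "\<psi> (\<rho> x g) h = \<psi> x (h + g)" by (simp add: \<psi>_def act_gr_elem)
  next
    fix x g assume "x \<in> B"
    then have "?P {#(1,x)#}" using B_one by auto
    then show "\<psi> x g \<in> B" using tensor_eval_closed z(1) \<Phi> by (metis \<psi>_def)
  next
    fix a assume a: "a \<in> A"
    have "set_mset {#(1, a)#} \<subseteq> B \<times> A" using a B_one by auto
    then have "BA.cl {#(1, a)#} \<in> \<phi> ` carrier BB.TR"
      using bij by (auto simp: bij_betw_def BA.carrier_ring)
    then obtain x where x: "?P x" "BA.cl {#(1, a)#} = \<phi> (BB.cl x)" by (auto simp: BB.carrier_ring)
    have "\<Phi> x = tensor_eval {#(1, a)#}" unfolding \<Phi>_def x(2)[symmetric] using a B_one by (intro class_eval) auto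
    then have "sc (a g) 1 = (\<Sum>(m,n)\<in>#x. m * \<psi> n g)" for g using \<Phi>_sum[OF x(1), of g] by simp
    then show "\<exists>x. ?P x \<and> (\<forall>g. sc (a g) 1 = (\<Sum>(m,n)\<in>#x. m * \<psi> n g))" using x(1) by blast
  next
    fix x c assume xc: "x \<in> B" "c \<in> B" "\<And>g. \<psi> x g = c"
    have "\<Phi> {#(1, x)#} = \<Phi> {#(c, 1)#}"
      by (rule ext) (simp add: \<Phi>_unit[OF xc(2)] xc(3) \<psi>_def[symmetric])
    then have TE: "BB.TE {#(1, x)#} {#(c, 1)#}" using xc(1,2) B_one by (intro \<Phi>_inj) simp_all
    have ind: "independent {1 :: 'b}" by simp
    define E where "E = extend_basis {1 :: 'b}"
    have E: "1 \<in> E" "independent E" "span E = UNIV"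
      using independent_extend_basis[OF ind] span_extend_basis[OF ind] extend_basis_superset[OF ind]
      by (simp_all add: E_def)
    (* Apply to the left-hand factors a K-linear form with value 1 at 1. *)
    let ?f = "\<lambda>m n. sc (representation E m 1) n"
    have "(\<Sum>(m,n)\<in>#{#(1, x)#}. ?f m n) = (\<Sum>(m,n)\<in>#{#(c, 1)#}. ?f m n)"
      by (rule BB.TE_bilinear[OF TE])
         (auto simp: E representation_add representation_scale scale_left_distrib scale_right_distrib mult.commute)
    then have "x = sc (representation E c 1) 1" using E by (simp add: representation_basis)
    then show "\<exists>k. x = sc k 1" ..
  qed
qed

lemma invariant_is_scalar:
  assumes phs: "principal_homogeneous_space sc B \<rho> A" and x: "x \<in> B" "\<And>g. \<rho> x g = x"
  shows "\<exists>k. x = sc k 1"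
proof (rule phs_translation[OF phs])
  fix \<psi>
  assume \<psi>: "\<And>x g h. x \<in> B \<Longrightarrow> \<psi> (\<rho> x g) h = \<psi> x (h + g)"
    "\<And>x g. x \<in> B \<Longrightarrow> \<psi> x g \<in> B"
    "\<And>x c. x \<in> B \<Longrightarrow> c \<in> B \<Longrightarrow> (\<And>g. \<psi> x g = c) \<Longrightarrow> \<exists>k. x = sc k 1"
  have "\<psi> x g = \<psi> x 0" for g using \<psi>(1)[OF x(1), of g 0] x(2)[of g] by simp
  then show ?thesis using \<psi>(3)[OF x(1) \<psi>(2)[OF x(1), of 0]] by blast
qed

end

section \<open>Free modules of rank one and the trace\<close>

lemma sum_single_support:
  assumes "{s. c s \<noteq> 0} \<subseteq> {b}" "a 0 b = (0 :: 'b::ab_group_add)"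
  shows "(\<Sum>s | c s \<noteq> 0. a (c s) s) = a (c b) b"
proof (cases "c b = 0")
  case True
  then have "{s. c s \<noteq> 0} = {}" using assms(1) by auto
  then show ?thesis using True assms(2) by simp
next
  case False
  then have "{s. c s \<noteq> 0} = {b}" using assms(1) by auto
  then show ?thesis by simp
qed

text \<open>The case of a one-element basis, where coefficient families reduce to single coefficients.\<close>

lemma free_module_singleton:
  assumes "b \<in> M" "0 \<in> D" "a 0 b = 0" "\<And>m. m \<in> M \<Longrightarrow> \<exists>!v. v \<in> D \<and> m = a v b"
  shows "free_module D a M"
  unfolding free_module_def
proof (intro exI[of _ "{b}"] conjI ballI)
  fix m assume "m \<in> M"
  from assms(4)[OF this] obtain v where v: "v \<in> D" "m = a v b"
    and uniq: "\<And>v'. v' \<in> D \<Longrightarrow> m = a v' b \<Longrightarrow> v' = v" by blast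
  show "\<exists>!c. finite {s. c s \<noteq> 0} \<and> {s. c s \<noteq> 0} \<subseteq> {b} \<and> range c \<subseteq> D \<and> m = (\<Sum>s | c s \<noteq> 0. a (c s) s)"
  proof (rule ex1I[of _ "\<lambda>s. if s = b then v else 0"])
    let ?c = "\<lambda>s. if s = b then v else 0"
    have sub: "{s. ?c s \<noteq> 0} \<subseteq> {b}" by auto
    show "finite {s. ?c s \<noteq> 0} \<and> {s. ?c s \<noteq> 0} \<subseteq> {b} \<and> range ?c \<subseteq> D \<and> m = (\<Sum>s | ?c s \<noteq> 0. a (?c s) s)"
      using sum_single_support[OF sub, of a] assms(2,3) v sub finite_subset[OF sub] by auto
  next
    fix c
    assume c: "finite {s. c s \<noteq> 0} \<and> {s. c s \<noteq> 0} \<subseteq> {b} \<and> range c \<subseteq> D \<and> m = (\<Sum>s | c s \<noteq> 0. a (c s) s)"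
    then have "m = a (c b) b" using sum_single_support[of c b a] assms(3) by auto
    moreover have "c b \<in> D" using c by blast
    ultimately have "c b = v" by (intro uniq)
    then show "c = (\<lambda>s. if s = b then v else 0)" using c by (auto simp: fun_eq_iff)
  qed
qed (use assms in auto)

text \<open>The chosen basis in \<open>alg_trace\<close> may be replaced by an orbit of \<open>G\<close>.\<close>

lemma (in vector_space) trace_basis_independent:
  assumes E: "finite E" "independent E" "span E = UNIV" and E': "finite E'" "independent E'" "span E' = UNIV"
    and T_add: "\<And>x y. T (x + y) = T x + T y" and T_scale: "\<And>c x. T (scale c x) = scale c (T x)"
  shows "(\<Sum>e\<in>E'. representation E' (T e) e) = (\<Sum>e\<in>E. representation E (T e) e)"
proof -
  have T_sum: "T (\<Sum>i\<in>I. f i) = (\<Sum>i\<in>I. T (f i))" for I :: "'b set" and f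
  proof (induction I rule: infinite_finite_induct)
    case (insert i I)
    then show ?case by (simp add: T_add)
  qed (use T_scale[of 0 0] in auto)
  have rep: "x = (\<Sum>e\<in>E. scale (representation E x e) e)" for x
    using E sum_representation_eq[of E x E] by simp
  have rep': "x = (\<Sum>e\<in>E'. scale (representation E' x e) e)" for x
    using E' sum_representation_eq[of E' x E'] by simp
  have "representation E' (T e') e' = (\<Sum>e\<in>E. representation E e' e * representation E' (T e) e')" for e'
    by (subst rep[of e']) (simp add: T_sum T_scale representation_sum representation_scale E')
  then have "(\<Sum>e\<in>E'. representation E' (T e) e) =
      (\<Sum>e'\<in>E'. \<Sum>e\<in>E. representation E e' e * representation E' (T e) e')" by simp
  also have "\<dots> = (\<Sum>e\<in>E. \<Sum>e'\<in>E'. representation E e' e * representation E' (T e) e')" by (rule sum.swap)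
  also have "\<dots> = (\<Sum>e\<in>E. representation E (T e) e)"
  proof (rule sum.cong)
    fix e
    show "(\<Sum>e'\<in>E'. representation E e' e * representation E' (T e) e') = representation E (T e) e"
      by (subst (2) rep'[of "T e"]) (simp add: representation_sum representation_scale E mult.commute)
  qed simp
  finally show ?thesis .
qed

context hopf_comodule
begin

text \<open>Free of rank one over the dual of \<open>A\<close>, with generator \<open>b\<close>.\<close>

definition cyclic :: "'b \<Rightarrow> bool" where
  "cyclic b \<longleftrightarrow> b \<in> B \<and> (\<forall>m\<in>B. \<exists>!v. v \<in> dual A \<and> m = ac v b)"

text \<open>Uniqueness of coefficients extends from the dual to all of \<open>K[G]\<close> by clearing denominators. This is
what makes the localizations of \<open>B\<close> free on the same generator.\<close>

lemma cyclic_faithful: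
  assumes "cyclic b" "ac v b = 0" shows "v = 0"
proof -
  obtain d :: int where d: "d \<noteq> 0" "map_scale (of_int d) v \<in> dual A"
    using integral_multiple_in_dual by blast
  have "0 = ac (map_scale (of_int d) v) b" using assms(2) by (simp add: act_scale_left)
  moreover have "0 = ac 0 b" by (simp add: act_zero_left)
  ultimately have "map_scale (of_int d) v = 0"
    using assms(1) B_zero d(2) dual_zero unfolding cyclic_def by blast
  then show ?thesis using d(1) by (auto simp: fun_eq_iff map_scale_def)
qed

lemma cyclic_inject: "cyclic b \<Longrightarrow> ac v b = ac w b \<Longrightarrow> v = w"
  using cyclic_faithful[of b "v - w"] by (simp add: act_diff_left)

lemma cyclic_generates:
  assumes "cyclic b" shows "\<exists>v. x = ac v b"
proof -
  obtain d :: int where d: "d \<noteq> 0" "sc (of_int d) x \<in> B"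
    using R_order_integral_multiple[OF K B_order] by blast
  then obtain v where "sc (of_int d) x = ac v b" using assms unfolding cyclic_def by blast
  then have "x = ac (map_scale (inverse (of_int d)) v) b" using d(1)
    by (simp add: act_scale_left flip: \<open>sc (of_int d) x = ac v b\<close>)
  then show ?thesis by blast
qed

lemma cyclic_free: "cyclic b \<Longrightarrow> free_module (dual A) ac B"
  by (rule free_module_singleton[of b]) (auto simp: cyclic_def dual_zero act_zero_left)

lemma cyclic_fin_gen: assumes "cyclic b" shows "fin_gen (dual A) ac B"
  unfolding fin_gen_def
proof (intro exI[of _ "{b}"] conjI ballI)
  fix m assume "m \<in> B"
  then obtain v where "v \<in> dual A" "m = ac v b" using assms unfolding cyclic_def by blast
  then show "\<exists>c. (\<forall>s\<in>{b}. c s \<in> dual A) \<and> m = (\<Sum>s\<in>{b}. ac (c s) s)"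
    by (intro exI[of _ "\<lambda>_. v"]) simp
qed (use assms in \<open>auto simp: cyclic_def\<close>)

lemma cyclic_locally_free:
  assumes b: "cyclic b" shows "locally_free sc (dual A) ac B"
  unfolding locally_free_def
proof (intro allI impI)
  fix P :: "'k set" assume P: "prime_of_R P"
  have bB: "b \<in> B" using b by (simp add: cyclic_def)
  show "free_module (localization map_scale P (dual A)) ac (localization sc P B)"
  proof (rule free_module_singleton[of b])
    have "b = sc (inverse 1) b" by simp
    then show "b \<in> localization sc P B" using bB P unfolding localization_def prime_of_R_def by blast
    have "(0 :: 'g \<Rightarrow> 'k) = map_scale (inverse 1) 0" by (simp add: map_scale_zero)
    then show "0 \<in> localization map_scale P (dual A)"
      using dual_zero P unfolding localization_def prime_of_R_def by blast
    show "ac 0 b = 0" by (rule act_zero_left)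
    fix m assume "m \<in> localization sc P B"
    then obtain s m' where s: "s \<in> ring_of_integers - P" "m' \<in> B" "m = sc (inverse s) m'"
      by (auto simp: localization_def)
    obtain v where v: "v \<in> dual A" "m' = ac v b" using b s(2) unfolding cyclic_def by blast
    show "\<exists>!v. v \<in> localization map_scale P (dual A) \<and> m = ac v b"
    proof (rule ex1I[of _ "map_scale (inverse s) v"])
      show "map_scale (inverse s) v \<in> localization map_scale P (dual A) \<and> m = ac (map_scale (inverse s) v) b"
        using s v by (auto simp: localization_def act_scale_left)
      then show "w = map_scale (inverse s) v" if "w \<in> localization map_scale P (dual A) \<and> m = ac w b" for w
        using that cyclic_inject[OF b] by auto
    qed
  qed
qed

lemma rho_act_one: "\<rho> (ac 1 x) g = ac 1 x"
proof -
  have "(\<Sum>h\<in>UNIV. \<rho> x (g + h)) = (\<Sum>h\<in>UNIV. \<rho> x h)"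
    by (rule sum.reindex_bij_witness[of _ "\<lambda>h. h - g" "\<lambda>h. g + h"]) auto
  then show ?thesis unfolding rho_act by (simp add: act_def)
qed

lemma act_one_rho: "ac 1 (\<rho> x g) = ac 1 x"
proof -
  have "(\<Sum>h\<in>UNIV. \<rho> x (h + g)) = (\<Sum>h\<in>UNIV. \<rho> x h)"
    by (rule sum.reindex_bij_witness[of _ "\<lambda>h. h - g" "\<lambda>h. h + g"]) auto
  then show ?thesis by (simp add: act_def rho_rho)
qed

lemma one_in_dual: "1 \<in> dual A"
  by (rule integral_in_dual) simp

end

text \<open>Comodule algebras whose invariants are scalars. Principal homogeneous spaces are of this kind by
\<open>invariant_is_scalar\<close>, and so is \<open>A\<close>, as a function on \<open>G\<close> is invariant under translations only if
it is constant.\<close>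

locale hopf_galois = hopf_comodule A sc B \<rho>
  for A :: "('g::{finite,ab_group_add} \<Rightarrow> 'k::field_char_0) set"
    and sc :: "'k \<Rightarrow> 'b::comm_ring_1 \<Rightarrow> 'b" and B \<rho> +
  assumes invariants: "\<And>x. x \<in> B \<Longrightarrow> (\<And>g. \<rho> x g = x) \<Longrightarrow> \<exists>k. x = sc k 1"
begin

lemma norm_scalar: "x \<in> B \<Longrightarrow> \<exists>k. ac 1 x = sc k 1"
  by (intro invariants act_closed one_in_dual rho_act_one)

text \<open>The norms \<open>\<Sum> \<rho> s g\<close> of the members \<open>s\<close> of a basis are nonzero invariants, hence proportional to
each other, whereas for distinct members a relation between them contradicts independence.\<close>

lemma free_imp_cyclic:
  assumes "free_module (dual A) ac B"
  shows "\<exists>b. cyclic b"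
proof -
  define good where "good S c \<longleftrightarrow> finite {s. c s \<noteq> 0} \<and> {s. c s \<noteq> 0} \<subseteq> S \<and> range c \<subseteq> dual A"
    for S and c :: "'b \<Rightarrow> 'g \<Rightarrow> 'k"
  define val where "val c = (\<Sum>s | c s \<noteq> 0. ac (c s) s)" for c :: "'b \<Rightarrow> 'g \<Rightarrow> 'k"
  obtain S where S: "S \<subseteq> B" "\<And>m. m \<in> B \<Longrightarrow> \<exists>!c. good S c \<and> m = val c"
  proof -
    from assms obtain S where "S \<subseteq> B" "\<forall>m\<in>B. \<exists>!c. good S c \<and> m = val c"
      unfolding free_module_def good_def val_def conj_assoc by (elim exE conjE)
    then show ?thesis by (intro that) auto
  qed
  have uniq: "c = c'" if "good S c" "good S c'" "val c = val c'" "val c \<in> B" for c c'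
    using S(2)[OF that(4)] that by blast
  have zero: "good S (\<lambda>_. 0)" "val (\<lambda>_. 0) = 0" by (auto simp: good_def val_def dual_zero)
  have val_eq: "val c = (\<Sum>s\<in>F. ac (c s) s)" if "finite F" "{s. c s \<noteq> 0} \<subseteq> F" for c F
    unfolding val_def using that by (intro sum.mono_neutral_left) (auto simp: act_zero_left)
  have norm: "\<exists>k. k \<noteq> 0 \<and> ac 1 s = sc k 1" if s: "s \<in> S" for s
  proof -
    obtain k where k: "ac 1 s = sc k 1" using norm_scalar S(1) s by blast
    have "k \<noteq> 0"
    proof
      assume "k = 0"
      let ?c = "\<lambda>t. if t = s then 1 else 0 :: 'g \<Rightarrow> 'k"
      have g: "good S ?c"
        using s one_in_dual dual_zero finite_subset[of "{t. ?c t \<noteq> 0}" "{s}"] by (auto simp: good_def)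
      have v: "val ?c = 0" using val_eq[of "{s}" ?c] k \<open>k = 0\<close> by auto
      have "?c = (\<lambda>_. 0)" by (rule uniq[OF g zero(1)]) (use v zero(2) B_zero in auto)
      from fun_cong[OF fun_cong[OF this, of s], of 0] show False by simp
    qed
    then show ?thesis using k by blast
  qed
  have eq: "s = t" if st: "s \<in> S" "t \<in> S" for s t
  proof (rule ccontr)
    assume ne: "s \<noteq> t"
    from norm[OF st(1)] norm[OF st(2)] obtain k l
      where kl: "k \<noteq> 0" "ac 1 s = sc k 1" "l \<noteq> 0" "ac 1 t = sc l 1" by blast
    obtain d where d: "d \<noteq> (0::int)" "algebraic_int (of_int d * k)"
      using number_field_integral_multiple[OF K] by blast
    obtain e where e: "e \<noteq> (0::int)" "algebraic_int (of_int e * l)"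
      using number_field_integral_multiple[OF K] by blast
    have int: "algebraic_int (of_int n :: 'k)" for n by (rule int_imp_algebraic_int) auto
    (* The relation l * norm s - k * norm t = 0, cleared of denominators. *)
    define p q where "p = of_int d * (of_int e * l)" and "q = - (of_int e * (of_int d * k))"
    have pq: "algebraic_int p" "algebraic_int q"
      unfolding p_def q_def algebraic_int_minus_iff
      by (rule algebraic_int_mult[OF int e(2)], rule algebraic_int_mult[OF int d(2)])
    define u v :: "'g \<Rightarrow> 'k" where "u = map_scale p 1" and "v = map_scale q 1"
    let ?c = "\<lambda>x. if x = s then u else if x = t then v else 0 :: 'g \<Rightarrow> 'k"
    have sub: "{x. ?c x \<noteq> 0} \<subseteq> {s, t}" by auto
    have "u \<in> dual A" "v \<in> dual A"
      using dual_sub one_in_dual pq unfolding u_def v_def R_submodule_def by blast+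
    then have g: "good S ?c" using st dual_zero finite_subset[OF sub] by (auto simp: good_def)
    have "val ?c = ac u s + ac v t"
      using val_eq[OF _ sub] ne by simp
    also have "\<dots> = sc (p * k + q * l) 1" unfolding u_def v_def act_scale_left kl by (simp add: scale_left_distrib)
    also have "p * k + q * l = 0" by (simp add: p_def q_def)
    finally have v: "val ?c = 0" by simp
    have "?c = (\<lambda>_. 0)" by (rule uniq[OF g zero(1)]) (use v zero(2) B_zero in auto)
    from fun_cong[OF fun_cong[OF this, of s], of 0] have "p = 0" by (simp add: u_def map_scale_def)
    then show False using d e kl by (simp add: p_def)
  qed
  have "S \<noteq> {}"
  proof
    assume "S = {}"
    obtain c where "good S c" "1 = val c" using S(2)[OF B_one] by blast
    then show False using \<open>S = {}\<close> by (simp add: good_def val_def)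
  qed
  then obtain b where Sb: "S = {b}" using eq by blast
  have "cyclic b"
    unfolding cyclic_def
  proof (intro conjI ballI)
    show "b \<in> B" using S Sb by auto
    fix m assume m: "m \<in> B"
    obtain c where c: "good {b} c" "m = val c" using S(2)[OF m] Sb by blast
    show "\<exists>!v. v \<in> dual A \<and> m = ac v b"
    proof (rule ex1I[of _ "c b"])
      show "c b \<in> dual A \<and> m = ac (c b) b" using c val_eq[of "{b}" c] by (auto simp: good_def)
      fix v assume v: "v \<in> dual A \<and> m = ac v b"
      let ?c = "\<lambda>t. if t = b then v else 0"
      have sub: "{x. ?c x \<noteq> 0} \<subseteq> {b}" by auto
      have "good {b} ?c" using v dual_zero finite_subset[OF sub] by (auto simp: good_def)
      moreover have "val ?c = m" using val_eq[OF _ sub] v by simp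
      ultimately have "?c = c" using uniq[of ?c c] c m Sb by simp
      then show "v = c b" by (auto dest: fun_cong[of _ _ b])
    qed
  qed
  then show ?thesis ..
qed

context
  fixes b assumes b: "cyclic b"
begin

definition coords :: "'b \<Rightarrow> 'g \<Rightarrow> 'k" where "coords x = (SOME v. x = ac v b)"

lemma act_coords: "ac (coords x) b = x"
  unfolding coords_def using someI_ex[OF cyclic_generates[OF b], of x] by simp

lemma coords_act: "coords (ac v b) = v"
  by (rule cyclic_inject[OF b act_coords])

lemma coords_rho: "coords (\<rho> x g) h = coords x (h - g)"
proof -
  have "\<rho> x g = \<rho> (ac (coords x) b) g" by (simp add: act_coords)
  also have "\<dots> = ac (\<lambda>h. coords x (h - g)) b"
    unfolding rho_act unfolding act_def
    by (rule sum.reindex_bij_witness[of _ "\<lambda>h. h - g" "\<lambda>h. g + h"]) auto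
  finally show ?thesis by (simp add: coords_act)
qed

lemma orbit_inj: "inj (\<rho> b)"
proof (rule injI)
  fix g h assume "\<rho> b g = \<rho> b h"
  then have "gr_elem g = (gr_elem h :: 'g \<Rightarrow> 'k)"
    using cyclic_inject[OF b] by (simp add: act_gr_elem[symmetric])
  from fun_cong[OF this, of g] show "g = h" by (simp add: gr_elem_def split: if_splits)
qed

lemma sum_orbit: "(\<Sum>e\<in>range (\<rho> b). f e) = (\<Sum>g\<in>UNIV. f (\<rho> b g))"
  by (simp add: sum.reindex[OF orbit_inj])

lemma orbit_independent: "independent (range (\<rho> b))"
proof (rule independent_if_scalars_zero)
  fix f e assume "(\<Sum>x\<in>range (\<rho> b). sc (f x) x) = 0" and e: "e \<in> range (\<rho> b)"
  then have "ac (\<lambda>g. f (\<rho> b g)) b = 0" by (simp add: sum_orbit act_def)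
  then have "(\<lambda>g. f (\<rho> b g)) = 0" by (rule cyclic_faithful[OF b])
  then show "f e = 0" using e by (auto simp: fun_eq_iff)
qed simp

lemma orbit_span: "span (range (\<rho> b)) = UNIV"
proof -
  have "x \<in> span (range (\<rho> b))" for x
  proof -
    have "ac (coords x) b \<in> span (range (\<rho> b))"
      unfolding act_def by (intro span_sum span_scale span_base) auto
    then show ?thesis by (simp add: act_coords)
  qed
  then show ?thesis by auto
qed

lemma orbit_representation: "representation (range (\<rho> b)) x (\<rho> b g) = coords x g"
proof -
  have "representation (range (\<rho> b)) (ac (coords x) b) (\<rho> b g) =
      (\<Sum>h\<in>UNIV. coords x h * (if \<rho> b g = \<rho> b h then 1 else 0))"
    unfolding act_def
    by (simp add: representation_sum representation_scale representation_basis orbit_independent orbit_span)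
  also have "\<dots> = (\<Sum>h\<in>UNIV. if h = g then coords x g else 0)"
    by (rule sum.cong) (auto simp: inj_eq[OF orbit_inj])
  finally show ?thesis by (simp add: act_coords)
qed

text \<open>The trace in the basis formed by the \<open>G\<close>-orbit of \<open>b\<close>.\<close>

lemma alg_trace_orbit: "alg_trace sc x = (\<Sum>g\<in>UNIV. coords (x * \<rho> b g) g)"
proof -
  define E where "E = (SOME E. independent E \<and> span E = UNIV)"
  have E: "independent E" "span E = UNIV"
    using someI[of "\<lambda>E. independent E \<and> span E = UNIV" "range (\<rho> b)"] orbit_independent orbit_span
    by (auto simp: E_def)
  have "finite E" using independent_span_bound[of "range (\<rho> b)" E] E orbit_span by auto
  then have "(\<Sum>e\<in>range (\<rho> b). representation (range (\<rho> b)) (x * e) e) = (\<Sum>e\<in>E. representation E (x * e) e)"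
    using E by (intro trace_basis_independent)
      (auto simp: orbit_independent orbit_span distrib_left sc_mult_right)
  then show ?thesis by (simp add: alg_trace_def Let_def E_def sum_orbit orbit_representation)
qed

lemma coords_add: "coords (x + y) = coords x + coords y"
  using coords_act[of "coords x + coords y"] by (simp add: act_add_left act_coords)

lemma coords_scale: "coords (sc c x) g = c * coords x g"
  using coords_act[of "map_scale c (coords x)"] by (simp add: act_scale_left act_coords map_scale_apply)

lemma alg_trace_add: "alg_trace sc (x + y) = alg_trace sc x + alg_trace sc y"
  by (simp add: alg_trace_orbit distrib_right coords_add sum.distrib)

lemma alg_trace_scale: "alg_trace sc (sc c x) = c * alg_trace sc x"
  by (simp add: alg_trace_orbit sc_mult_left coords_scale sum_distrib_left)

lemma alg_trace_sum: "alg_trace sc (\<Sum>i\<in>I. f i) = (\<Sum>i\<in>I. alg_trace sc (f i))"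
  using alg_trace_scale[of 0 0]
  by (induction I rule: infinite_finite_induct) (auto simp: alg_trace_add)

lemma alg_trace_rho: "alg_trace sc (\<rho> x k) = alg_trace sc x"
proof -
  have "coords (\<rho> x k * \<rho> b g) g = coords (x * \<rho> b (g - k)) (g - k)" for g
    using coords_rho[of "x * \<rho> b (g - k)" k g] by (simp add: rho_mult rho_rho)
  then have "alg_trace sc (\<rho> x k) = (\<Sum>g\<in>UNIV. coords (x * \<rho> b (g - k)) (g - k))"
    by (simp add: alg_trace_orbit)
  also have "\<dots> = alg_trace sc x"
    unfolding alg_trace_orbit
    by (rule sum.reindex_bij_witness[of _ "\<lambda>g. g + k" "\<lambda>g. g - k"]) auto
  finally show ?thesis .
qed

lemma alg_trace_one: "alg_trace sc 1 = of_nat CARD('g)"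
proof -
  have "coords (\<rho> b g) = gr_elem g" for g using coords_act[of "gr_elem g"] by (simp add: act_gr_elem)
  then show ?thesis by (simp add: alg_trace_orbit gr_elem_def)
qed

text \<open>Both sides are \<open>G\<close>-invariant linear functions of \<open>x\<close>, and on \<open>K[G] b\<close> such a function is determined
by its value at \<open>b\<close>. So they are proportional, and at \<open>x = 1\<close> both are the order of \<open>G\<close>, a
nonzero element of \<open>K\<close>.\<close>

lemma norm_eq_trace: "ac 1 x = sc (alg_trace sc x) 1"
proof -
  have "b \<in> B" using b by (simp add: cyclic_def)
  from norm_scalar[OF this] obtain k where k: "ac 1 b = sc k 1" ..
  define s where "s x = (\<Sum>g\<in>UNIV. coords x g)" for x
  have N: "ac 1 x = sc (s x * k) 1" for x
  proof -
    have "ac 1 x = ac 1 (ac (coords x) b)" by (simp add: act_coords)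
    also have "\<dots> = (\<Sum>g\<in>UNIV. sc (coords x g) (ac 1 (\<rho> b g)))"
      unfolding act_def[of sc \<rho> "coords x"] act_sum act_scale ..
    also have "\<dots> = sc (s x * k) 1" by (simp add: act_one_rho k s_def scale_sum_left sum_distrib_right)
    finally show ?thesis .
  qed
  have T: "alg_trace sc x = s x * alg_trace sc b" for x
  proof -
    have "alg_trace sc x = alg_trace sc (ac (coords x) b)" by (simp add: act_coords)
    also have "\<dots> = s x * alg_trace sc b"
      by (simp add: act_def alg_trace_sum alg_trace_scale alg_trace_rho s_def sum_distrib_right)
    finally show ?thesis .
  qed
  have "ac 1 1 = sc (of_nat CARD('g)) 1"
    using scale_sum_left[of "\<lambda>_. 1" "UNIV :: 'g set" "1 :: 'b"] by (simp add: act_def rho_one)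
  then have "sc (s 1 * k) 1 = sc (of_nat CARD('g)) 1" by (simp only: N)
  then have sk: "s 1 * k = of_nat CARD('g)" by simp
  have st: "s 1 * alg_trace sc b = of_nat CARD('g)" using T[of 1] alg_trace_one by simp
  have "s 1 * k \<noteq> 0" unfolding sk by simp
  then have "k = alg_trace sc b" using sk st by (metis mult_left_cancel mult_zero_left)
  then show ?thesis by (simp only: N[of x] T[of x])
qed

end

end

lemma (in hopf_lattice) hopf_galois_regular: "hopf_galois A map_scale A comult"
proof -
  interpret A: hopf_comodule A map_scale A comult by (rule hopf_comodule_regular)
  show ?thesis
  proof unfold_locales
    fix x assume "x \<in> A" and inv: "\<And>g. comult x g = x"
    have "x h = x 0" for h using fun_cong[OF inv[of h], of 0] by (simp add: comult_def)
    then have "x = map_scale (x 0) 1" by (simp add: fun_eq_iff map_scale_def)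
    then show "\<exists>k. x = map_scale k 1" ..
  qed
qed

lemma (in hopf_integral) alg_trace_regular: fixes f :: "'g \<Rightarrow> 'k" shows "alg_trace map_scale f = (\<Sum>g\<in>UNIV. f g)"
proof -
  interpret A: hopf_galois A map_scale A comult by (rule hopf_galois_regular)
  have "A.cyclic generator" using generator_in regular_cyclic by (auto simp: A.cyclic_def)
  then have "act map_scale comult 1 f = map_scale (alg_trace map_scale f) 1" by (rule A.norm_eq_trace)
  from fun_cong[OF this, of 0] show ?thesis by (simp add: act_comult map_scale_def)
qed

section \<open>The group ring with coefficients in a comodule algebra\<close>

text \<open>The group ring of \<open>G\<close> over any commutative ring is the ring of polynomial mappings on \<open>G\<close>. Over
\<open>K\<close> its multiplication is \<open>conv\<close>; having it as a type makes powers and commutative algebra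
available, also with coefficients in \<open>B\<^sub>K\<close>.\<close>

definition group_ring :: "('g::finite \<Rightarrow> 'r::zero) \<Rightarrow> 'g \<Rightarrow>\<^sub>0 'r" where
  "group_ring f = Abs_poly_mapping f"

lemma lookup_GR [simp]: "Poly_Mapping.lookup (group_ring f) = f"
  by (simp add: group_ring_def)

lemma group_ring_lookup [simp]: "group_ring (Poly_Mapping.lookup X) = X"
  by (simp add: group_ring_def)

lemma group_ring_inject: "group_ring u = group_ring v \<longleftrightarrow> u = v"
  using lookup_GR by metis

lemma lookup_times:
  fixes X Y :: "'g::{finite,ab_group_add} \<Rightarrow>\<^sub>0 'r::comm_ring_1"
  shows "Poly_Mapping.lookup (X * Y) g = (\<Sum>h\<in>UNIV. Poly_Mapping.lookup X h * Poly_Mapping.lookup Y (g - h))"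
proof -
  have "g = h + q \<longleftrightarrow> q = g - h" for h q :: 'g by (auto simp: algebra_simps)
  then have "Poly_Mapping.lookup (X * Y) g = (\<Sum>h. Poly_Mapping.lookup X h * Poly_Mapping.lookup Y (g - h))"
    by (simp add: lookup_mult when_def)
  also have "\<dots> = (\<Sum>h\<in>UNIV. Poly_Mapping.lookup X h * Poly_Mapping.lookup Y (g - h))"
    by (rule Sum_any.expand_superset) auto
  finally show ?thesis .
qed

lemma lookup_1: "Poly_Mapping.lookup 1 g = (if g = 0 then 1 else 0)"
  by (auto simp: lookup_one when_def)

lemma group_ring_conv: "group_ring (conv u v) = group_ring u * group_ring v"
  by (rule poly_mapping_eqI) (simp add: lookup_times conv_def)

lemma lookup_times_eq_conv: "Poly_Mapping.lookup (X * Y) = conv (Poly_Mapping.lookup X) (Poly_Mapping.lookup Y)"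
  by (simp add: fun_eq_iff lookup_times conv_def)

definition bar :: "('g::{finite,ab_group_add} \<Rightarrow>\<^sub>0 'r::zero) \<Rightarrow> 'g \<Rightarrow>\<^sub>0 'r" where
  "bar X = group_ring (\<lambda>g. Poly_Mapping.lookup X (- g))"

lemma lookup_bar [simp]: "Poly_Mapping.lookup (bar X) g = Poly_Mapping.lookup X (- g)"
  by (simp add: bar_def)

lemma bar_bar: "bar (bar X) = X" by (rule poly_mapping_eqI) simp

lemma bar_times:
  fixes X Y :: "'g::{finite,ab_group_add} \<Rightarrow>\<^sub>0 'r::comm_ring_1"
  shows "bar (X * Y) = bar X * bar Y"
proof (rule poly_mapping_eqI)
  fix g
  show "Poly_Mapping.lookup (bar (X * Y)) g = Poly_Mapping.lookup (bar X * bar Y) g"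
    unfolding lookup_times lookup_bar
    by (rule sum.reindex_bij_witness[of _ uminus uminus]) auto
qed

lemma bar_one: "bar (1 :: 'g::{finite,ab_group_add} \<Rightarrow>\<^sub>0 'r::comm_ring_1) = 1"
  by (rule poly_mapping_eqI) (simp add: lookup_1)

lemma bar_power: "bar (X ^ n) = bar (X :: 'g::{finite,ab_group_add} \<Rightarrow>\<^sub>0 'r::comm_ring_1) ^ n"
  by (induction n) (simp_all add: bar_one bar_times)

text \<open>Lagrange's theorem for a finite commutative group: translation by \<open>g\<close> permutes the factors of the
product of all group elements.\<close>

lemma single_power_card:
  "(Poly_Mapping.single g 1 :: 'g::{finite,ab_group_add} \<Rightarrow>\<^sub>0 'r::comm_ring_1) ^ CARD('g) = 1"
proof -
  let ?s = "\<lambda>g. Poly_Mapping.single g 1 :: 'g \<Rightarrow>\<^sub>0 'r"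
  have mult: "?s g * ?s h = ?s (g + h)" for g h by (simp add: mult_single)
  let ?P = "\<Prod>h\<in>UNIV. ?s h"
  have "?P = (\<Prod>h\<in>UNIV. ?s (g + h))"
    by (rule prod.reindex_bij_witness[of _ "\<lambda>h. g + h" "\<lambda>h. h - g"]) auto
  also have "\<dots> = ?s g ^ CARD('g) * ?P" by (simp add: mult[symmetric] prod.distrib)
  finally have P: "?P = ?s g ^ CARD('g) * ?P" .
  let ?Q = "\<Prod>h\<in>UNIV. ?s (- h)"
  have "?P * ?Q = (\<Prod>h\<in>UNIV. ?s h * ?s (- h))" by (simp add: prod.distrib)
  also have "\<dots> = 1" by (simp add: mult)
  finally have "?P * ?Q = 1" .
  then have inv: "?P * ?Q = 1" .
  have "1 = ?P * ?Q" by (rule inv[symmetric])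
  also have "\<dots> = ?s g ^ CARD('g) * (?P * ?Q)" by (subst P) (rule mult.assoc)
  also have "\<dots> = ?s g ^ CARD('g)" unfolding inv by simp
  finally show ?thesis ..
qed

context hopf_comodule
begin

definition embed :: "('g \<Rightarrow>\<^sub>0 'k) \<Rightarrow> 'g \<Rightarrow>\<^sub>0 'b" where
  "embed U = group_ring (\<lambda>g. sc (Poly_Mapping.lookup U g) 1)"

lemma lookup_embed [simp]: "Poly_Mapping.lookup (embed U) g = sc (Poly_Mapping.lookup U g) 1"
  by (simp add: embed_def)

lemma embed_times: "embed (U * V) = embed U * embed V"
  by (rule poly_mapping_eqI)
     (simp add: lookup_times scale_sum_left sc_mult_left sc_mult_right mult.commute)

lemma embed_one: "embed 1 = 1" by (rule poly_mapping_eqI) (simp add: lookup_1)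

lemma embed_bar: "embed (bar U) = bar (embed U)" by (rule poly_mapping_eqI) simp

lemma embed_power: "embed (U ^ n) = embed U ^ n" by (induction n) (simp_all add: embed_one embed_times)

lemma embed_inject: "embed U = embed V \<Longrightarrow> U = V"
  by (auto simp: poly_mapping_eq_iff fun_eq_iff)

text \<open>The subring \<open>B \<otimes> D\<close> of \<open>B\<^sub>K[G]\<close>, where \<open>D\<close> is the dual of \<open>A\<close>, described as the linear maps
from \<open>A\<close> to \<open>B\<close>.\<close>

definition tensor_dual :: "('g \<Rightarrow>\<^sub>0 'b) set" where
  "tensor_dual = {X. \<forall>f\<in>A. (\<Sum>g\<in>UNIV. sc (f g) (Poly_Mapping.lookup X g)) \<in> B}"

text \<open>The value of a product at \<open>f\<close> is obtained from \<open>comult f\<close>, which lies in \<open>A \<otimes> A\<close>.\<close>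

lemma tensor_dual_times:
  assumes X: "X \<in> tensor_dual" and Y: "Y \<in> tensor_dual" shows "X * Y \<in> tensor_dual"
  unfolding tensor_dual_def
proof (intro CollectI ballI)
  fix f assume f: "f \<in> A"
  let ?x = "Poly_Mapping.lookup X" and ?y = "Poly_Mapping.lookup Y"
  let ?b = "\<lambda>F. \<Sum>h\<in>UNIV. \<Sum>k\<in>UNIV. sc (F k h) (?x h * ?y k)"
  have "(\<Sum>g\<in>UNIV. sc (f g) (Poly_Mapping.lookup (X * Y) g)) = (\<Sum>g\<in>UNIV. \<Sum>h\<in>UNIV. sc (f g) (?x h * ?y (g - h)))"
    by (simp add: lookup_times scale_sum_right)
  also have "\<dots> = (\<Sum>h\<in>UNIV. \<Sum>g\<in>UNIV. sc (f g) (?x h * ?y (g - h)))" by (rule sum.swap)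
  also have "\<dots> = ?b (comult f)"
  proof (rule sum.cong)
    fix h :: 'g
    show "(\<Sum>g\<in>UNIV. sc (f g) (?x h * ?y (g - h))) = (\<Sum>k\<in>UNIV. sc (comult f k h) (?x h * ?y k))"
      unfolding comult_def
      by (rule sum.reindex_bij_witness[of _ "\<lambda>k. h + k" "\<lambda>g. g - h"]) auto
  qed simp
  also have "\<dots> \<in> B"
  proof -
    have scale: "?b (\<lambda>g. map_scale r (F g)) = sc r (?b F)" for r F
      by (simp add: scale_sum_right map_scale_def)
    have add: "?b (F + F') = ?b F + ?b F'" for F F' :: "'g \<Rightarrow> 'g \<Rightarrow> 'k"
      by (simp add: scale_left_distrib sum.distrib)
    have zero: "?b 0 = 0" by simp
    have "R_submodule (\<lambda>r F g. map_scale r (F g)) {F. ?b F \<in> B}"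
      unfolding R_submodule_def mem_Collect_eq scale add zero
      by (auto intro: B_add B_scale B_zero)
    moreover have "{\<lambda>g. map_scale (a g) a' | a' a. a' \<in> A \<and> a \<in> A} \<subseteq> {F. ?b F \<in> B}"
    proof safe
      fix a a' assume a: "a' \<in> A" "a \<in> A"
      have "?b (\<lambda>g. map_scale (a g) a') = (\<Sum>h\<in>UNIV. sc (a' h) (?x h)) * (\<Sum>k\<in>UNIV. sc (a k) (?y k))"
        by (simp add: sum_product sc_mult_left sc_mult_right map_scale_def mult.commute)
      also have "\<dots> \<in> B" using X Y a by (intro B_mult) (auto simp: tensor_dual_def)
      finally show "?b (\<lambda>g. map_scale (a g) a') \<in> B" .
    qed
    ultimately have "tensor_with map_scale A A \<subseteq> {F. ?b F \<in> B}"
      unfolding tensor_with_def by (rule R_span_minimal)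
    moreover have "comult f \<in> tensor_with map_scale A A" using hopf f by (simp add: hopf_order_def)
    ultimately show ?thesis by auto
  qed
  finally show "(\<Sum>g\<in>UNIV. sc (f g) (Poly_Mapping.lookup (X * Y) g)) \<in> B" .
qed

lemma tensor_dual_one: "1 \<in> tensor_dual"
proof -
  have "(\<Sum>g\<in>UNIV. sc (f g) (Poly_Mapping.lookup (1 :: 'g \<Rightarrow>\<^sub>0 'b) g)) = sc (f 0) 1" for f :: "'g \<Rightarrow> 'k"
  proof -
    have "(\<Sum>g\<in>UNIV. sc (f g) (Poly_Mapping.lookup (1 :: 'g \<Rightarrow>\<^sub>0 'b) g)) = (\<Sum>g\<in>(UNIV :: 'g set). if g = 0 then sc (f 0) (1 :: 'b) else 0)"
      by (rule sum.cong) (auto simp: lookup_1)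
    then show ?thesis by simp
  qed
  then show ?thesis by (simp add: tensor_dual_def B_scale A_values_integral B_one)
qed

lemma tensor_dual_power: "X \<in> tensor_dual \<Longrightarrow> X ^ n \<in> tensor_dual"
  by (induction n) (auto simp: tensor_dual_one tensor_dual_times)

lemma tensor_dual_bar: assumes "X \<in> tensor_dual" shows "bar X \<in> tensor_dual"
  unfolding tensor_dual_def
proof (intro CollectI ballI)
  fix f assume "f \<in> A"
  then have "(\<Sum>g\<in>UNIV. sc (antipode f g) (Poly_Mapping.lookup X g)) \<in> B"
    using assms antipode_closed by (auto simp: tensor_dual_def)
  moreover have "(\<Sum>g\<in>UNIV. sc (antipode f g) (Poly_Mapping.lookup X g)) = (\<Sum>g\<in>UNIV. sc (f g) (Poly_Mapping.lookup (bar X) g))"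
    unfolding antipode_def by (rule sum.reindex_bij_witness[of _ uminus uminus]) auto
  ultimately show "(\<Sum>g\<in>UNIV. sc (f g) (Poly_Mapping.lookup (bar X) g)) \<in> B" by simp
qed

text \<open>As \<open>B\<close> meets \<open>K\<close> in the ring of integers, \<open>B \<otimes> D\<close> meets \<open>K[G]\<close> in \<open>D\<close>.\<close>

lemma tensor_dual_embed: "embed U \<in> tensor_dual \<longleftrightarrow> Poly_Mapping.lookup U \<in> dual A"
proof -
  have "(\<Sum>g\<in>UNIV. sc (f g) (Poly_Mapping.lookup (embed U) g)) = sc (pairing (Poly_Mapping.lookup U) f) 1" for f
    by (simp add: pairing_def scale_sum_left mult.commute)
  moreover have "sc c 1 \<in> B \<longleftrightarrow> algebraic_int c" for c
    using scalar_in_B_integral B_scale B_one by blast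
  ultimately show ?thesis by (simp add: tensor_dual_def dual_iff)
qed

definition rho_map :: "'g \<Rightarrow> ('g \<Rightarrow>\<^sub>0 'b) \<Rightarrow> 'g \<Rightarrow>\<^sub>0 'b" where
  "rho_map k X = group_ring (\<lambda>g. \<rho> (Poly_Mapping.lookup X g) k)"

lemma rho_map_times: "rho_map k (X * Y) = rho_map k X * rho_map k Y"
  by (rule poly_mapping_eqI) (simp add: rho_map_def lookup_times rho_sum rho_mult)

lemma rho_map_one: "rho_map k 1 = 1"
  by (rule poly_mapping_eqI) (simp add: rho_map_def lookup_1 rho_one rho_zero)

lemma rho_map_power: "rho_map k (X ^ n) = rho_map k X ^ n"
  by (induction n) (simp_all add: rho_map_one rho_map_times)

lemma rho_map_embed: "rho_map k (embed U) = embed U"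
  by (rule poly_mapping_eqI) (simp add: rho_map_def rho_scale rho_one)

end

context hopf_galois
begin

lemma invariant_scalar:
  assumes "\<And>g. \<rho> x g = x" shows "\<exists>k. x = sc k 1"
proof -
  obtain d :: int where d: "d \<noteq> 0" "sc (of_int d) x \<in> B"
    using R_order_integral_multiple[OF K B_order] by blast
  obtain k where k: "sc (of_int d) x = sc k 1" using invariants[OF d(2)] assms by (auto simp: rho_scale)
  then have "sc (inverse (of_int d)) (sc (of_int d) x) = sc (inverse (of_int d) * k) 1" by simp
  then have "x = sc (inverse (of_int d) * k) 1" using d(1) by simp
  then show ?thesis ..
qed

lemma invariant_embed:
  assumes "\<And>k. rho_map k X = X" shows "\<exists>U. X = embed U"
proof -
  have "\<rho> (Poly_Mapping.lookup X g) k = Poly_Mapping.lookup X g" for g k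
    using arg_cong[OF assms[of k], of "\<lambda>X. Poly_Mapping.lookup X g"] by (simp add: rho_map_def)
  then have "\<exists>u. Poly_Mapping.lookup X g = sc u 1" for g by (rule invariant_scalar)
  then have "\<exists>u. \<forall>g. Poly_Mapping.lookup X g = sc (u g) 1" by (intro choice allI)
  then obtain u where u: "\<And>g. Poly_Mapping.lookup X g = sc (u g) 1" by blast
  have "X = embed (group_ring u)" by (rule poly_mapping_eqI) (simp add: u)
  then show ?thesis ..
qed

end

section \<open>Resolvents and norms\<close>

locale hopf_torsor = hopf_comodule A sc B \<rho> + hopf_integral A l
  for A :: "('g::{finite,ab_group_add} \<Rightarrow> 'k::field_char_0) set"
    and sc :: "'k \<Rightarrow> 'b::comm_ring_1 \<Rightarrow> 'b" and B \<rho> l +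
  assumes phs: "principal_homogeneous_space sc B \<rho> A"
begin

sublocale hopf_galois A sc B \<rho>
  by unfold_locales (rule invariant_is_scalar[OF phs])

interpretation A: hopf_galois A map_scale A comult by (rule hopf_galois_regular)

context
  fixes b assumes b: "cyclic b"
begin

lemma b_in: "b \<in> B" using b by (simp add: cyclic_def)

text \<open>The Gram element of the trace form of \<open>B\<close> with respect to the generator \<open>b\<close>, scaled so that the
corresponding element of \<open>A\<close> for the generator \<open>l\<delta>\<close> is \<open>1\<close>.\<close>

definition theta :: "'g \<Rightarrow> 'k" where
  "theta k = inverse (l\<^sup>2) * alg_trace sc (b * \<rho> b k)"

lemma sum_orbit_products: "(\<Sum>h\<in>UNIV. \<rho> b h * \<rho> b (h + k)) = sc (l\<^sup>2 * theta k) 1"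
proof -
  have "(\<Sum>h\<in>UNIV. \<rho> b h * \<rho> b (h + k)) = ac 1 (b * \<rho> b k)"
    by (simp add: act_def rho_mult rho_rho)
  then show ?thesis using norm_eq_trace[OF b] l_nonzero by (simp add: theta_def mult.assoc[symmetric])
qed

definition resolvent :: "'g \<Rightarrow>\<^sub>0 'b" where
  "resolvent = group_ring (\<lambda>g. sc (inverse l) (\<rho> b (- g)))"

text \<open>Stated for a general function \<open>c\<close> in place of \<open>\<rho> b\<close>, since it is also needed for the image of the
resolvent under a ring homomorphism of coefficients.\<close>

lemma twisted_resolvent_norm:
  assumes "\<And>k. (\<Sum>h\<in>UNIV. c h * c (h + k)) = sc (l\<^sup>2 * theta k) 1"
  defines "X \<equiv> group_ring (\<lambda>g. sc (inverse l) (c (- g)))"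
  shows "X * bar X = embed (group_ring theta)"
proof (rule poly_mapping_eqI)
  fix k
  have "Poly_Mapping.lookup (X * bar X) k = (\<Sum>h\<in>UNIV. sc (inverse l * inverse l) (c (- h) * c (k - h)))"
    by (simp add: X_def lookup_times sc_mult_left sc_mult_right)
  also have "\<dots> = (\<Sum>h\<in>UNIV. sc (inverse l * inverse l) (c h * c (h + k)))"
    by (rule sum.reindex_bij_witness[of _ uminus uminus]) (auto simp: add.commute)
  also have "\<dots> = sc (inverse l * inverse l) (sc (l\<^sup>2 * theta k) 1)"
    unfolding assms(1)[symmetric] by (simp add: scale_sum_right)
  also have "\<dots> = sc (inverse l * inverse l * l\<^sup>2 * theta k) 1" by (simp add: mult.assoc)
  also have "inverse l * inverse l * l\<^sup>2 = 1" using l_nonzero by (simp add: power2_eq_square field_simps)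
  finally show "Poly_Mapping.lookup (X * bar X) k = Poly_Mapping.lookup (embed (group_ring theta)) k" by simp
qed

lemma resolvent_norm: "resolvent * bar resolvent = embed (group_ring theta)"
  unfolding resolvent_def by (rule twisted_resolvent_norm[OF sum_orbit_products])

text \<open>Here the self-duality of \<open>A\<close> is used: \<open>l\<^sup>-\<^sup>1 f\<close> acts on \<open>B\<close>.\<close>

lemma resolvent_in: "resolvent \<in> tensor_dual"
  unfolding tensor_dual_def
proof (intro CollectI ballI)
  fix f assume f: "f \<in> A"
  have "(\<Sum>g\<in>UNIV. sc (f g) (Poly_Mapping.lookup resolvent g)) = (\<Sum>g\<in>UNIV. sc (inverse l * f (- g)) (\<rho> b g))"
    unfolding resolvent_def lookup_GR
    by (rule sum.reindex_bij_witness[of _ uminus uminus]) (auto simp: mult.commute)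
  also have "\<dots> = ac (map_scale (inverse l) (antipode f)) b"
    by (simp add: act_def map_scale_def antipode_def)
  also have "\<dots> \<in> B" by (intro act_closed A_subset_dual antipode_closed f b_in)
  finally show "(\<Sum>g\<in>UNIV. sc (f g) (Poly_Mapping.lookup resolvent g)) \<in> B" .
qed

lemma bar_theta: "bar (group_ring theta) = group_ring theta"
proof (rule embed_inject)
  show "embed (bar (group_ring theta)) = embed (group_ring theta)"
    unfolding embed_bar resolvent_norm[symmetric] bar_times bar_bar by (rule mult.commute)
qed

lemma rho_map_resolvent: "rho_map k resolvent = resolvent * Poly_Mapping.single k 1"
proof (rule poly_mapping_eqI)
  fix g
  have "Poly_Mapping.lookup (resolvent * Poly_Mapping.single k 1) g =
      (\<Sum>h\<in>UNIV. if h = g - k then Poly_Mapping.lookup resolvent (g - k) else 0)"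
    unfolding lookup_times by (rule sum.cong) (auto simp: lookup_single when_def)
  also have "\<dots> = Poly_Mapping.lookup resolvent (g - k)" by simp
  finally show "Poly_Mapping.lookup (rho_map k resolvent) g = Poly_Mapping.lookup (resolvent * Poly_Mapping.single k 1) g"
    by (simp add: rho_map_def resolvent_def rho_scale rho_rho)
qed

text \<open>The action on coefficients multiplies the resolvent by a group element, whose power with the order
of \<open>G\<close> as exponent is \<open>1\<close>.\<close>

lemma resolvent_power: "\<exists>W. resolvent ^ CARD('g) = embed W \<and> Poly_Mapping.lookup W \<in> dual A"
proof -
  have "rho_map k (resolvent ^ CARD('g)) = resolvent ^ CARD('g)" for k
    by (simp add: rho_map_power rho_map_resolvent power_mult_distrib single_power_card)
  then obtain W where W: "resolvent ^ CARD('g) = embed W" using invariant_embed by blast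
  then have "Poly_Mapping.lookup W \<in> dual A" using tensor_dual_power[OF resolvent_in] tensor_dual_embed by metis
  then show ?thesis using W by blast
qed

text \<open>Write \<open>\<psi>\<close> as the coaction followed by a ring homomorphism \<open>j\<close> of \<open>B\<close>, and let \<open>Y\<close> be the resolvent
with \<open>j\<close> applied to its coefficients. As \<open>\<theta>\<close> has scalar coefficients, it is the norm of \<open>Y\<close> as
well. The expression of the generator \<open>l\<delta>\<close> by values of \<open>\<psi>\<close> says precisely that \<open>Y\<close> has an
inverse in \<open>B \<otimes> D\<close>. So \<open>\<theta>\<close> has an inverse there, which is invariant because inverses are unique,
and therefore lies in \<open>D\<close>.\<close>

lemma theta_unit: "\<exists>V. group_ring theta * V = 1 \<and> Poly_Mapping.lookup V \<in> dual A"
proof (rule phs_translation[OF phs])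
  fix \<psi>
  assume add: "\<And>x y g. x \<in> B \<Longrightarrow> y \<in> B \<Longrightarrow> \<psi> (x + y) g = \<psi> x g + \<psi> y g"
    and mult: "\<And>x y g. x \<in> B \<Longrightarrow> y \<in> B \<Longrightarrow> \<psi> (x * y) g = \<psi> x g * \<psi> y g"
    and scale: "\<And>r x g. algebraic_int r \<Longrightarrow> x \<in> B \<Longrightarrow> \<psi> (sc r x) g = sc r (\<psi> x g)"
    and one: "\<And>g. \<psi> 1 g = 1"
    and equi: "\<And>x g h. x \<in> B \<Longrightarrow> \<psi> (\<rho> x g) h = \<psi> x (h + g)"
    and surj: "\<And>a. a \<in> A \<Longrightarrow> \<exists>x. set_mset x \<subseteq> B \<times> B \<and> (\<forall>g. sc (a g) 1 = (\<Sum>(m,n)\<in>#x. m * \<psi> n g))"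
  have zero: "\<psi> 0 g = 0" for g using scale[of 0 0 g] B_zero by simp
  have sum: "\<psi> (\<Sum>i\<in>I. f i) g = (\<Sum>i\<in>I. \<psi> (f i) g)" if "\<And>i. i \<in> I \<Longrightarrow> f i \<in> B" for I :: "'g set" and f g
    using that by (induction I rule: infinite_finite_induct) (auto simp: zero add B_sum)
  have int: "algebraic_int (of_int n :: 'k)" for n by (rule int_imp_algebraic_int) auto
  (* The homomorphism is linear over the ring of integers only, so denominators
     have to be cleared before it is applied to n = coords b n \<cdot> b. *)
  have expand: "\<psi> n g = (\<Sum>h\<in>UNIV. sc (coords b n h) (\<psi> b (g + h)))" if n: "n \<in> B" for n g
  proof -
    obtain D :: int where D: "D \<noteq> 0" and Di: "\<And>h. algebraic_int (of_int D * coords b n h)"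
      using common_integral_multiple[OF K, of "coords b n"] by blast
    have "n = (\<Sum>h\<in>UNIV. sc (coords b n h) (\<rho> b h))"
      using act_coords[OF b, of n] by (simp add: act_def)
    then have "sc (of_int D) n = sc (of_int D) (\<Sum>h\<in>UNIV. sc (coords b n h) (\<rho> b h))" by (rule arg_cong)
    also have "\<dots> = (\<Sum>h\<in>UNIV. sc (of_int D * coords b n h) (\<rho> b h))" by (simp add: scale_sum_right)
    finally have "\<psi> (sc (of_int D) n) g = (\<Sum>h\<in>UNIV. sc (of_int D * coords b n h) (\<psi> b (g + h)))"
      using Di by (simp add: sum scale rho_closed b_in B_scale equi)
    then have "sc (of_int D) (\<psi> n g) = sc (of_int D) (\<Sum>h\<in>UNIV. sc (coords b n h) (\<psi> b (g + h)))"
      using scale[OF int n] by (simp add: scale_sum_right)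
    then show ?thesis using D by (simp add: scale_left_imp_eq)
  qed
  obtain x where x: "set_mset x \<subseteq> B \<times> B" "\<And>g. sc (generator g) 1 = (\<Sum>(m,n)\<in>#x. m * \<psi> n g)"
    using surj[OF generator_in] by blast
  define s where "s h = (\<Sum>(m,n)\<in>#x. sc (coords b n h) m)" for h
  have swap: "(\<Sum>h\<in>UNIV. \<Sum>p\<in>#y. F p h) = (\<Sum>p\<in>#y. \<Sum>h\<in>UNIV. F p h)"
    for F :: "'b \<times> 'b \<Rightarrow> 'g \<Rightarrow> 'b" and y
    by (induction y) (auto simp: sum.distrib)
  have s_in: "group_ring s \<in> tensor_dual"
    unfolding tensor_dual_def
  proof (intro CollectI ballI)
    fix f assume f: "f \<in> A"
    have "(\<Sum>h\<in>UNIV. sc (f h) (s h)) = (\<Sum>p\<in>#x. sc (pairing (coords b (snd p)) f) (fst p))"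
    proof -
      have "sc (f h) (s h) = (\<Sum>p\<in>#x. sc (coords b (snd p) h * f h) (fst p))" for h
        unfolding s_def case_prod_unfold by (induction x) (auto simp: scale_right_distrib mult.commute)
      then show ?thesis by (simp add: swap pairing_def scale_sum_left)
    qed
    also have "\<dots> \<in> B" using x(1)
    proof (induction x)
      case (add p x)
      obtain v where v: "v \<in> dual A" "snd p = ac v b" using add.prems b unfolding cyclic_def by force
      then have "pairing (coords b (snd p)) f = pairing v f" by (simp add: coords_act[OF b])
      then show ?case using add v(1) f by (auto simp: dual_iff intro!: B_add B_scale)
    qed (simp add: B_zero)
    finally show "(\<Sum>h\<in>UNIV. sc (f h) (Poly_Mapping.lookup (group_ring s) h)) \<in> B" by simp
  qed
  have s_eq: "(\<Sum>h\<in>UNIV. s h * \<psi> b (g + h)) = sc (generator g) 1" for g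
  proof -
    have "s h * \<psi> b (g + h) = (\<Sum>p\<in>#x. fst p * sc (coords b (snd p) h) (\<psi> b (g + h)))" for h
      unfolding s_def case_prod_unfold
      by (induction x) (auto simp: distrib_right sc_mult_left sc_mult_right)
    then have "(\<Sum>h\<in>UNIV. s h * \<psi> b (g + h)) = (\<Sum>p\<in>#x. fst p * (\<Sum>h\<in>UNIV. sc (coords b (snd p) h) (\<psi> b (g + h))))"
      by (simp add: swap sum_distrib_left)
    also have "\<dots> = (\<Sum>p\<in>#x. fst p * \<psi> (snd p) g)"
    proof (rule arg_cong[where f = sum_mset], rule image_mset_cong)
      fix p assume "p \<in># x"
      then have "snd p \<in> B" using x(1) by auto
      then show "fst p * (\<Sum>h\<in>UNIV. sc (coords b (snd p) h) (\<psi> b (g + h))) = fst p * \<psi> (snd p) g"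
        by (simp add: expand[symmetric])
    qed
    finally show ?thesis using x(2)[of g] by (simp add: case_prod_unfold)
  qed
  define Y where "Y = group_ring (\<lambda>g. sc (inverse l) (\<psi> b (- g)))"
  have SY: "group_ring s * Y = 1"
  proof (rule poly_mapping_eqI)
    fix k
    have "Poly_Mapping.lookup (group_ring s * Y) k = (\<Sum>h\<in>UNIV. sc (inverse l) (s h * \<psi> b (- k + h)))"
      by (simp add: lookup_times Y_def sc_mult_right)
    also have "\<dots> = sc (inverse l * generator (- k)) 1"
      using s_eq[of "- k"] by (simp add: scale_sum_right[symmetric])
    finally show "Poly_Mapping.lookup (group_ring s * Y) k = Poly_Mapping.lookup 1 k"
      using l_nonzero by (auto simp: generator_def map_scale_def gr_elem_def lookup_1)
  qed
  have YY: "Y * bar Y = embed (group_ring theta)"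
    unfolding Y_def
  proof (rule twisted_resolvent_norm)
    fix k
    have "(\<Sum>h\<in>UNIV. \<psi> b h * \<psi> b (h + k)) = \<psi> (\<Sum>h\<in>UNIV. \<rho> b h * \<rho> b (h + k)) 0"
      by (simp add: sum mult rho_closed b_in B_mult equi)
    also have "\<dots> = \<psi> (sc (l\<^sup>2 * theta k) 1) 0" by (simp add: sum_orbit_products)
    also have "\<dots> = sc (l\<^sup>2 * theta k) 1"
    proof -
      have "sc (l\<^sup>2 * theta k) 1 \<in> B"
        unfolding sum_orbit_products[symmetric] by (intro B_sum B_mult rho_closed b_in)
      then show ?thesis using scale[OF scalar_in_B_integral B_one] one by simp
    qed
    finally show "(\<Sum>h\<in>UNIV. \<psi> b h * \<psi> b (h + k)) = sc (l\<^sup>2 * theta k) 1" .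
  qed
  define X where "X = group_ring s * bar (group_ring s)"
  have "X * embed (group_ring theta) = (group_ring s * Y) * bar (group_ring s * Y)"
    unfolding X_def YY[symmetric] bar_times by (simp only: mult_ac)
  then have X1: "X * embed (group_ring theta) = 1" by (simp add: SY bar_one)
  have "rho_map k X = X" for k
  proof -
    have "rho_map k X * embed (group_ring theta) = 1"
      using arg_cong[OF X1, of "rho_map k"] by (simp add: rho_map_times rho_map_embed rho_map_one)
    then have "X = X * (rho_map k X * embed (group_ring theta))" by simp
    also have "\<dots> = rho_map k X * (X * embed (group_ring theta))" by (simp only: mult_ac)
    finally show ?thesis using X1 by simp
  qed
  then obtain V where V: "X = embed V" using invariant_embed by blast
  have "Poly_Mapping.lookup V \<in> dual A"
    unfolding tensor_dual_embed[symmetric] V[symmetric] X_def by (intro tensor_dual_times tensor_dual_bar s_in)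
  moreover have "embed (group_ring theta * V) = embed 1"
    using X1 V by (simp add: embed_times embed_one mult.commute)
  then have "group_ring theta * V = 1" by (rule embed_inject)
  ultimately show ?thesis by blast
qed

lemma dual_mult: "Poly_Mapping.lookup U \<in> dual A \<Longrightarrow> Poly_Mapping.lookup V \<in> dual A \<Longrightarrow> Poly_Mapping.lookup (U * V) \<in> dual A"
  by (simp add: lookup_times_eq_conv dual_conv)

lemma dual_one: "Poly_Mapping.lookup 1 \<in> dual A"
  by (rule integral_in_dual) (auto simp: lookup_1)

lemma dual_power: "Poly_Mapping.lookup U \<in> dual A \<Longrightarrow> Poly_Mapping.lookup (U ^ n) \<in> dual A"
  by (induction n) (auto simp: dual_mult dual_one)

lemma dual_bar: "Poly_Mapping.lookup U \<in> dual A \<Longrightarrow> Poly_Mapping.lookup (bar U) \<in> dual A"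
  using dual_antipode[of "Poly_Mapping.lookup U"] by (simp add: bar_def antipode_def)

text \<open>With \<open>n = 2m + 1\<close> the order of \<open>G\<close>: \<open>\<theta>\<^sup>n\<close> is the norm of \<open>W\<^sub>0\<close>, the power of the resolvent, and
\<open>\<theta>\<^sup>-\<^sup>2\<^sup>m\<close> is the norm of \<open>\<theta>\<^sup>-\<^sup>m\<close> because \<open>\<theta>\<close> is symmetric.\<close>

lemma theta_is_norm:
  assumes odd: "odd CARD('g)"
  obtains W V where "W * bar W = group_ring theta" "W * V = 1"
    "Poly_Mapping.lookup W \<in> dual A" "Poly_Mapping.lookup V \<in> dual A"
proof -
  obtain W0 where W0: "resolvent ^ CARD('g) = embed W0" "Poly_Mapping.lookup W0 \<in> dual A"
    using resolvent_power by blast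
  obtain V0 where V0: "group_ring theta * V0 = 1" "Poly_Mapping.lookup V0 \<in> dual A"
    using theta_unit by blast
  obtain m where m: "CARD('g) = 2 * m + 1" using odd by (rule oddE)
  have "embed (W0 * bar W0) = embed (group_ring theta ^ CARD('g))"
    unfolding embed_times embed_bar embed_power resolvent_norm[symmetric] W0(1)[symmetric] power_mult_distrib bar_power ..
  then have WW: "W0 * bar W0 = group_ring theta ^ CARD('g)" by (rule embed_inject)
  have "group_ring theta * bar V0 = 1"
    using arg_cong[OF V0(1), of bar] by (simp add: bar_times bar_theta bar_one)
  moreover have "bar V0 * (group_ring theta * V0) = (group_ring theta * bar V0) * V0" by (simp only: mult_ac)
  ultimately have barV: "bar V0 = V0" using V0(1) by simp
  define W where "W = W0 * V0 ^ m"
  have "W * bar W = group_ring theta ^ CARD('g) * (V0 ^ m * V0 ^ m)"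
    unfolding W_def bar_times bar_power barV WW[symmetric] by (simp only: mult_ac)
  also have "\<dots> = group_ring theta * (group_ring theta * V0) ^ (2 * m)"
  proof -
    have "V0 ^ m * V0 ^ m = V0 ^ (2 * m)" by (simp add: mult_2 power_add)
    moreover have "group_ring theta ^ CARD('g) = group_ring theta * group_ring theta ^ (2 * m)" by (simp add: m)
    ultimately show ?thesis by (simp only: power_mult_distrib mult.assoc)
  qed
  finally have W: "W * bar W = group_ring theta" by (simp add: V0(1))
  show ?thesis
  proof (rule that[OF W, of "bar W * V0"])
    have "W * (bar W * V0) = (W * bar W) * V0" by (simp only: mult.assoc)
    then show "W * (bar W * V0) = 1" using W V0(1) by simp
    show W_in: "Poly_Mapping.lookup W \<in> dual A"
      unfolding W_def by (intro dual_mult dual_power W0 V0)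
    show "Poly_Mapping.lookup (bar W * V0) \<in> dual A" by (intro dual_mult dual_bar W_in V0)
  qed
qed

end

end

section \<open>Quadratic spaces\<close>

lemma R_linear_form_sum:
  assumes f: "R_linear_form sc M f" and M: "R_submodule sc M" and I: "\<And>i. i \<in> I \<Longrightarrow> x i \<in> M"
  shows "f (\<Sum>i\<in>I. x i) = (\<Sum>i\<in>I. f (x i))"
proof -
  have add: "\<And>x y. x \<in> M \<Longrightarrow> y \<in> M \<Longrightarrow> f (x + y) = f x + f y" using f by (simp add: R_linear_form_def)
  have "0 \<in> M" using M by (simp add: R_submodule_def)
  then have "f 0 = 0" using add[of 0 0] by simp
  then show ?thesis using I
    by (induction I rule: infinite_finite_induct) (auto simp: add R_submodule_sum[OF M])
qed

text \<open>The property of being a \<open>G\<close>-quadratic space passes along an isometry, except for the module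
properties of the source. So the unimodularity of the trace form of \<open>B\<close> comes from that of \<open>A\<close>.\<close>

lemma G_quadratic_space_transport:
  assumes q': "G_quadratic_space sc' D a' M' q'"
    and iso: "isometry D a M q a' M' q' \<phi>"
    and mod: "is_module D a M" "fin_gen D a M" "locally_free sc D a M"
    and sc: "\<And>r x. algebraic_int r \<Longrightarrow> x \<in> M \<Longrightarrow> sc r x \<in> M \<and> \<phi> (sc r x) = sc' r (\<phi> x)"
    and gr: "\<And>g. gr_elem g \<in> D"
  shows "G_quadratic_space sc D a M q"
proof -
  have bij: "bij_betw \<phi> M M'" and add: "\<And>x y. x \<in> M \<Longrightarrow> y \<in> M \<Longrightarrow> \<phi> (x + y) = \<phi> x + \<phi> y"
    and equi: "\<And>u x. u \<in> D \<Longrightarrow> x \<in> M \<Longrightarrow> \<phi> (a u x) = a' u (\<phi> x)"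
    and form: "\<And>x y. x \<in> M \<Longrightarrow> y \<in> M \<Longrightarrow> q' (\<phi> x) (\<phi> y) = q x y"
    using iso by (auto simp: isometry_def)
  have mem: "\<phi> x \<in> M'" if "x \<in> M" for x using bij that by (auto simp: bij_betw_def)
  have aM: "a u x \<in> M" if "u \<in> D" "x \<in> M" for u x using mod(1) that by (simp add: is_module_def)
  have plus: "x + y \<in> M" if "x \<in> M" "y \<in> M" for x y
  proof -
    have diff: "\<And>x y. x \<in> M \<Longrightarrow> y \<in> M \<Longrightarrow> x - y \<in> M" and "0 \<in> M"
      using mod(1) by (simp_all add: is_module_def)
    then have "x - (0 - y) \<in> M" using that by blast
    then show ?thesis by simp
  qed
  have lin': "\<And>x. x \<in> M' \<Longrightarrow> R_linear_form sc' M' (q' x)" and sym': "\<And>x y. x \<in> M' \<Longrightarrow> y \<in> M' \<Longrightarrow> q' x y = q' y x"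
    and nondeg': "\<And>f. R_linear_form sc' M' f \<Longrightarrow> \<exists>!x. x \<in> M' \<and> (\<forall>y\<in>M'. q' x y = f y)"
    and inv': "\<And>g x y. x \<in> M' \<Longrightarrow> y \<in> M' \<Longrightarrow> q' (a' (gr_elem g) x) (a' (gr_elem g) y) = q' x y"
    using q' by (simp_all add: G_quadratic_space_def)
  have lin: "R_linear_form sc M (q x)" if x: "x \<in> M" for x
  proof -
    note l = lin'[OF mem[OF x], unfolded R_linear_form_def]
    have "q x y \<in> ring_of_integers" if "y \<in> M" for y using l mem form x that by metis
    moreover have "q x (y + z) = q x y + q x z" if "y \<in> M" "z \<in> M" for y z
      unfolding form[OF x plus[OF that], symmetric] form[OF x that(1), symmetric] form[OF x that(2), symmetric]
      using l add mem that by simp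
    moreover have "q x (sc r y) = r * q x y" if "algebraic_int r" "y \<in> M" for r y
    proof -
      have "q x (sc r y) = q' (\<phi> x) (sc' r (\<phi> y))" using form[OF x, of "sc r y"] sc[OF that] by simp
      also have "\<dots> = r * q' (\<phi> x) (\<phi> y)" using l mem that by simp
      finally show ?thesis using form x that by simp
    qed
    ultimately show ?thesis by (simp add: R_linear_form_def)
  qed
  have nondeg: "\<exists>!x. x \<in> M \<and> (\<forall>y\<in>M. q x y = f y)" if f: "R_linear_form sc M f" for f
  proof -
    define p where "p = inv_into M \<phi>"
    have p: "\<And>x. x \<in> M \<Longrightarrow> p (\<phi> x) = x" "\<And>x. x \<in> M' \<Longrightarrow> p x \<in> M" "\<And>x. x \<in> M' \<Longrightarrow> \<phi> (p x) = x"
      unfolding p_def using bij by (auto simp: bij_betw_def inv_into_into f_inv_into_f)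
    have ex: "\<exists>x0\<in>M. x = \<phi> x0" if "x \<in> M'" for x using p(2,3)[OF that] by metis
    note fl = f[unfolded R_linear_form_def]
    have "R_linear_form sc' M' (\<lambda>x. f (p x))"
      unfolding R_linear_form_def
    proof (intro conjI ballI)
      fix x assume "x \<in> M'"
      then show "f (p x) \<in> ring_of_integers" using fl p(2) by blast
    next
      fix x y assume "x \<in> M'" "y \<in> M'"
      then obtain x0 y0 where xy: "x0 \<in> M" "x = \<phi> x0" "y0 \<in> M" "y = \<phi> y0" using ex by blast
      have "p (\<phi> x0 + \<phi> y0) = x0 + y0" unfolding add[OF xy(1,3), symmetric] by (rule p(1)[OF plus[OF xy(1,3)]])
      then show "f (p (x + y)) = f (p x) + f (p y)" using fl xy p(1) by simp
    next
      fix r :: 'a and x assume r: "r \<in> ring_of_integers" and "x \<in> M'"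
      then obtain x0 where x0: "x0 \<in> M" "x = \<phi> x0" using ex by blast
      have "sc r x0 \<in> M" "sc' r (\<phi> x0) = \<phi> (sc r x0)" using sc[of r x0] r x0 by auto
      then have "p (sc' r x) = sc r x0" using p(1)[of "sc r x0"] x0 by simp
      then show "f (p (sc' r x)) = r * f (p x)" using fl x0 p(1) r by simp
    qed
    from nondeg'[OF this] obtain x' where x': "x' \<in> M'" "\<And>y. y \<in> M' \<Longrightarrow> q' x' y = f (p y)"
      and u: "\<And>z. z \<in> M' \<Longrightarrow> (\<And>y. y \<in> M' \<Longrightarrow> q' z y = f (p y)) \<Longrightarrow> z = x'" by blast
    show ?thesis
    proof (rule ex1I[of _ "p x'"], intro conjI ballI)
      show "p x' \<in> M" using p x' by simp
      fix y assume "y \<in> M"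
      then show "q (p x') y = f y" using form[of "p x'" y] p x' mem by simp
    next
      fix z assume z: "z \<in> M \<and> (\<forall>y\<in>M. q z y = f y)"
      have "\<phi> z = x'"
      proof (rule u)
        show "\<phi> z \<in> M'" using z mem by blast
        fix y assume "y \<in> M'"
        then show "q' (\<phi> z) y = f (p y)" using z form[of z "p y"] p by metis
      qed
      then show "z = p x'" using p(1) z by metis
    qed
  qed
  show ?thesis
    unfolding G_quadratic_space_def
  proof (intro conjI ballI allI impI)
    fix x y g assume xy: "x \<in> M" "y \<in> M"
    show "q x y = q y x" using form[OF xy] form[OF xy(2,1)] sym'[OF mem[OF xy(1)] mem[OF xy(2)]] by simp
    have "q (a (gr_elem g) x) (a (gr_elem g) y) = q' (a' (gr_elem g) (\<phi> x)) (a' (gr_elem g) (\<phi> y))"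
      using form[OF aM[OF gr xy(1)] aM[OF gr xy(2)]] equi[OF gr xy(1)] equi[OF gr xy(2)] by metis
    then show "q (a (gr_elem g) x) (a (gr_elem g) y) = q x y"
      using inv'[OF mem[OF xy(1)] mem[OF xy(2)]] form[OF xy] by simp
  qed (fact mod lin nondeg)+
qed

context hopf_integral
begin

interpretation A: hopf_galois A map_scale A comult by (rule hopf_galois_regular)

lemma generator_cyclic: "A.cyclic generator"
  using generator_in regular_cyclic by (auto simp: A.cyclic_def)

lemma trace_form_regular: fixes f f' :: "'g \<Rightarrow> 'k" shows "trace_form map_scale l f f' = inverse l * pairing f f'"
  unfolding trace_form_def alg_trace_regular by (simp add: pairing_def)

lemma scaled_dual: "w \<in> dual A \<Longrightarrow> map_scale l w \<in> A"
  using A.act_closed[OF dual_antipode generator_in, of w]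
  by (simp add: act_generator antipode_def map_scale_def)

text \<open>In terms of a dual basis \<open>u\<^sub>i, e\<^sub>i\<close>, a linear form \<open>f\<close> on \<open>A\<close> is represented by the element
\<open>l \<Sum> f(e\<^sub>i) u\<^sub>i\<close>, which belongs to \<open>A\<close> by self-duality.\<close>

lemma regular_G_quadratic_space:
  "G_quadratic_space map_scale (dual A) (act map_scale comult) A (trace_form map_scale l)"
  unfolding G_quadratic_space_def
proof (intro conjI ballI allI impI)
  show "is_module (dual A) (act map_scale comult) A" by (rule A.dual_module)
  show "fin_gen (dual A) (act map_scale comult) A" by (rule A.cyclic_fin_gen[OF generator_cyclic])
  show "locally_free map_scale (dual A) (act map_scale comult) A"
    by (rule A.cyclic_locally_free[OF generator_cyclic])
next
  fix x assume x: "x \<in> A"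
  have "algebraic_int (inverse l * pairing x y)" if "y \<in> A" for y
    using sum_divisible[OF A_mult[OF x that]] by (simp add: pairing_def)
  then show "R_linear_form map_scale A (trace_form map_scale l x)"
    by (simp add: R_linear_form_def trace_form_regular pairing_add_right pairing_scale_right distrib_left)
  fix y assume "y \<in> A"
  show "trace_form map_scale l x y = trace_form map_scale l y x"
    by (simp add: trace_form_regular pairing_def mult.commute)
  fix g
  have "(\<Sum>h\<in>UNIV. x (h + g) * y (h + g)) = (\<Sum>h\<in>UNIV. x h * y h)"
    by (rule sum.reindex_bij_witness[of _ "\<lambda>h. h - g" "\<lambda>h. h + g"]) auto
  then show "trace_form map_scale l (act map_scale comult (gr_elem g) x) (act map_scale comult (gr_elem g) y) =
      trace_form map_scale l x y"
    by (simp add: A.act_gr_elem trace_form_regular pairing_def comult_def)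
next
  fix f assume f: "R_linear_form map_scale A f"
  obtain n :: nat and u e where ue: "\<And>i. i < n \<Longrightarrow> u i \<in> dual A" "\<And>i. i < n \<Longrightarrow> e i \<in> A"
    "\<And>f y. f y = (\<Sum>i<n. pairing (u i) f * e i y)"
    by (rule dual_basis) blast
  define w where "w = (\<Sum>i<n. map_scale (f (e i)) (u i))"
  have "w \<in> dual A"
    unfolding w_def
  proof (rule R_submodule_sum[OF dual_sub])
    fix i assume "i \<in> {..<n}"
    then have "algebraic_int (f (e i))" "u i \<in> dual A" using f ue by (auto simp: R_linear_form_def)
    then show "map_scale (f (e i)) (u i) \<in> dual A" using dual_sub by (auto simp: R_submodule_def)
  qed
  have w: "pairing w y = f y" if y: "y \<in> A" for y
  proof -
    have p: "algebraic_int (pairing (u i) y)" if "i < n" for i using ue(1)[OF that] y by (auto simp: dual_iff)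
    have "y = (\<Sum>i<n. map_scale (pairing (u i) y) (e i))"
    proof
      fix z
      show "y z = (\<Sum>i<n. map_scale (pairing (u i) y) (e i)) z"
        using ue(3)[of y z] by (simp add: sum_fun_apply map_scale_apply)
    qed
    then have "f y = f (\<Sum>i<n. map_scale (pairing (u i) y) (e i))" by (rule arg_cong)
    also have "\<dots> = (\<Sum>i<n. f (map_scale (pairing (u i) y) (e i)))"
      by (rule R_linear_form_sum[OF f A_sub]) (use p ue in \<open>auto intro: A_scale\<close>)
    also have "\<dots> = (\<Sum>i<n. pairing (u i) y * f (e i))"
      using f p ue by (intro sum.cong) (auto simp: R_linear_form_def)
    also have "\<dots> = (\<Sum>i<n. pairing (map_scale (f (e i)) (u i)) y)"
      by (simp add: pairing_scale_left mult.commute)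
    also have "\<dots> = pairing w y"
      unfolding w_def by (rule pairing_sum_left[symmetric])
    finally show ?thesis ..
  qed
  show "\<exists>!x. x \<in> A \<and> (\<forall>y\<in>A. trace_form map_scale l x y = f y)"
  proof (rule ex1I[of _ "map_scale l w"], intro conjI ballI)
    show "map_scale l w \<in> A" by (rule scaled_dual) fact
    fix y assume "y \<in> A"
    then show "trace_form map_scale l (map_scale l w) y = f y"
      using w l_nonzero by (simp add: trace_form_regular pairing_scale_left)
  next
    fix x assume x: "x \<in> A \<and> (\<forall>y\<in>A. trace_form map_scale l x y = f y)"
    show "x = map_scale l w"
    proof
      fix k
      let ?y = "map_scale l (gr_elem k) :: 'g \<Rightarrow> 'k"
      have y: "?y \<in> A" by (rule scaled_dual[OF gr_elem_in_dual])
      have "pairing v ?y = l * v k" for v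
      proof -
        have "pairing v ?y = (\<Sum>g\<in>UNIV. if g = k then l * v k else 0)"
          unfolding pairing_def by (rule sum.cong) (auto simp: map_scale_def gr_elem_def)
        then show ?thesis by simp
      qed
      then have "x k = f ?y" "l * w k = f ?y"
        using x y w[OF y] l_nonzero by (auto simp: trace_form_regular mult.assoc[symmetric])
      then show "x k = map_scale l w k" by (simp add: map_scale_apply)
    qed
  qed
qed

lemma trace_form_generator:
  "trace_form map_scale l (act map_scale comult u generator) (act map_scale comult v generator) =
     l * Poly_Mapping.lookup (group_ring u * bar (group_ring v)) 0"
proof -
  have "pairing (map_scale l (antipode u)) (map_scale l (antipode v)) = (\<Sum>g\<in>UNIV. l * (l * (u g * v g)))"
    unfolding pairing_def map_scale_def antipode_def
    by (rule sum.reindex_bij_witness[of _ uminus uminus]) auto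
  also have "\<dots> = l * (l * Poly_Mapping.lookup (group_ring u * bar (group_ring v)) 0)"
    by (simp add: lookup_times sum_distrib_left)
  finally show ?thesis using l_nonzero
    by (simp add: trace_form_regular act_generator mult.assoc[symmetric])
qed

end

context hopf_torsor
begin

interpretation A: hopf_galois A map_scale A comult by (rule hopf_galois_regular)

text \<open>The translate of \<open>b\<close> by \<open>g\<close> times the one by \<open>h\<close> has the same trace as \<open>b\<close> times its translate by
\<open>h - g\<close>; collecting terms by \<open>g - h\<close> gives a convolution.\<close>

lemma trace_form_cyclic:
  assumes b: "cyclic b"
  shows "trace_form sc l (ac u b) (ac v b) = l * Poly_Mapping.lookup (group_ring u * bar (group_ring v) * group_ring (theta b)) 0"
proof -
  have tr: "alg_trace sc (\<rho> b g * \<rho> b h) = l\<^sup>2 * theta b (h - g)" for g h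
  proof -
    have "\<rho> b g * \<rho> b h = \<rho> (b * \<rho> b (h - g)) g" by (simp add: rho_mult rho_rho)
    then have "alg_trace sc (\<rho> b g * \<rho> b h) = alg_trace sc (b * \<rho> b (h - g))"
      by (simp add: alg_trace_rho[OF b])
    then show ?thesis using l_nonzero by (simp add: theta_def[OF b])
  qed
  have "ac u b * ac v b = (\<Sum>g\<in>UNIV. \<Sum>h\<in>UNIV. sc (u g * v h) (\<rho> b g * \<rho> b h))"
    by (simp add: act_def sum_product sc_mult_left sc_mult_right mult.commute)
  then have "alg_trace sc (ac u b * ac v b) = (\<Sum>g\<in>UNIV. \<Sum>h\<in>UNIV. u g * v h * (l\<^sup>2 * theta b (h - g)))"
    by (simp add: alg_trace_sum[OF b] alg_trace_scale[OF b] tr)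
  also have "\<dots> = (\<Sum>g\<in>UNIV. \<Sum>k\<in>UNIV. l\<^sup>2 * (u g * v (g - k) * theta b (- k)))"
  proof (rule sum.cong)
    fix g :: 'g
    show "(\<Sum>h\<in>UNIV. u g * v h * (l\<^sup>2 * theta b (h - g))) = (\<Sum>k\<in>UNIV. l\<^sup>2 * (u g * v (g - k) * theta b (- k)))"
      by (rule sum.reindex_bij_witness[of _ "\<lambda>k. g - k" "\<lambda>h. g - h"]) auto
  qed simp
  also have "\<dots> = (\<Sum>k\<in>UNIV. \<Sum>g\<in>UNIV. l\<^sup>2 * (u g * v (g - k) * theta b (- k)))" by (rule sum.swap)
  also have "\<dots> = l\<^sup>2 * Poly_Mapping.lookup (group_ring u * bar (group_ring v) * group_ring (theta b)) 0"
  proof -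
    have "Poly_Mapping.lookup (group_ring u * bar (group_ring v) * group_ring (theta b)) 0 =
        (\<Sum>k\<in>UNIV. (\<Sum>g\<in>UNIV. u g * v (g - k)) * theta b (- k))"
      unfolding lookup_times by simp
    then show ?thesis by (simp add: sum_distrib_left sum_distrib_right mult.assoc)
  qed
  finally show ?thesis using l_nonzero by (simp add: trace_form_def power2_eq_square)
qed

text \<open>By \<open>trace_form_generator\<close> and \<open>trace_form_cyclic\<close>, multiplying coordinates by \<open>W\<close> replaces
\<open>W (bar W)\<close> by \<open>\<theta>\<close>; and \<open>V = W\<^sup>-\<^sup>1\<close> makes the map bijective.\<close>

lemma isometry_of_norm:
  assumes b: "cyclic b" and W: "W * bar W = group_ring (theta b)" "W * V = 1"
    "Poly_Mapping.lookup W \<in> dual A" "Poly_Mapping.lookup V \<in> dual A"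
  defines "\<phi> \<equiv> \<lambda>x. act map_scale comult (conv (coords b x) (Poly_Mapping.lookup W)) generator"
  shows "isometry (dual A) ac B (trace_form sc l) (act map_scale comult) A (trace_form map_scale l) \<phi>"
  unfolding isometry_def
proof (intro conjI ballI)
  have c_in: "coords b x \<in> dual A" if x: "x \<in> B" for x
  proof -
    obtain v where "v \<in> dual A" "x = ac v b" using b x unfolding cyclic_def by blast
    then show ?thesis by (simp add: coords_act[OF b])
  qed
  show "bij_betw \<phi> B A"
  proof (rule bij_betw_byWitness)
    let ?p = "\<lambda>y. ac (conv (A.coords generator y) (Poly_Mapping.lookup V)) b"
    note gc = generator_cyclic
    have assoc: "conv (conv u (Poly_Mapping.lookup X)) (Poly_Mapping.lookup Y) = u" if "X * Y = 1" for u X Y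
    proof -
      have "group_ring (conv (conv u (Poly_Mapping.lookup X)) (Poly_Mapping.lookup Y)) = group_ring u * (X * Y)"
        by (simp only: group_ring_conv group_ring_lookup mult.assoc)
      also have "\<dots> = group_ring u" unfolding that by (rule mult_1_right)
      finally show ?thesis by (simp only: group_ring_inject)
    qed
    have VW: "V * W = 1" using W(2) by (simp add: mult.commute)
    show "\<forall>x\<in>B. ?p (\<phi> x) = x"
      by (simp add: \<phi>_def A.coords_act[OF gc] assoc[OF W(2)] act_coords[OF b])
    show "\<forall>y\<in>A. \<phi> (?p y) = y"
      by (simp add: \<phi>_def coords_act[OF b] assoc[OF VW] A.act_coords[OF gc])
    show "\<phi> ` B \<subseteq> A"
      using A.act_closed[OF dual_conv[OF c_in W(3)] generator_in] by (simp add: \<phi>_def image_subset_iff)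
    have "A.coords generator y \<in> dual A" if y: "y \<in> A" for y
    proof -
      obtain v where "v \<in> dual A" "y = act map_scale comult v generator"
        using gc y unfolding A.cyclic_def by blast
      then show ?thesis by (simp add: A.coords_act[OF gc])
    qed
    then show "?p ` A \<subseteq> B"
      using act_closed[OF dual_conv[OF _ W(4)] b_in[OF b]] by (simp add: image_subset_iff)
  qed
next
  fix x y
  have "conv (u + v) w = conv u w + conv v w" for u v w :: "'g \<Rightarrow> 'k"
    by (simp add: fun_eq_iff conv_def distrib_right sum.distrib)
  then show "\<phi> (x + y) = \<phi> x + \<phi> y"
    by (simp only: \<phi>_def coords_add[OF b] A.act_add_left)
  have "trace_form map_scale l (\<phi> x) (\<phi> y) =
      l * Poly_Mapping.lookup (group_ring (coords b x) * bar (group_ring (coords b y)) * (W * bar W)) 0"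
    unfolding \<phi>_def trace_form_generator group_ring_conv bar_times group_ring_lookup by (simp only: mult_ac)
  also have "\<dots> = trace_form sc l (ac (coords b x) b) (ac (coords b y) b)"
    unfolding W(1) trace_form_cyclic[OF b] ..
  finally show "trace_form map_scale l (\<phi> x) (\<phi> y) = trace_form sc l x y" by (simp only: act_coords[OF b])
next
  fix u x
  have "ac u x = ac (conv u (coords b x)) b" by (simp add: act_conv act_coords[OF b])
  then have "coords b (ac u x) = conv u (coords b x)" by (simp add: coords_act[OF b])
  moreover have "conv (conv u v) w = conv u (conv v w)" for u v w :: "'g \<Rightarrow> 'k"
    using mult.assoc[of "group_ring u" "group_ring v" "group_ring w"] by (simp only: group_ring_conv[symmetric] group_ring_inject)
  ultimately show "\<phi> (ac u x) = act map_scale comult u (\<phi> x)"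
    by (simp add: \<phi>_def A.act_conv)
qed

lemma isomorphic_iff_free:
  assumes odd: "odd CARD('g)"
  shows "isomorphic_G_quadratic_spaces (dual A) sc ac B (trace_form sc l)
           map_scale (act map_scale comult) A (trace_form map_scale l)
         \<longleftrightarrow> free_module (dual A) ac B"
proof
  assume "free_module (dual A) ac B"
  then obtain b where b: "cyclic b" using free_imp_cyclic by blast
  obtain W V where W: "W * bar W = group_ring (theta b)" "W * V = 1"
    "Poly_Mapping.lookup W \<in> dual A" "Poly_Mapping.lookup V \<in> dual A"
    using theta_is_norm[OF b odd] by blast
  let ?\<phi> = "\<lambda>x. act map_scale comult (conv (coords b x) (Poly_Mapping.lookup W)) generator"
  have iso: "isometry (dual A) ac B (trace_form sc l) (act map_scale comult) A (trace_form map_scale l) ?\<phi>"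
    by (rule isometry_of_norm[OF b W])
  have scale: "?\<phi> (sc r x) = map_scale r (?\<phi> x)" for r x
  proof -
    have "conv (coords b (sc r x)) (Poly_Mapping.lookup W) = map_scale r (conv (coords b x) (Poly_Mapping.lookup W))"
      by (simp add: fun_eq_iff conv_def map_scale_def coords_scale[OF b] sum_distrib_left mult.assoc)
    then show ?thesis by (simp add: A.act_scale_left)
  qed
  have "G_quadratic_space sc (dual A) ac B (trace_form sc l)"
    by (rule G_quadratic_space_transport[OF regular_G_quadratic_space iso dual_module
          cyclic_fin_gen[OF b] cyclic_locally_free[OF b]])
       (auto simp: B_scale scale gr_elem_in_dual)
  then show "isomorphic_G_quadratic_spaces (dual A) sc ac B (trace_form sc l)
           map_scale (act map_scale comult) A (trace_form map_scale l)"
    using regular_G_quadratic_space iso unfolding isomorphic_G_quadratic_spaces_def by blast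
next
  assume "isomorphic_G_quadratic_spaces (dual A) sc ac B (trace_form sc l)
           map_scale (act map_scale comult) A (trace_form map_scale l)"
  then obtain \<phi> where bij: "bij_betw \<phi> B A"
    and equi: "\<And>u x. u \<in> dual A \<Longrightarrow> x \<in> B \<Longrightarrow> \<phi> (ac u x) = act map_scale comult u (\<phi> x)"
    unfolding isomorphic_G_quadratic_spaces_def isometry_def by blast
  obtain b where b: "b \<in> B" "\<phi> b = generator"
    using bij generator_in unfolding bij_betw_def by (metis imageE)
  have inj: "x = y" if "x \<in> B" "y \<in> B" "\<phi> x = \<phi> y" for x y
    using bij that unfolding bij_betw_def inj_on_def by blast
  have "cyclic b"
    unfolding cyclic_def
  proof (intro conjI ballI)
    fix m assume m: "m \<in> B"
    have "m = ac v b \<longleftrightarrow> \<phi> m = act map_scale comult v generator" if "v \<in> dual A" for v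
      using equi[OF that b(1)] b(2) inj[OF m act_closed[OF that b(1)]] by auto
    moreover have "\<phi> m \<in> A" using bij m by (auto simp: bij_betw_def)
    then have "\<exists>!v. v \<in> dual A \<and> \<phi> m = act map_scale comult v generator" by (rule regular_cyclic)
    ultimately show "\<exists>!v. v \<in> dual A \<and> m = ac v b" by (simp cong: conj_cong)
  qed (fact b(1))
  then show "free_module (dual A) ac B" by (rule cyclic_free)
qed

end

theorem theorem1p8:
  fixes A :: "('g::{finite,ab_group_add} \<Rightarrow> 'k::field_char_0) set"
    and sc :: "'k \<Rightarrow> 'b::comm_ring_1 \<Rightarrow> 'b"
    and B :: "'b set"
    and \<rho> :: "'b \<Rightarrow> 'g \<Rightarrow> 'b"
    and \<alpha> :: 'k
  assumes "number_field TYPE('k)"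
    and "odd (CARD('g))"
    and "hopf_order A"
    and "\<alpha> \<in> ring_of_integers"
    and "counit ` integrals A = {\<alpha>\<^sup>2 * r | r. r \<in> ring_of_integers}"
    and "principal_homogeneous_space sc B \<rho> A"
  shows "isomorphic_G_quadratic_spaces (dual A)
           sc (act sc \<rho>) B (trace_form sc (\<alpha>\<^sup>2))
           map_scale (act map_scale comult) A (trace_form map_scale (\<alpha>\<^sup>2))
         \<longleftrightarrow> free_module (dual A) (act sc \<rho>) B"
proof -
  interpret hopf_torsor A sc B \<rho> "\<alpha>\<^sup>2"
    using assms by unfold_locales (auto simp: principal_homogeneous_space_def)
  show ?thesis using assms(2) by (rule isomorphic_iff_free)
qed

end
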